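(* Assume that $\mathcal{D}(A)\subset\mathcal{D}(Q^{-1/2})$, $|(-A)^{1/2}Q^{1/2}|_{\mathcal{L}_2(H)}<\infty$ and $|Q^{-1/2}(-A)^{-1}|_{\mathcal{L}(H)}<\infty$. Assume that $F\colon H\to H$ is Fréchet differentiable and that there exist $L_F,L>0$ such that $|F(u)-F(v)|\le L_F|u-v|$ for $u,v\in H$, $|F(u)|_{\dot H^1}\le L(1+|u|_{\dot H^1})$ for $u\in\dot H^1$, and $|F'(u)v|_{\dot H^2}\le L(1+|u|_{\dot H^2}^2)|v|_{\dot H^2}$ for $u,v\in\dot H^2$. Assume moreover that $F(0)=0$ and $L_F<\lambda_1$. Let $n\in\mathbb{N}^+$. Then for any $\alpha\ge0$, $\delta>0$ and $\gamma>0$, there exists $\varepsilon_0>0$ such that $$\mu^{\varepsilon,n}(\{y\in H_n:\rho^H(y,K^n(\alpha))\ge\delta\})\le\exp\Big(-\frac{\alpha-\gamma}{\varepsilon^2}\Big),\quad 0<\varepsilon\le\varepsilon_0,$$ where $K^n(\alpha)=\{v\in H_n:V^n(v)\le\alpha\}$ and $\rho^H(u,U):=\inf_{u'\in U}|u-u'|$.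
   Context: $H:=L^2((0,1);\mathbb{R})$ with inner product $\langle\cdot,\cdot\rangle$ and norm $|\cdot|$; $\mathcal{L}(H)$ and $\mathcal{L}_2(H)$ are the bounded and the Hilbert–Schmidt operators on $H$. $A$ is the Dirichlet Laplacian on $(0,1)$, $\mathcal{D}(A)=H_0^1\cap H^2$; $e_i(\xi)=\sqrt2\sin(i\pi\xi)$ is an orthonormal basis of $H$ with $-Ae_i=\lambda_ie_i$, $\lambda_i=\pi^2i^2$. For $\gamma\in\mathbb{R}$, $\dot H^\gamma:=\mathcal{D}((-A)^{\gamma/2})$ with norm $|u|_{\dot H^\gamma}=|(-A)^{\gamma/2}u|$. $Q$ is a self-adjoint, positive definite bounded linear operator on $H$ with $Qe_i=q_ie_i$, $q_i>0$; $Q^{-1/2}\colon Q^{1/2}(H)\to H$ is the inverse of $Q^{1/2}$ and $\mathcal{D}(Q^{-1/2})=Q^{1/2}(H)$. $W(t)=\sum_i\beta_i(t)e_i$ is a cylindrical Wiener process, $\beta_i$ independent standard real Brownian motions. For $n\in\mathbb{N}^+$: $H_n:=\mathrm{span}\{e_1,\dots,e_n\}$, $P_n$ is the orthogonal projection of $H$ onto $H_n$, $A_n:=P_nA$ (on $H_n$), $F_n:=P_nF$, $Q_n^{1/2}:=P_nQ^{1/2}$, $W_n:=P_nW$. For $y\in H_n$, $\varepsilon>0$, $X_y^{\varepsilon,n}$ is the unique mild solution of $dX=(A_nX+F_n(X))dt+\varepsilon Q_n^{1/2}dW_n$, $X(0)=y$. The measure $\mu^{\varepsilon,n}$: the time averages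 $\mu_t^{\varepsilon,n}(B):=\frac1t\int_0^t\mathbb{P}(X_0^{\varepsilon,n}(s)\in B)ds$, $B\in\mathcal{B}(H_n)$, form a tight family, and for each $\varepsilon>0$, $\mu^{\varepsilon,n}$ denotes a weak limit of $\mu_{t_i}^{\varepsilon,n}$ along some sequence $t_i\uparrow+\infty$ (possibly depending on $\varepsilon$); by the Krylov–Bogoliubov theorem it is an invariant measure of the equation for $X^{\varepsilon,n}$. For $\psi\in L^2(0,T;H_n)$, $z_{0,y}^{n,\psi}$ is the unique mild solution of $\frac{dz}{dt}=A_nz+F_n(z)+Q_n^{1/2}\psi$ on $(0,T]$, $z(0)=y$; $I_{0,T}^{n,y}(z)=\tfrac12\inf\{|\psi|_{L^2(0,T;H)}^2:\psi\in L^2(0,T;H_n),\ z_{0,y}^{n,\psi}=z\}$ for $z\in C([0,T];H_n)$ ($\inf\emptyset=+\infty$); and $$V^n(v)=\inf\{I_{0,T}^{n,0}(z):T>0,\ z\in C([0,T];H_n),\ z(0)=0,\ z(T)=v\},\quad v\in H_n.$$ *)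

theory Defs
  imports "HOL-Probability.Probability"
begin

abbreviation I01 :: "real measure" where
  "I01 \<equiv> lebesgue_on {0<..<1}"

definition L2_fun :: "(real \<Rightarrow> real) \<Rightarrow> bool" where
  "L2_fun f \<longleftrightarrow> f \<in> borel_measurable I01 \<and> integrable I01 (\<lambda>x. (f x)\<^sup>2)"

definition L2_eq :: "(real \<Rightarrow> real) \<Rightarrow> (real \<Rightarrow> real) \<Rightarrow> bool" where
  "L2_eq f g \<longleftrightarrow> L2_fun f \<and> L2_fun g \<and> (AE x in I01. f x = g x)"

lemma L2_fun_measurable: "L2_fun f \<Longrightarrow> f \<in> borel_measurable I01"
  by (simp add: L2_fun_def)

lemma L2_fun_zero: "L2_fun (\<lambda>_. 0)"
  by (simp add: L2_fun_def)

lemma L2_fun_scale: "L2_fun f \<Longrightarrow> L2_fun (\<lambda>x. c * f x)"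
  by (auto simp: L2_fun_def power_mult_distrib)

lemma L2_fun_mult_integrable:
  assumes "L2_fun f" "L2_fun g"
  shows "integrable I01 (\<lambda>x. f x * g x)"
proof (rule Bochner_Integration.integrable_bound)
  show "integrable I01 (\<lambda>x. (f x)\<^sup>2 + (g x)\<^sup>2)"
    using assms by (simp add: L2_fun_def)
  show "(\<lambda>x. f x * g x) \<in> borel_measurable I01"
    using assms by (intro borel_measurable_times L2_fun_measurable)
  have "\<bar>f x * g x\<bar> \<le> (f x)\<^sup>2 + (g x)\<^sup>2" for x
  proof -
    have "2 * (\<bar>f x\<bar> * \<bar>g x\<bar>) \<le> (f x)\<^sup>2 + (g x)\<^sup>2" "0 \<le> \<bar>f x\<bar> * \<bar>g x\<bar>"
      using sum_squares_bound[of "\<bar>f x\<bar>" "\<bar>g x\<bar>"] by (simp_all add: mult.assoc)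
    then show ?thesis unfolding abs_mult by linarith
  qed
  then show "AE x in I01. norm (f x * g x) \<le> norm ((f x)\<^sup>2 + (g x)\<^sup>2)"
    by (intro AE_I2) (simp add: abs_mult)
qed

lemma L2_fun_add: "L2_fun f \<Longrightarrow> L2_fun g \<Longrightarrow> L2_fun (\<lambda>x. f x + g x)"
  using L2_fun_mult_integrable[of f g]
  by (auto simp: L2_fun_def power2_sum mult.assoc)

lemma L2_fun_minus: "L2_fun f \<Longrightarrow> L2_fun (\<lambda>x. - f x)"
  by (auto simp: L2_fun_def)

lemma L2_fun_diff: "L2_fun f \<Longrightarrow> L2_fun g \<Longrightarrow> L2_fun (\<lambda>x. f x - g x)"
  using L2_fun_add[of f "\<lambda>x. - g x"] L2_fun_minus[of g] by simp

lemma L2_fun_continuous: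
  assumes "continuous_on {0..1} f"
  shows "L2_fun f"
proof -
  have "integrable (lebesgue_on {0<..<1}) g" if "continuous_on {0..1} g" for g :: "real \<Rightarrow> real"
  proof -
    have "integrable (lebesgue_on {0..1}) g"
      by (rule continuous_imp_integrable_real[OF that])
    then have "set_integrable lebesgue {0..1} g"
      by (simp add: set_integrable_def integrable_restrict_space)
    then have "set_integrable lebesgue {0<..<1} g"
      by (rule set_integrable_subset) auto
    then show ?thesis
      by (simp add: set_integrable_def integrable_restrict_space)
  qed
  from this[OF assms] this[of "\<lambda>x. (f x)\<^sup>2"] assms show ?thesis
    by (auto simp: L2_fun_def intro!: continuous_on_power)
qed

quotient_type L2 = "real \<Rightarrow> real" / partial: L2_eq
proof (rule part_equivpI)
  show "\<exists>f. L2_eq f f" by (rule exI[of _ "\<lambda>_. 0"]) (simp add: L2_eq_def L2_fun_zero)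
  show "symp L2_eq" by (rule sympI) (auto simp: L2_eq_def)
  show "transp L2_eq" by (rule transpI) (auto simp: L2_eq_def)
qed

instantiation L2 :: real_vector
begin

lift_definition zero_L2 :: L2 is "\<lambda>_. 0"
  by (simp add: L2_eq_def L2_fun_zero)

lift_definition plus_L2 :: "L2 \<Rightarrow> L2 \<Rightarrow> L2" is "\<lambda>f g x. f x + g x"
  by (auto simp: L2_eq_def L2_fun_add)

lift_definition minus_L2 :: "L2 \<Rightarrow> L2 \<Rightarrow> L2" is "\<lambda>f g x. f x - g x"
  by (auto simp: L2_eq_def L2_fun_diff)

lift_definition uminus_L2 :: "L2 \<Rightarrow> L2" is "\<lambda>f x. - f x"
  by (auto simp: L2_eq_def L2_fun_minus)

lift_definition scaleR_L2 :: "real \<Rightarrow> L2 \<Rightarrow> L2" is "\<lambda>c f x. c * f x"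
  by (auto simp: L2_eq_def L2_fun_scale)

instance
  by (standard; transfer;
      auto simp: L2_eq_def algebra_simps intro!: L2_fun_add L2_fun_scale L2_fun_minus L2_fun_zero L2_fun_diff)

end

instantiation L2 :: real_inner
begin

lift_definition inner_L2 :: "L2 \<Rightarrow> L2 \<Rightarrow> real" is "\<lambda>f g. \<integral>x. f x * g x \<partial>I01"
  unfolding L2_eq_def
  by (intro integral_cong_AE) (auto simp: L2_fun_def)

definition norm_L2 :: "L2 \<Rightarrow> real" where
  "norm_L2 u = sqrt (inner u u)"

definition dist_L2 :: "L2 \<Rightarrow> L2 \<Rightarrow> real" where
  "dist_L2 u v = norm (u - v)"

definition sgn_L2 :: "L2 \<Rightarrow> L2" where
  "sgn_L2 u = u /\<^sub>R norm u"

definition uniformity_L2 :: "(L2 \<times> L2) filter" where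
  "uniformity_L2 = (INF e\<in>{0<..}. principal {(u, v). dist u v < e})"

definition open_L2 :: "L2 set \<Rightarrow> bool" where
  "open_L2 U \<longleftrightarrow> (\<forall>u\<in>U. eventually (\<lambda>(u', v). u' = u \<longrightarrow> v \<in> U) uniformity)"

instance
proof
  fix u v w :: L2 and r :: real and U :: "L2 set"
  show "dist u v = norm (u - v)" by (rule dist_L2_def)
  show "sgn u = u /\<^sub>R norm u" by (rule sgn_L2_def)
  show "uniformity = (INF e\<in>{0<..}. principal {(u, v::L2). dist u v < e})" by (rule uniformity_L2_def)
  show "open U = (\<forall>u\<in>U. \<forall>\<^sub>F (u', v) in uniformity. u' = u \<longrightarrow> v \<in> U)" by (rule open_L2_def)
  show "inner u v = inner v u"
    by transfer (simp add: mult.commute)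
  show "inner (u + v) w = inner u w + inner v w"
    by transfer (simp add: distrib_right L2_eq_def L2_fun_mult_integrable)
  show "inner (r *\<^sub>R u) v = r * inner u v"
    by transfer (simp add: mult.assoc)
  show "0 \<le> inner u u"
    by transfer simp
  show "inner u u = 0 \<longleftrightarrow> u = 0"
  proof transfer
    fix f assume "L2_eq f f"
    then have f: "L2_fun f" by (simp add: L2_eq_def)
    have "(\<integral>x. f x * f x \<partial>I01) = 0 \<longleftrightarrow> (AE x in I01. f x * f x = 0)"
      by (rule integral_nonneg_eq_0_iff_AE) (auto intro: L2_fun_mult_integrable f)
    then show "(\<integral>x. f x * f x \<partial>I01) = 0 \<longleftrightarrow> L2_eq f (\<lambda>_. 0)"
      using f by (simp add: L2_eq_def L2_fun_zero)
  qed
  show "norm u = sqrt (inner u u)" by (rule norm_L2_def)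
qed

end

lemma L2_fun_rep: "L2_fun (rep_L2 u)"
  using Quotient_rep_reflp[OF Quotient_L2] by (auto simp: L2_eq_def)

lemma abs_rep_L2 [simp]: "abs_L2 (rep_L2 u) = u"
  by (rule Quotient_abs_rep[OF Quotient_L2])

lemma abs_L2_diff:
  assumes "L2_fun f" "L2_fun g"
  shows "abs_L2 f - abs_L2 g = abs_L2 (\<lambda>x. f x - g x)"
  using assms by (intro minus_L2.abs_eq) (auto simp: L2_eq_def)

lemma norm_L2_eq:
  assumes "L2_fun f" "L2_fun f'"
  shows "ennreal ((norm (abs_L2 f - abs_L2 f'))\<^sup>2) = (\<integral>\<^sup>+x. ennreal ((f x - f' x)\<^sup>2) \<partial>I01)"
proof -
  have "abs_L2 f - abs_L2 f' = abs_L2 (\<lambda>x. f x - f' x)"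
    using assms by (rule abs_L2_diff)
  moreover have d: "L2_fun (\<lambda>x. f x - f' x)"
    using assms by (rule L2_fun_diff)
  ultimately have "(norm (abs_L2 f - abs_L2 f'))\<^sup>2 = (\<integral>x. (f x - f' x) * (f x - f' x) \<partial>I01)"
    by (simp add: power2_norm_eq_inner) (intro inner_L2.abs_eq, auto simp: L2_eq_def)
  then show ?thesis
    using d by (subst nn_integral_eq_integral) (auto simp: L2_fun_def power2_eq_square)
qed

lemma L2_nn_integral_abs_le_norm:
  assumes "L2_fun f"
  shows "(\<integral>\<^sup>+x. ennreal \<bar>f x\<bar> \<partial>I01) \<le> ennreal (norm (abs_L2 f))"
proof -
  have one: "L2_fun (\<lambda>_. 1)" by (intro L2_fun_continuous continuous_intros)
  have a: "L2_fun (\<lambda>x. \<bar>f x\<bar>)"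
    using assms by (auto simp: L2_fun_def)
  have r: "L2_eq (\<lambda>_. 1) (\<lambda>_. 1)" "L2_eq (\<lambda>x. \<bar>f x\<bar>) (\<lambda>x. \<bar>f x\<bar>)" "L2_eq f f"
    using one a assms by (auto simp: L2_eq_def)
  have int: "integrable I01 (\<lambda>x. \<bar>f x\<bar>)"
    using L2_fun_mult_integrable[OF a one] by simp
  have "(\<integral>x. \<bar>f x\<bar> \<partial>I01) = inner (abs_L2 (\<lambda>x. \<bar>f x\<bar>)) (abs_L2 (\<lambda>_. 1))"
    using r by (simp add: inner_L2.abs_eq)
  also have "\<dots> \<le> norm (abs_L2 (\<lambda>x. \<bar>f x\<bar>)) * norm (abs_L2 (\<lambda>_. 1))"
    by (rule norm_cauchy_schwarz)
  also have "norm (abs_L2 (\<lambda>_. 1)) = 1"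
    unfolding norm_L2_def inner_L2.abs_eq[OF r(1) r(1)] by (simp add: measure_restrict_space)
  also have "norm (abs_L2 (\<lambda>x. \<bar>f x\<bar>)) = norm (abs_L2 f)"
    unfolding norm_L2_def inner_L2.abs_eq[OF r(2) r(2)] inner_L2.abs_eq[OF r(3) r(3)] by simp
  finally show ?thesis
    using int by (simp add: nn_integral_eq_integral ennreal_leI)
qed

instance L2 :: banach
proof
  fix X :: "nat \<Rightarrow> L2" assume X: "Cauchy X"
  have "\<exists>N. \<forall>m\<ge>N. \<forall>n\<ge>N. norm (X m - X n) < (1/2) ^ k" for k :: nat
    using X unfolding Cauchy_def dist_norm by (metis half_gt_zero_iff zero_less_one zero_less_power)
  then obtain N where N: "\<And>k m n. m \<ge> N k \<Longrightarrow> n \<ge> N k \<Longrightarrow> norm (X m - X n) < (1/2) ^ k"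
    by metis
  define r where "r k = (\<Sum>j\<le>k. N j)" for k
  have rN: "r k \<ge> N k" and rS: "r (Suc k) \<ge> r k" for k
    by (auto simp: r_def intro: member_le_sum)
  define f where "f k = rep_L2 (X (r k))" for k
  have f: "L2_fun (f k)" "abs_L2 (f k) = X (r k)" for k
    by (auto simp: f_def L2_fun_rep)
  have meas [measurable]: "f k \<in> borel_measurable I01" for k
    by (rule L2_fun_measurable[OF f(1)])
  have step: "(\<integral>\<^sup>+x. ennreal \<bar>f (Suc k) x - f k x\<bar> \<partial>I01) \<le> ennreal ((1/2) ^ k)" for k
  proof -
    have "abs_L2 (\<lambda>x. f (Suc k) x - f k x) = X (r (Suc k)) - X (r k)"
      using abs_L2_diff[OF f(1) f(1)] by (simp add: f(2))
    then have "(\<integral>\<^sup>+x. ennreal \<bar>f (Suc k) x - f k x\<bar> \<partial>I01) \<le> ennreal (norm (X (r (Suc k)) - X (r k)))"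
      using L2_nn_integral_abs_le_norm[OF L2_fun_diff[OF f(1) f(1)], of "Suc k" k] by simp
    also have "\<dots> \<le> ennreal ((1/2) ^ k)"
      using N[of k "r (Suc k)" "r k"] rN[of k] rS[of k] by (intro ennreal_leI) auto
    finally show ?thesis .
  qed
  have "(\<integral>\<^sup>+x. (\<Sum>k. ennreal \<bar>f (Suc k) x - f k x\<bar>) \<partial>I01) = (\<Sum>k. \<integral>\<^sup>+x. ennreal \<bar>f (Suc k) x - f k x\<bar> \<partial>I01)"
    by (rule nn_integral_suminf) measurable
  also have "\<dots> \<le> (\<Sum>k. ennreal ((1/2) ^ k))"
    by (intro suminf_le step) auto
  also have "\<dots> < \<infinity>"
    by (subst suminf_ennreal2) (auto intro: summable_geometric)
  finally have "AE x in I01. (\<Sum>k. ennreal \<bar>f (Suc k) x - f k x\<bar>) \<noteq> \<infinity>"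
    by (intro nn_integral_PInf_AE) auto
  then have conv: "AE x in I01. convergent (\<lambda>k. f k x)"
  proof eventually_elim
    case (elim x)
    then have "summable (\<lambda>k. \<bar>f (Suc k) x - f k x\<bar>)"
      by (intro summable_suminf_not_top) auto
    then have "summable (\<lambda>k. f (Suc k) x - f k x)"
      by (rule summable_rabs_cancel)
    then have "convergent (\<lambda>n. \<Sum>k<n. f (Suc k) x - f k x)"
      by (simp add: summable_iff_convergent)
    then have "convergent (\<lambda>n. f n x - f 0 x)"
      using sum_lessThan_telescope[of "\<lambda>k. f k x"] by (simp only:)
    then show ?case
      by (simp only: convergent_diff_const_right_iff)
  qed
  define F where "F x = lim (\<lambda>k. f k x)" for x
  have [measurable]: "F \<in> borel_measurable I01"
    unfolding F_def by measurable
  have lim: "AE x in I01. (\<lambda>k. f k x) \<longlonglongrightarrow> F x"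
    using conv by eventually_elim (simp add: F_def convergent_LIMSEQ_iff)
  have tail: "(\<integral>\<^sup>+x. ennreal ((F x - f m x)\<^sup>2) \<partial>I01) \<le> ennreal (((1/2) ^ m)\<^sup>2)" for m
  proof -
    define h where "h k x = ennreal ((f k x - f m x)\<^sup>2)" for k x
    have h: "h k \<in> borel_measurable I01" for k
      unfolding h_def
      by (intro measurable_compose[OF _ measurable_ennreal] borel_measurable_power borel_measurable_diff meas)
    have eq: "(\<integral>\<^sup>+x. ennreal ((F x - f m x)\<^sup>2) \<partial>I01) = (\<integral>\<^sup>+x. liminf (\<lambda>k. h k x) \<partial>I01)"
    proof (rule nn_integral_cong_AE)
      show "AE x in I01. ennreal ((F x - f m x)\<^sup>2) = liminf (\<lambda>k. h k x)"
        using lim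
      proof eventually_elim
        case (elim x)
        then have "(\<lambda>k. h k x) \<longlonglongrightarrow> ennreal ((F x - f m x)\<^sup>2)"
          unfolding h_def by (intro tendsto_intros)
        then show ?case
          using lim_imp_Liminf[OF sequentially_bot] by metis
      qed
    qed
    have fatou: "(\<integral>\<^sup>+x. liminf (\<lambda>k. h k x) \<partial>I01) \<le> liminf (\<lambda>k. integral\<^sup>N I01 (h k))"
      by (rule nn_integral_liminf[OF h])
    have bd: "integral\<^sup>N I01 (h k) \<le> ennreal (((1/2) ^ m)\<^sup>2)" if "k \<ge> m" for k
    proof -
      have "r k \<ge> r m" using lift_Suc_mono_le[where f=r, OF rS that] .
      then have "norm (X (r k) - X (r m)) \<le> (1/2) ^ m"
        using N[of m "r k" "r m"] rN[of m] by auto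
      then show ?thesis
        unfolding h_def norm_L2_eq[OF f(1) f(1), of k m, symmetric] f(2)
        by (intro ennreal_leI power_mono) auto
    qed
    have "\<forall>\<^sub>F k in sequentially. integral\<^sup>N I01 (h k) \<le> ennreal (((1/2) ^ m)\<^sup>2)"
      using bd by (auto simp: eventually_sequentially)
    note order_trans[OF fatou Liminf_le[OF sequentially_bot this]]
    then show ?thesis unfolding eq .
  qed
  have "L2_fun (\<lambda>x. F x - f 0 x)"
    unfolding L2_fun_def
  proof (intro conjI integrableI_bounded)
    show "(\<integral>\<^sup>+x. ennreal (norm ((F x - f 0 x)\<^sup>2)) \<partial>I01) < \<infinity>"
      using tail[of 0] by (simp add: le_less_trans)
  qed measurable
  from L2_fun_add[OF this f(1)[of 0]] have F: "L2_fun F" by simp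
  have tail': "norm (X (r m) - abs_L2 F) \<le> (1/2) ^ m" for m
  proof -
    have "ennreal ((norm (abs_L2 F - X (r m)))\<^sup>2) \<le> ennreal (((1/2) ^ m)\<^sup>2)"
      using norm_L2_eq[OF F f(1)] f(2) tail by metis
    then have "(norm (abs_L2 F - X (r m)))\<^sup>2 \<le> ((1/2) ^ m)\<^sup>2"
      by (subst (asm) ennreal_le_iff) auto
    then show ?thesis
      by (subst norm_minus_commute) (rule power2_le_imp_le, auto)
  qed
  have "X \<longlonglongrightarrow> abs_L2 F"
  proof (rule LIMSEQ_I)
    fix e :: real assume e: "e > 0"
    obtain k where k: "(1/2) ^ k < e / 2"
      using real_arch_pow_inv[of "e/2" "1/2"] e by auto
    have "norm (X n - abs_L2 F) < e" if "n \<ge> r k" for n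
    proof -
      have "norm (X n - abs_L2 F) \<le> norm (X n - X (r k)) + norm (X (r k) - abs_L2 F)"
        using norm_triangle_ineq[of "X n - X (r k)" "X (r k) - abs_L2 F"] by simp
      also have "\<dots> < e"
        using N[of k n "r k"] that rN[of k] tail'[of k] k by auto
      finally show ?thesis .
    qed
    then show "\<exists>no. \<forall>n\<ge>no. norm (X n - abs_L2 F) < e" by blast
  qed
  then show "convergent X" by (rule convergentI)
qed


definition ebasis :: "nat \<Rightarrow> L2" where
  "ebasis i = abs_L2 (\<lambda>x. sqrt 2 * sin (real i * pi * x))"

definition eigval :: "nat \<Rightarrow> real" where
  "eigval i = pi\<^sup>2 * (real i)\<^sup>2"

text \<open>
  \<open>laplace_graph u w\<close>: the class \<open>u\<close> lies in \<open>H\<^sup>2 \<inter> H\<^sub>0\<^sup>1\<close> and has second weak derivative \<open>w\<close>.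
  In one dimension this means that \<open>u\<close> has a representative \<open>f\<close> vanishing at both end points whose
  derivative \<open>g\<close> is absolutely continuous with square-integrable derivative \<open>w\<close>.
\<close>

definition laplace_graph :: "L2 \<Rightarrow> L2 \<Rightarrow> bool" where
  "laplace_graph u w \<longleftrightarrow> (\<exists>f g.
     (AE x in I01. rep_L2 u x = f x) \<and> f 0 = 0 \<and> f 1 = 0 \<and>
     (\<forall>x\<in>{0..1}. (g has_integral (f x - f 0)) {0..x}) \<and>
     (\<forall>x\<in>{0..1}. (rep_L2 w has_integral (g x - g 0)) {0..x}))"

definition dom_laplace :: "L2 set" where
  "dom_laplace = {u. \<exists>w. laplace_graph u w}"

definition laplace :: "L2 \<Rightarrow> L2" where
  "laplace u = (THE w. laplace_graph u w)"

definition neg_laplace_inv :: "L2 \<Rightarrow> L2" where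
  "neg_laplace_inv = inv_into dom_laplace (\<lambda>u. - laplace u)"

text \<open>
  Fractional powers of the negative Laplacian by the spectral expansion. The eigenfunctions carry the
  indices 1, 2, ..., whence the successors. By orthonormality the series converges in norm
  if and only if its coefficients are square-summable.
\<close>

definition frac_coeff :: "real \<Rightarrow> L2 \<Rightarrow> nat \<Rightarrow> L2" where
  "frac_coeff s u i = (eigval (Suc i) powr s * inner u (ebasis (Suc i))) *\<^sub>R ebasis (Suc i)"

definition dom_frac :: "real \<Rightarrow> L2 set" where
  "dom_frac s = {u. summable (frac_coeff s u)}"

definition frac_laplace :: "real \<Rightarrow> L2 \<Rightarrow> L2" where
  "frac_laplace s u = (\<Sum>i. frac_coeff s u i)"

definition Hdot :: "real \<Rightarrow> L2 set" where
  "Hdot \<gamma> = dom_frac (\<gamma> / 2)"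

definition Hdot_norm :: "real \<Rightarrow> L2 \<Rightarrow> real" where
  "Hdot_norm \<gamma> u = norm (frac_laplace (\<gamma> / 2) u)"

definition hilbert_schmidt :: "(L2 \<Rightarrow> L2) \<Rightarrow> bool" where
  "hilbert_schmidt T \<longleftrightarrow> bounded_linear T \<and> summable (\<lambda>i. (norm (T (ebasis (Suc i))))\<^sup>2)"

definition self_adjoint :: "(L2 \<Rightarrow> L2) \<Rightarrow> bool" where
  "self_adjoint T \<longleftrightarrow> (\<forall>u v. inner (T u) v = inner u (T v))"

definition positive_sqrt :: "(L2 \<Rightarrow> L2) \<Rightarrow> (L2 \<Rightarrow> L2) \<Rightarrow> bool" where
  "positive_sqrt S Q \<longleftrightarrow>
     bounded_linear S \<and> self_adjoint S \<and> (\<forall>u. 0 \<le> inner (S u) u) \<and> S \<circ> S = Q"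

definition H_n :: "nat \<Rightarrow> L2 set" where
  "H_n n = span (ebasis ` {1..n})"

definition P_n :: "nat \<Rightarrow> L2 \<Rightarrow> L2" where
  "P_n n u = (\<Sum>i=1..n. inner u (ebasis i) *\<^sub>R ebasis i)"

definition A_n :: "nat \<Rightarrow> L2 \<Rightarrow> L2" where
  "A_n n u = P_n n (laplace u)"

abbreviation borel_n :: "nat \<Rightarrow> L2 measure" where
  "borel_n n \<equiv> restrict_space borel (H_n n)"

definition S_n :: "nat \<Rightarrow> real \<Rightarrow> L2 \<Rightarrow> L2" where
  \<comment> \<open>the semigroup \<open>exp (t A\<^sub>n)\<close> on \<open>H\<^sub>n\<close>\<close>
  "S_n n t u = (\<Sum>k. (t ^ k / fact k) *\<^sub>R (A_n n ^^ k) u)"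

definition std_brownian_motion :: "'w measure \<Rightarrow> (real \<Rightarrow> 'w \<Rightarrow> real) \<Rightarrow> bool" where
  "std_brownian_motion M b \<longleftrightarrow>
     (\<forall>t\<ge>0. b t \<in> borel_measurable M) \<and>
     (AE \<omega> in M. b 0 \<omega> = 0) \<and>
     (AE \<omega> in M. continuous_on {0..} (\<lambda>t. b t \<omega>)) \<and>
     (\<forall>s t. 0 \<le> s \<and> s < t \<longrightarrow>
        distributed M lborel (\<lambda>\<omega>. b t \<omega> - b s \<omega>) (normal_density 0 (sqrt (t - s)))) \<and>
     (\<forall>m (\<tau> :: nat \<Rightarrow> real). 0 \<le> \<tau> 0 \<and> (\<forall>k<m. \<tau> k < \<tau> (Suc k)) \<longrightarrow>
        prob_space.indep_vars M (\<lambda>_. borel) (\<lambda>k \<omega>. b (\<tau> (Suc k)) \<omega> - b (\<tau> k) \<omega>) {..<m})"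

definition indep_brownian_motions :: "'w measure \<Rightarrow> (nat \<Rightarrow> real \<Rightarrow> 'w \<Rightarrow> real) \<Rightarrow> bool" where
  "indep_brownian_motions M \<beta> \<longleftrightarrow>
     (\<forall>i\<ge>1. std_brownian_motion M (\<beta> i)) \<and>
     prob_space.indep_vars M (\<lambda>_. Pi\<^sub>M {0..} (\<lambda>_. borel)) (\<lambda>i \<omega>. \<lambda>t\<in>{0..}. \<beta> i t \<omega>) {1..}"

text \<open>
  The cylindrical series \<open>W\<close> does not converge in the Hilbert space; its projection is the finite sum.
\<close>

definition W_n :: "nat \<Rightarrow> (nat \<Rightarrow> real \<Rightarrow> 'w \<Rightarrow> real) \<Rightarrow> real \<Rightarrow> 'w \<Rightarrow> L2" where
  "W_n n \<beta> t \<omega> = (\<Sum>i=1..n. \<beta> i t \<omega> *\<^sub>R ebasis i)"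

text \<open>
  The stochastic integral over \<open>[0,t]\<close> of a deterministic, continuous, operator-valued integrand, as
  the mean-square limit of its Riemann sums along uniform partitions.
\<close>

definition has_wiener_integral ::
  "'w measure \<Rightarrow> (real \<Rightarrow> 'w \<Rightarrow> L2) \<Rightarrow> (real \<Rightarrow> L2 \<Rightarrow> L2) \<Rightarrow> real \<Rightarrow> ('w \<Rightarrow> L2) \<Rightarrow> bool" where
  "has_wiener_integral M W \<Phi> t Z \<longleftrightarrow>
     Z \<in> borel_measurable M \<and>
     ((\<lambda>m. \<integral>\<^sup>+\<omega>. ennreal ((norm
         ((\<Sum>k<m. \<Phi> (t * real k / real m) (W (t * real (Suc k) / real m) \<omega> - W (t * real k / real m) \<omega>))
          - Z \<omega>))\<^sup>2) \<partial>M) \<longlonglongrightarrow> 0)"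

text \<open>
  From here on \<open>Qh\<close> is the positive square root of the covariance operator \<open>Q\<close>.
\<close>

definition mild_sde_solution ::
  "'w measure \<Rightarrow> (nat \<Rightarrow> real \<Rightarrow> 'w \<Rightarrow> real) \<Rightarrow> (L2 \<Rightarrow> L2) \<Rightarrow> (L2 \<Rightarrow> L2) \<Rightarrow> nat \<Rightarrow> real \<Rightarrow> L2
    \<Rightarrow> (real \<Rightarrow> 'w \<Rightarrow> L2) \<Rightarrow> bool" where
  "mild_sde_solution M \<beta> Qh F n \<epsilon> y X \<longleftrightarrow>
     (\<forall>t\<ge>0. X t \<in> M \<rightarrow>\<^sub>M borel_n n) \<and>
     (AE \<omega> in M. continuous_on {0..} (\<lambda>t. X t \<omega>)) \<and>
     (\<forall>t\<ge>0. \<exists>Z. has_wiener_integral M (W_n n \<beta>) (\<lambda>s h. S_n n (t - s) (P_n n (Qh h))) t Z \<and>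
        (AE \<omega> in M. ((\<lambda>s. S_n n (t - s) (P_n n (F (X s \<omega>))))
           has_integral (X t \<omega> - S_n n t y - \<epsilon> *\<^sub>R Z \<omega>)) {0..t}))"

text \<open>
  The set function below is countably additive because \<open>s \<mapsto> P(X(s) \<in> B)\<close> is Borel measurable for
  processes with almost surely continuous paths.
\<close>

definition time_average :: "'w measure \<Rightarrow> nat \<Rightarrow> (real \<Rightarrow> 'w \<Rightarrow> L2) \<Rightarrow> real \<Rightarrow> L2 measure" where
  "time_average M n X t = measure_of (H_n n) (sets (borel_n n))
     (\<lambda>B. ennreal (1 / t) * (\<integral>\<^sup>+s\<in>{0..t}. emeasure M {\<omega>\<in>space M. X s \<omega> \<in> B} \<partial>lborel))"

definition weakly_converges_n :: "nat \<Rightarrow> (nat \<Rightarrow> L2 measure) \<Rightarrow> L2 measure \<Rightarrow> bool" where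
  "weakly_converges_n n \<nu> \<mu> \<longleftrightarrow>
     (\<forall>f :: L2 \<Rightarrow> real. continuous_on (H_n n) f \<and> bounded (f ` H_n n) \<longrightarrow>
        (\<lambda>i. integral\<^sup>L (\<nu> i) f) \<longlonglongrightarrow> integral\<^sup>L \<mu> f)"

definition weak_limit_of_time_averages ::
  "'w measure \<Rightarrow> nat \<Rightarrow> (real \<Rightarrow> 'w \<Rightarrow> L2) \<Rightarrow> L2 measure \<Rightarrow> bool" where
  "weak_limit_of_time_averages M n X \<mu> \<longleftrightarrow>
     prob_space \<mu> \<and> sets \<mu> = sets (borel_n n) \<and>
     (\<exists>\<tau> :: nat \<Rightarrow> real. (\<forall>i. 0 < \<tau> i) \<and> incseq \<tau> \<and> filterlim \<tau> at_top sequentially \<and>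
        weakly_converges_n n (\<lambda>i. time_average M n X (\<tau> i)) \<mu>)"

definition control_energy :: "real \<Rightarrow> (real \<Rightarrow> L2) \<Rightarrow> ennreal" where
  "control_energy T \<psi> = (\<integral>\<^sup>+t\<in>{0..T}. ennreal ((norm (\<psi> t))\<^sup>2) \<partial>lborel)"

definition controls :: "nat \<Rightarrow> real \<Rightarrow> (real \<Rightarrow> L2) set" where
  "controls n T = {\<psi>. \<psi> \<in> restrict_space lborel {0..T} \<rightarrow>\<^sub>M borel_n n \<and> control_energy T \<psi> < \<infinity>}"

definition paths :: "nat \<Rightarrow> real \<Rightarrow> (real \<Rightarrow> L2) set" where
  "paths n T = {z. continuous_on {0..T} z \<and> z ` {0..T} \<subseteq> H_n n}"

definition mild_control_solution ::
  "(L2 \<Rightarrow> L2) \<Rightarrow> (L2 \<Rightarrow> L2) \<Rightarrow> nat \<Rightarrow> real \<Rightarrow> L2 \<Rightarrow> (real \<Rightarrow> L2) \<Rightarrow> (real \<Rightarrow> L2) \<Rightarrow> bool" where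
  "mild_control_solution Qh F n T y \<psi> z \<longleftrightarrow>
     z \<in> paths n T \<and>
     (\<forall>t\<in>{0..T}. ((\<lambda>s. S_n n (t - s) (P_n n (F (z s)) + P_n n (Qh (\<psi> s))))
        has_integral (z t - S_n n t y)) {0..t})"

text \<open>The infimum over the empty set is \<open>\<infinity>\<close> in \<open>ennreal\<close>.\<close>

definition action ::
  "(L2 \<Rightarrow> L2) \<Rightarrow> (L2 \<Rightarrow> L2) \<Rightarrow> nat \<Rightarrow> real \<Rightarrow> L2 \<Rightarrow> (real \<Rightarrow> L2) \<Rightarrow> ennreal" where
  "action Qh F n T y z =
     (INF \<psi>\<in>{\<psi>\<in>controls n T. mild_control_solution Qh F n T y \<psi> z}. control_energy T \<psi>) / 2"

definition quasi_potential :: "(L2 \<Rightarrow> L2) \<Rightarrow> (L2 \<Rightarrow> L2) \<Rightarrow> nat \<Rightarrow> L2 \<Rightarrow> ennreal" where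
  "quasi_potential Qh F n v =
     (INF (T, z)\<in>{(T, z). T > 0 \<and> z \<in> paths n T \<and> z 0 = 0 \<and> z T = v}. action Qh F n T 0 z)"

definition level_set :: "(L2 \<Rightarrow> L2) \<Rightarrow> (L2 \<Rightarrow> L2) \<Rightarrow> nat \<Rightarrow> real \<Rightarrow> L2 set" where
  "level_set Qh F n \<alpha> = {v \<in> H_n n. quasi_potential Qh F n v \<le> ennreal \<alpha>}"

end

theory Submission
  imports Defs
begin

text \<open>
  For a time \<open>t \<ge> T\<close> put \<open>a = t - T\<close> and compare \<open>X(t)\<close> with the controlled path \<open>z\<close> whose control vanishes
  on \<open>[0,a]\<close> and equals \<open>\<epsilon>\<close> times the slope of the polygon through \<open>W\<close> at the nodes \<open>a + k h\<close> on \<open>[a,t]\<close>, \<open>T = m h\<close>.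
  The action of \<open>z\<close> is \<open>\<epsilon>\<^sup>2/2\<close> times a chi-square variable with \<open>n m\<close> degrees of freedom, hence exceeds \<open>\<alpha>\<close>
  with probability at most \<open>K exp(-(\<alpha> - \<gamma>/2)/\<epsilon>\<^sup>2)\<close>; if it does not, then \<open>z(t)\<close> lies in the level set.
  Since \<open>L\<^sub>F < \<lambda>\<^sub>1\<close>, dissipativity gives \<open>|X(t) - z(t)|\<^sup>2 \<le> \<epsilon>\<^sup>2 J\<close>, where \<open>J\<close> is an exponentially discounted time
  integral of squares of Gaussian variables: Brownian increments before \<open>a\<close>, Brownian bridges of length \<open>h\<close> after it.
  For large \<open>T\<close> and small \<open>h\<close> their discounted variances are so small that, by Jensen's inequality for the
  exponential, \<open>P(\<epsilon>\<^sup>2 J \<ge> \<delta>\<^sup>2)\<close> is at most \<open>2 exp(-\<alpha>/\<epsilon>\<^sup>2)\<close>. Neither bound depends on \<open>t\<close>, so they survive time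
  averaging and the weak limit.
\<close>

text \<open>The estimate has to hold at all large times at once, while bounds on a fixed time
  interval come with constants that grow with its length. Steering along all of [0,t] would produce
  a chi-square variable whose degrees of freedom grow with t, and the prefactor of its tail would
  not be uniform; hence the control acts only on a final stretch of fixed length. The idle stretch
  before it costs no action, and the quasi-potential admits every horizon, so t itself serves as
  horizon and no time shift is needed. What the control misses before a is forgotten, provided the
  error of the driving path is measured relative to its value at the final time t rather than at 0:
  for s before a it is then the Brownian increment over [s,a], whose variance grows only linearly
  backwards from a and loses against the exponential discount. Both equations are written in an
  integrated form driven by continuous paths, so the comparison is deterministic and pathwise; the
  noise enters only through Gaussian moments of increments. Of the slack \<gamma> in the exponent,
  one half is spent on keeping the moment parameter of the chi-square variable below 1/2, the other
  on absorbing prefactors.\<close>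

declare One_nat_def [simp del]

subsection \<open>The eigenbasis\<close>

lemma L2_fun_ebasis: "L2_fun (\<lambda>x. sqrt 2 * sin (real i * pi * x))"
  by (intro L2_fun_continuous continuous_intros)

lemma has_integral_cos_pi:
  fixes k :: int
  assumes "k \<noteq> 0"
  shows "((\<lambda>x. cos (of_int k * pi * x)) has_integral 0) {0..1::real}"
proof -
  have "((\<lambda>x. cos (of_int k * pi * x)) has_integral
      (sin (of_int k * pi * 1) / (of_int k * pi) - sin (of_int k * pi * 0) / (of_int k * pi))) {0..1::real}"
    using assms
    by (intro fundamental_theorem_of_calculus)
      (auto intro!: derivative_eq_intros simp: has_real_derivative_iff_has_vector_derivative[symmetric])
  moreover have "sin (of_int k * pi) = 0"
    using sin_times_pi_eq_0[of "of_int k"] by simp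
  ultimately show ?thesis by simp
qed

text \<open>The product-to-sum formula leaves cosines of the integer frequencies
  \<open>i - j\<close> and \<open>i + j\<close>, and a nonzero frequency integrates to 0 over the
  unit interval. Index 0 is excluded because \<open>ebasis 0\<close> is the zero class.\<close>

lemma inner_ebasis:
  assumes "i \<ge> 1" "j \<ge> 1"
  shows "inner (ebasis i) (ebasis j) = (if i = j then 1 else 0)"
proof -
  let ?f = "\<lambda>i x. sqrt 2 * sin (real i * pi * x)"
  have eq: "?f i x * ?f j x = cos (of_int (int i - int j) * pi * x) - cos (of_int (int i + int j) * pi * x)" for x
  proof -
    have "sin (real i * pi * x) * sin (real j * pi * x)
        = (cos (real i * pi * x - real j * pi * x) - cos (real i * pi * x + real j * pi * x)) / 2"
      by (rule sin_times_sin)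
    moreover have "?f i x * ?f j x = (sqrt 2 * sqrt 2) * (sin (real i * pi * x) * sin (real j * pi * x))"
      by (simp only: mult_ac)
    moreover have "sqrt 2 * sqrt 2 = (2::real)" by simp
    ultimately have "?f i x * ?f j x = cos (real i * pi * x - real j * pi * x) - cos (real i * pi * x + real j * pi * x)"
      by (simp only:) simp
    then show ?thesis
      by (simp add: algebra_simps)
  qed
  have "((\<lambda>x. cos (of_int (int i - int j) * pi * x)) has_integral (if i = j then 1 else 0)) {0..1::real}"
  proof (cases "i = j")
    case True
    then show ?thesis using has_integral_const_real[of "1::real" 0 1] by simp
  next
    case False
    then show ?thesis using has_integral_cos_pi[of "int i - int j"] by simp
  qed
  moreover have "((\<lambda>x. cos (of_int (int i + int j) * pi * x)) has_integral 0) {0..1::real}"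
    using assms by (intro has_integral_cos_pi) auto
  ultimately have "((\<lambda>x. ?f i x * ?f j x) has_integral ((if i = j then 1 else 0) - 0)) {0..1::real}"
    unfolding eq by (rule has_integral_diff)
  then have hi: "((\<lambda>x. ?f i x * ?f j x) has_integral (if i = j then 1 else 0)) {0<..<1}"
    by (simp add: has_integral_Icc_iff_Ioo)
  have r: "L2_eq (?f i) (?f i)" "L2_eq (?f j) (?f j)"
    using L2_fun_ebasis by (auto simp: L2_eq_def)
  have "inner (ebasis i) (ebasis j) = (\<integral>x. ?f i x * ?f j x \<partial>I01)"
    unfolding ebasis_def by (rule inner_L2.abs_eq[OF r])
  also have "\<dots> = integral {0<..<1} (\<lambda>x. ?f i x * ?f j x)"
    by (intro lebesgue_integral_eq_integral L2_fun_mult_integrable L2_fun_ebasis) auto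
  also have "\<dots> = (if i = j then 1 else 0)"
    using hi by (rule integral_unique)
  finally show ?thesis .
qed

lemma ebasis_in_H_n: "i \<in> {1..n} \<Longrightarrow> ebasis i \<in> H_n n"
  unfolding H_n_def by (intro span_base) auto

lemma subspace_H_n: "subspace (H_n n)"
  unfolding H_n_def by (rule subspace_span)

lemma basis_sum_in_H_n: "(\<Sum>i=1..n. c i *\<^sub>R ebasis i) \<in> H_n n"
  by (intro subspace_sum subspace_H_n subspace_scale ebasis_in_H_n)

lemma inner_basis_sum:
  assumes "j \<in> {1..n}"
  shows "inner (\<Sum>i=1..n. c i *\<^sub>R ebasis i) (ebasis j) = c j"
proof -
  have "inner (\<Sum>i=1..n. c i *\<^sub>R ebasis i) (ebasis j) = (\<Sum>i=1..n. if i = j then c i else 0)"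
    unfolding inner_sum_left inner_scaleR_left
    by (intro sum.cong) (use assms in \<open>auto simp: inner_ebasis\<close>)
  then show ?thesis using assms by simp
qed

lemma H_n_expand:
  assumes "u \<in> H_n n"
  shows "u = (\<Sum>i=1..n. inner u (ebasis i) *\<^sub>R ebasis i)"
proof -
  have fin: "finite (ebasis ` {1..n})" by simp
  have inj: "inj_on ebasis {1..n}"
    by (rule inj_onI) (metis atLeastAtMost_iff inner_ebasis zero_neq_one)
  from assms obtain c where "u = (\<Sum>v\<in>ebasis ` {1..n}. c v *\<^sub>R v)"
    unfolding H_n_def span_finite[OF fin] by auto
  then have u: "u = (\<Sum>i=1..n. c (ebasis i) *\<^sub>R ebasis i)"
    by (simp add: sum.reindex[OF inj] o_def)
  show ?thesis
    by (subst u, intro sum.cong) (use u inner_basis_sum in auto)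
qed

lemma P_n_in_H_n: "P_n n u \<in> H_n n"
  unfolding P_n_def by (rule basis_sum_in_H_n)

lemma inner_P_n: "i \<in> {1..n} \<Longrightarrow> inner (P_n n u) (ebasis i) = inner u (ebasis i)"
  unfolding P_n_def by (rule inner_basis_sum)

lemma inner_eq_sum_coords:
  assumes "u \<in> H_n n"
  shows "inner u v = (\<Sum>i=1..n. inner u (ebasis i) * inner v (ebasis i))"
  by (subst H_n_expand[OF assms]) (simp add: inner_sum_left inner_commute[of v])

lemma norm_sq_eq_sum_coords:
  assumes "u \<in> H_n n"
  shows "(norm u)\<^sup>2 = (\<Sum>i=1..n. (inner u (ebasis i))\<^sup>2)"
  unfolding power2_norm_eq_inner inner_eq_sum_coords[OF assms, of u] by (simp add: power2_eq_square)

lemma norm_sq_basis_sum: "(norm (\<Sum>i=1..n. c i *\<^sub>R ebasis i))\<^sup>2 = (\<Sum>i=1..n. (c i)\<^sup>2)"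
  by (subst norm_sq_eq_sum_coords[OF basis_sum_in_H_n]) (intro sum.cong refl, subst inner_basis_sum, auto)

lemma H_n_eqI:
  assumes "u \<in> H_n n" "v \<in> H_n n" "\<And>i. i \<in> {1..n} \<Longrightarrow> inner u (ebasis i) = inner v (ebasis i)"
  shows "u = v"
  using assms by (subst H_n_expand[OF assms(1)], subst H_n_expand[OF assms(2)]) (auto intro!: sum.cong)

lemma eigval_nonneg: "eigval i \<ge> 0"
  by (simp add: eigval_def)

lemma eigval_pos: "i \<ge> 1 \<Longrightarrow> eigval i > 0"
  by (simp add: eigval_def)

lemma eigval_mono: "i \<le> j \<Longrightarrow> eigval i \<le> eigval j"
  unfolding eigval_def by (intro mult_left_mono power_mono) auto

lemma norm_ebasis: "i \<ge> 1 \<Longrightarrow> norm (ebasis i) = 1"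
  by (simp add: norm_eq_sqrt_inner inner_ebasis)

subsection \<open>The Laplacian on finite-dimensional subspaces\<close>

text \<open>\<open>rep_L2\<close> picks an arbitrary representative, so it matches a concrete
  function only almost everywhere. As \<open>laplace_graph\<close> speaks about representatives,
  every computation with it passes through identities of this kind.\<close>

lemma rep_abs_L2:
  assumes "L2_fun f"
  shows "AE x in I01. rep_L2 (abs_L2 f) x = f x"
proof -
  have "L2_eq f f" using assms by (simp add: L2_eq_def)
  then have "L2_eq (rep_L2 (abs_L2 f)) f" by (rule Quotient_rep_abs[OF Quotient_L2])
  then show ?thesis by (simp add: L2_eq_def)
qed

lemma rep_L2_add: "AE x in I01. rep_L2 (u + v) x = rep_L2 u x + rep_L2 v x"
proof -
  have r: "L2_eq (rep_L2 w) (rep_L2 w)" for w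
    using L2_fun_rep by (simp add: L2_eq_def)
  have "abs_L2 (\<lambda>x. rep_L2 u x + rep_L2 v x) = u + v"
    using plus_L2.abs_eq[OF r r, of u v] by simp
  then show ?thesis
    using rep_abs_L2[OF L2_fun_add[OF L2_fun_rep L2_fun_rep, of u v]] by simp
qed

lemma rep_L2_scaleR: "AE x in I01. rep_L2 (c *\<^sub>R u) x = c * rep_L2 u x"
proof -
  have r: "L2_eq (rep_L2 w) (rep_L2 w)" for w
    using L2_fun_rep by (simp add: L2_eq_def)
  have "abs_L2 (\<lambda>x. c * rep_L2 u x) = c *\<^sub>R u"
    using scaleR_L2.abs_eq[OF r, of c u] by simp
  then show ?thesis
    using rep_abs_L2[OF L2_fun_scale[OF L2_fun_rep, of c u]] by simp
qed

text \<open>Passes from Lebesgue null sets on the open interval to the negligible sets of the gauge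
  integral on the closed one; the two end points are added to the exceptional set.\<close>

lemma I01_AE_negligible:
  assumes "AE x in I01. P x"
  obtains N where "negligible N" "\<And>x. x \<in> {0..1} - N \<Longrightarrow> P x"
proof -
  have "AE x in lebesgue. x \<in> {0<..<1} \<longrightarrow> P x"
    using assms by (subst (asm) AE_restrict_space_iff) auto
  then obtain N where N: "N \<in> null_sets lebesgue" "{x. \<not> (x \<in> {0<..<1} \<longrightarrow> P x)} \<subseteq> N"
    by (auto simp: eventually_ae_filter)
  have "negligible (N \<union> {0,1})"
    using N(1) negligible_iff_null_sets by (intro negligible_Un) auto
  moreover have "P x" if "x \<in> {0..1} - (N \<union> {0,1})" for x
  proof -
    have "x \<in> {0<..<1}" "x \<notin> N" using that by auto
    then show ?thesis using N(2) by blast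
  qed
  ultimately show ?thesis by (rule that)
qed

lemma has_integral_AE_I01:
  assumes "AE x in I01. f x = g x" "x \<in> {0..1}"
  shows "(f has_integral y) {0..x} \<longleftrightarrow> (g has_integral y) {0..x}"
proof -
  obtain N where N: "negligible N" "\<And>x. x \<in> {0..1} - N \<Longrightarrow> f x = g x"
    using I01_AE_negligible[OF assms(1)] by blast
  have "f z = g z" if "z \<in> {0..x} - N" for z
    using N(2)[of z] that assms(2) by auto
  then show ?thesis
    by (intro has_integral_spike_eq[OF N(1)]) auto
qed

text \<open>Together with the scaling lemma below this makes the graph a linear subspace, which
  reduces its single-valuedness to the case \<open>u = 0\<close>.\<close>

lemma laplace_graph_add:
  assumes "laplace_graph u w" "laplace_graph u' w'"
  shows "laplace_graph (u + u') (w + w')"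
proof -
  obtain f g where 1: "AE x in I01. rep_L2 u x = f x" "f 0 = 0" "f 1 = 0"
     "\<forall>x\<in>{0..1}. (g has_integral (f x - f 0)) {0..x}" "\<forall>x\<in>{0..1}. (rep_L2 w has_integral (g x - g 0)) {0..x}"
    using assms(1) unfolding laplace_graph_def by blast
  obtain f' g' where 2: "AE x in I01. rep_L2 u' x = f' x" "f' 0 = 0" "f' 1 = 0"
     "\<forall>x\<in>{0..1}. (g' has_integral (f' x - f' 0)) {0..x}" "\<forall>x\<in>{0..1}. (rep_L2 w' has_integral (g' x - g' 0)) {0..x}"
    using assms(2) unfolding laplace_graph_def by blast
  show ?thesis unfolding laplace_graph_def
  proof (rule exI[of _ "\<lambda>x. f x + f' x"], rule exI[of _ "\<lambda>x. g x + g' x"], intro conjI ballI)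
    show "AE x in I01. rep_L2 (u + u') x = f x + f' x"
      using rep_L2_add[of u u'] 1(1) 2(1) by eventually_elim simp
    fix x :: real assume x: "x \<in> {0..1}"
    show "((\<lambda>x. g x + g' x) has_integral (f x + f' x - (f 0 + f' 0))) {0..x}"
      using has_integral_add[OF 1(4)[rule_format, OF x] 2(4)[rule_format, OF x]] by (simp add: algebra_simps)
    show "(rep_L2 (w + w') has_integral (g x + g' x - (g 0 + g' 0))) {0..x}"
      unfolding has_integral_AE_I01[OF rep_L2_add x]
      using has_integral_add[OF 1(5)[rule_format, OF x] 2(5)[rule_format, OF x]] by (simp add: algebra_simps)
  qed (use 1 2 in auto)
qed

lemma laplace_graph_scaleR:
  assumes "laplace_graph u w"
  shows "laplace_graph (c *\<^sub>R u) (c *\<^sub>R w)"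
proof -
  obtain f g where 1: "AE x in I01. rep_L2 u x = f x" "f 0 = 0" "f 1 = 0"
     "\<forall>x\<in>{0..1}. (g has_integral (f x - f 0)) {0..x}" "\<forall>x\<in>{0..1}. (rep_L2 w has_integral (g x - g 0)) {0..x}"
    using assms(1) unfolding laplace_graph_def by blast
  show ?thesis unfolding laplace_graph_def
  proof (rule exI[of _ "\<lambda>x. c * f x"], rule exI[of _ "\<lambda>x. c * g x"], intro conjI ballI)
    show "AE x in I01. rep_L2 (c *\<^sub>R u) x = c * f x"
      using rep_L2_scaleR[of c u] 1(1) by eventually_elim simp
    fix x :: real assume x: "x \<in> {0..1}"
    show "((\<lambda>x. c * g x) has_integral (c * f x - c * f 0)) {0..x}"
      using has_integral_mult_right[OF 1(4)[rule_format, OF x], of c] by (simp add: algebra_simps)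
    show "(rep_L2 (c *\<^sub>R w) has_integral (c * g x - c * g 0)) {0..x}"
      unfolding has_integral_AE_I01[OF rep_L2_scaleR x]
      using has_integral_mult_right[OF 1(5)[rule_format, OF x], of c] by (simp add: algebra_simps)
  qed (use 1 in auto)
qed

lemma laplace_graph_ebasis: "laplace_graph (ebasis i) (- eigval i *\<^sub>R ebasis i)"
  unfolding laplace_graph_def
proof (rule exI[of _ "\<lambda>x. sqrt 2 * sin (real i * pi * x)"], rule exI[of _ "\<lambda>x. sqrt 2 * (real i * pi) * cos (real i * pi * x)"], intro conjI ballI)
  show "AE x in I01. rep_L2 (ebasis i) x = sqrt 2 * sin (real i * pi * x)"
    unfolding ebasis_def by (rule rep_abs_L2[OF L2_fun_ebasis])
  show "sqrt 2 * sin (real i * pi * 1) = 0" by simp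
  fix x :: real assume x: "x \<in> {0..1}"
  show "((\<lambda>x. sqrt 2 * (real i * pi) * cos (real i * pi * x)) has_integral
      (sqrt 2 * sin (real i * pi * x) - sqrt 2 * sin (real i * pi * 0))) {0..x}"
    using x by (intro fundamental_theorem_of_calculus)
      (auto intro!: derivative_eq_intros simp: has_real_derivative_iff_has_vector_derivative[symmetric])
  have ae: "AE x in I01. rep_L2 (- eigval i *\<^sub>R ebasis i) x = - eigval i * (sqrt 2 * sin (real i * pi * x))"
    using rep_L2_scaleR[of "- eigval i" "ebasis i"] rep_abs_L2[OF L2_fun_ebasis, of i]
    unfolding ebasis_def by eventually_elim simp
  have hi: "((\<lambda>x. - eigval i * (sqrt 2 * sin (real i * pi * x))) has_integral
      (sqrt 2 * (real i * pi) * cos (real i * pi * x) - sqrt 2 * (real i * pi) * cos (real i * pi * 0))) {0..x}"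
    using x by (intro fundamental_theorem_of_calculus)
      (auto intro!: derivative_eq_intros
        simp: eigval_def power2_eq_square has_real_derivative_iff_has_vector_derivative[symmetric])
  show "(rep_L2 (- eigval i *\<^sub>R ebasis i) has_integral
      (sqrt 2 * (real i * pi) * cos (real i * pi * x) - sqrt 2 * (real i * pi) * cos (real i * pi * 0))) {0..x}"
    by (rule has_integral_AE_I01[OF ae x, THEN iffD2, OF hi])
qed auto

section \<open>Uniqueness of the weak second derivative\<close>

lemma continuous_on_primitive:
  fixes g f :: "real \<Rightarrow> real"
  assumes "\<And>x. x \<in> {0..1} \<Longrightarrow> (g has_integral (f x - f 0)) {0..x}"
  shows "continuous_on {0..1} f"
proof -
  have "continuous_on {0..1} (\<lambda>x. integral {0..x} g)"
    using assms[of 1] by (intro indefinite_integral_continuous_1) auto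
  then have "continuous_on {0..1} (\<lambda>x. integral {0..x} g + f 0)"
    by (intro continuous_intros)
  then show ?thesis
  proof (rule continuous_on_eq)
    fix x :: real assume "x \<in> {0..1}"
    from integral_unique[OF assms[OF this]] show "integral {0..x} g + f 0 = f x" by simp
  qed
qed

text \<open>The squared difference is continuous and nonnegative with integral 0, so it vanishes
  everywhere, end points included.\<close>

lemma AE_I01_eq_continuous:
  fixes f g :: "real \<Rightarrow> real"
  assumes "AE x in I01. f x = g x" "continuous_on {0..1} f" "continuous_on {0..1} g" "x \<in> {0..1}"
  shows "f x = g x"
proof -
  obtain N where N: "negligible N" "\<And>x. x \<in> {0..1} - N \<Longrightarrow> f x = g x"
    using I01_AE_negligible[OF assms(1)] by blast
  have "((\<lambda>x. (f x - g x)\<^sup>2) has_integral 0) {0..1}"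
    by (rule has_integral_negligible[OF N(1)]) (simp add: N(2))
  then show ?thesis
    using has_integral_0_cbox_imp_0[of 0 1 "\<lambda>x. (f x - g x)\<^sup>2" x] assms(2-4)
      continuous_on_power[OF continuous_on_diff[OF assms(2,3)], of 2] by simp
qed

text \<open>Both \<open>h x\<close> and 0 are derivatives of the vanishing primitive; taking
  derivatives within the closed interval covers the end points.\<close>

lemma primitive_zero_imp_zero:
  fixes h :: "real \<Rightarrow> real"
  assumes "continuous_on {0..1} h" "\<And>x. x \<in> {0..1} \<Longrightarrow> (h has_integral 0) {0..x}" "x \<in> {0..1}"
  shows "h x = 0"
proof -
  have "((\<lambda>x. integral {0..x} h) has_vector_derivative h x) (at x within {0..1})"
    using assms by (intro integral_has_vector_derivative) auto
  moreover have "((\<lambda>x. integral {0..x} h) has_vector_derivative 0) (at x within {0..1})"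
    by (rule has_vector_derivative_transform[OF assms(3), of _ "\<lambda>_. 0"])
      (use assms(2) integral_unique in \<open>auto\<close>)
  ultimately show ?thesis
    using vector_derivative_unique_within_closed_interval[of 0 1 x] assms(3) by force
qed

text \<open>Henstock's lemma makes the sum of \<open>|content * f(tag) - integral|\<close> over the
  cells of a fine division small. All cell integrals vanish, so this sum is exactly a Riemann sum of
  \<open>|f|\<close>. The argument takes the place of differentiating the primitive almost
  everywhere.\<close>

lemma has_integral_abs_0_if_integrals_0:
  fixes f :: "real \<Rightarrow> real"
  assumes "f integrable_on {a..b}" "\<And>c d. {c..d} \<subseteq> {a..b} \<Longrightarrow> integral {c..d} f = 0"
  shows "((\<lambda>x. \<bar>f x\<bar>) has_integral 0) {a..b}"
proof -
  have "((\<lambda>x. \<bar>f x\<bar>) has_integral 0) (cbox a b)"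
    unfolding has_integral
  proof (intro allI impI)
    fix e :: real assume "e > 0"
    then obtain \<gamma> where \<gamma>: "gauge \<gamma>"
      "\<And>p. p tagged_partial_division_of (cbox a b) \<Longrightarrow> \<gamma> fine p \<Longrightarrow>
         sum (\<lambda>(x,k). norm (measure lborel k *\<^sub>R f x - integral k f)) p < e"
      using Henstock_lemma[of f a b e] assms(1) by auto
    show "\<exists>\<gamma>. gauge \<gamma> \<and> (\<forall>D. D tagged_division_of cbox a b \<and> \<gamma> fine D \<longrightarrow>
        norm ((\<Sum>(x, k)\<in>D. measure lborel k *\<^sub>R \<bar>f x\<bar>) - 0) < e)"
    proof (intro exI[of _ \<gamma>] conjI allI impI \<gamma>(1))
      fix D assume D: "D tagged_division_of cbox a b \<and> \<gamma> fine D"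
      have "(\<Sum>(x, k)\<in>D. measure lborel k *\<^sub>R \<bar>f x\<bar>) = sum (\<lambda>(x,k). norm (measure lborel k *\<^sub>R f x - integral k f)) D"
      proof (intro sum.cong refl, clarsimp)
        fix x k assume "(x, k) \<in> D"
        then obtain c d where k: "k = cbox c d" "k \<subseteq> cbox a b"
          using D by (metis tagged_division_ofD(3,4))
        then have "integral k f = 0" using assms(2)[of c d] by simp
        then show "measure lborel k * \<bar>f x\<bar> = \<bar>measure lborel k * f x - integral k f\<bar>"
          by (simp add: abs_mult)
      qed
      moreover have "\<dots> < e"
        using D by (intro \<gamma>(2)) (auto simp: tagged_division_of_def)
      moreover have "0 \<le> (\<Sum>(x, k)\<in>D. measure lborel k *\<^sub>R \<bar>f x\<bar>)"
        by (intro sum_nonneg) auto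
      ultimately show "norm ((\<Sum>(x, k)\<in>D. measure lborel k *\<^sub>R \<bar>f x\<bar>) - 0) < e" by simp
    qed
  qed
  then show ?thesis by simp
qed

text \<open>Needed for the \<open>THE\<close> in \<open>laplace\<close> to denote. For the
  difference of two graph points the class is 0; continuity makes \<open>f\<close> vanish
  everywhere, so the continuous \<open>g\<close> has zero primitive and vanishes too, and then the
  remaining second derivative has integral 0 over every subinterval.\<close>

lemma laplace_graph_unique:
  assumes "laplace_graph u w" "laplace_graph u w'"
  shows "w = w'"
proof -
  have "laplace_graph (u + (-1) *\<^sub>R u) (w + (-1) *\<^sub>R w')"
    using assms by (intro laplace_graph_add laplace_graph_scaleR)
  then have "laplace_graph 0 (w - w')" by simp
  then obtain f g where 1: "AE x in I01. rep_L2 0 x = f x" "f 0 = 0"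
     "\<And>x. x\<in>{0..1} \<Longrightarrow> (g has_integral (f x - f 0)) {0..x}"
     "\<And>x. x\<in>{0..1} \<Longrightarrow> (rep_L2 (w - w') has_integral (g x - g 0)) {0..x}"
    unfolding laplace_graph_def by blast
  have "AE x in I01. rep_L2 0 x = 0"
    using rep_abs_L2[OF L2_fun_zero] unfolding zero_L2_def by simp
  with 1(1) have "AE x in I01. f x = 0" by eventually_elim simp
  moreover have "continuous_on {0..1} f" "continuous_on {0..1} g"
    using 1(3) 1(4) by (blast intro: continuous_on_primitive)+
  ultimately have cg: "continuous_on {0..1} g" and f0: "f x = 0" if "x \<in> {0..1}" for x
    using AE_I01_eq_continuous[of f "\<lambda>_. 0", OF _ _ continuous_on_const that] by auto
  have "(g has_integral 0) {0..x}" if "x \<in> {0..1}" for x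
    using 1(3)[OF that] f0[OF that] f0[of 0] by simp
  then have g0: "g x = 0" if "x \<in> {0..1}" for x
    using primitive_zero_imp_zero[OF cg[OF that]] that by blast
  let ?d = "rep_L2 (w - w')"
  have int0: "integral {0..x} ?d = 0" if "x \<in> {0..1}" for x
    using integral_unique[OF 1(4)[OF that]] g0[OF that] g0[of 0] by simp
  \<comment> \<open>Multiplication by the constant 1 turns square-integrability into Lebesgue
    integrability, so that the gauge integral of \<open>\<bar>?d x\<bar>\<close> may be read as a
    Lebesgue integral.\<close>
  have "L2_fun (\<lambda>_. 1)" by (intro L2_fun_continuous continuous_intros)
  then have i: "integrable I01 ?d"
    using L2_fun_mult_integrable[OF L2_fun_rep] by fastforce
  have hk: "?d integrable_on {0..1}"
    using 1(4)[of 1] by auto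
  have "integral {a..b} ?d = 0" if "{a..b} \<subseteq> {0..1}" for a b
  proof (cases "a \<le> b")
    case True
    then have "integral {0..a} ?d + integral {a..b} ?d = integral {0..b} ?d"
      using that by (intro Henstock_Kurzweil_Integration.integral_combine integrable_subinterval_real[OF hk]) auto
    then show ?thesis using int0[of a] int0[of b] that True by auto
  qed simp
  then have "((\<lambda>x. \<bar>?d x\<bar>) has_integral 0) {0..1}"
    by (rule has_integral_abs_0_if_integrals_0[OF hk])
  then have "integral {0<..<1} (\<lambda>x. \<bar>?d x\<bar>) = 0"
    by (intro integral_unique) (simp add: has_integral_Icc_iff_Ioo)
  then have "(\<integral>x. \<bar>?d x\<bar> \<partial>I01) = 0"
    using lebesgue_integral_eq_integral[of "{0<..<1}" "\<lambda>x. \<bar>?d x\<bar>"] i by simp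
  then have "AE x in I01. \<bar>?d x\<bar> = 0"
    using i by (subst (asm) integral_nonneg_eq_0_iff_AE) auto
  then have ae: "AE x in I01. ?d x = 0" by simp
  have "inner (abs_L2 ?d) (abs_L2 ?d) = (\<integral>x. ?d x * ?d x \<partial>I01)"
    by (rule inner_L2.abs_eq) (auto simp: L2_eq_def L2_fun_rep)
  also have "\<dots> = (\<integral>x. 0 \<partial>I01)"
    using ae L2_fun_measurable[OF L2_fun_rep, of "w - w'"] by (intro integral_cong_AE) auto
  finally show ?thesis by simp
qed

section \<open>Spectral form of the semigroup\<close>

lemma laplace_graph_basis_sum:
  "laplace_graph (\<Sum>i\<in>I. c i *\<^sub>R ebasis i) (\<Sum>i\<in>I. (- eigval i * c i) *\<^sub>R ebasis i)"
proof (induction I rule: infinite_finite_induct)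
  case (insert x I)
  have "laplace_graph (c x *\<^sub>R ebasis x) ((- eigval x * c x) *\<^sub>R ebasis x)"
    using laplace_graph_scaleR[OF laplace_graph_ebasis, of "c x" x] by (simp add: mult.commute)
  from laplace_graph_add[OF this insert(3)] show ?case using insert(1,2) by simp
qed (use laplace_graph_scaleR[OF laplace_graph_ebasis, of 0] in simp_all)

lemma A_n_basis_sum:
  "A_n n (\<Sum>i=1..n. c i *\<^sub>R ebasis i) = (\<Sum>i=1..n. (- eigval i * c i) *\<^sub>R ebasis i)"
proof -
  have "laplace (\<Sum>i=1..n. c i *\<^sub>R ebasis i) = (\<Sum>i=1..n. (- eigval i * c i) *\<^sub>R ebasis i)"
    unfolding laplace_def
    by (rule the_equality) (use laplace_graph_basis_sum laplace_graph_unique in blast)+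
  then show ?thesis
    unfolding A_n_def P_n_def by (simp only:) (intro sum.cong refl, subst inner_basis_sum, auto)
qed

lemma A_n_power_basis_sum:
  "(A_n n ^^ k) (\<Sum>i=1..n. c i *\<^sub>R ebasis i) = (\<Sum>i=1..n. ((- eigval i) ^ k * c i) *\<^sub>R ebasis i)"
  by (induction k) (simp_all add: A_n_basis_sum mult.assoc)

text \<open>On eigenvectors the operator series decouples into finitely many scalar exponential
  series.\<close>

lemma S_n_basis_sum:
  "S_n n t (\<Sum>i=1..n. c i *\<^sub>R ebasis i) = (\<Sum>i=1..n. (exp (- eigval i * t) * c i) *\<^sub>R ebasis i)"
proof -
  have "(\<lambda>k. (t ^ k / fact k) *\<^sub>R (A_n n ^^ k) (\<Sum>i=1..n. c i *\<^sub>R ebasis i))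
      = (\<lambda>k. \<Sum>i=1..n. (((- eigval i * t) ^ k /\<^sub>R fact k) * c i) *\<^sub>R ebasis i)"
    unfolding A_n_power_basis_sum scaleR_sum_right
  proof (intro ext sum.cong refl)
    fix k i
    have "(- eigval i * t) ^ k = (- eigval i) ^ k * t ^ k"
      by (rule power_mult_distrib)
    then show "(t ^ k / fact k) *\<^sub>R ((- eigval i) ^ k * c i) *\<^sub>R ebasis i
        = (((- eigval i * t) ^ k /\<^sub>R fact k) * c i) *\<^sub>R ebasis i"
      by (simp only: scaleR_scaleR real_scaleR_def divide_inverse mult_ac)
  qed
  moreover have "(\<lambda>k. \<Sum>i=1..n. (((- eigval i * t) ^ k /\<^sub>R fact k) * c i) *\<^sub>R ebasis i) sums
      (\<Sum>i=1..n. (exp (- eigval i * t) * c i) *\<^sub>R ebasis i)"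
    by (intro sums_sum sums_scaleR_left sums_mult2 exp_converges)
  ultimately show ?thesis
    unfolding S_n_def by (simp only: sums_unique[symmetric])
qed

lemma S_n_H_n:
  assumes "u \<in> H_n n"
  shows "S_n n t u = (\<Sum>i=1..n. (exp (- eigval i * t) * inner u (ebasis i)) *\<^sub>R ebasis i)"
  using S_n_basis_sum[of n t "\<lambda>i. inner u (ebasis i)"] H_n_expand[OF assms] by simp

lemma inner_S_n:
  assumes "u \<in> H_n n" "i \<in> {1..n}"
  shows "inner (S_n n t u) (ebasis i) = exp (- eigval i * t) * inner u (ebasis i)"
  using assms by (simp only: S_n_H_n inner_basis_sum)

section \<open>The square root of the covariance on eigenvectors\<close>

text \<open>Factor \<open>S^2 - q\<close> as \<open>(S + sqrt q) (S - sqrt q)\<close>: the vector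
  \<open>w = (S - sqrt q) e\<close> satisfies \<open>S w = - sqrt q * w\<close>, which positivity of
  \<open>S\<close> allows only for \<open>w = 0\<close>.\<close>

lemma positive_sqrt_eigenvector:
  assumes "positive_sqrt S Q" "Q e = q *\<^sub>R e" "q > 0"
  shows "S e = sqrt q *\<^sub>R e"
proof -
  interpret bounded_linear S using assms(1) by (simp add: positive_sqrt_def)
  define w where "w = S e - sqrt q *\<^sub>R e"
  have "S (S e) = q *\<^sub>R e"
    using assms(1,2) by (auto simp: positive_sqrt_def o_def fun_eq_iff)
  then have "S w = - sqrt q *\<^sub>R w"
    using assms(3) by (simp add: w_def diff scaleR scaleR_diff_right)
  moreover have "0 \<le> inner (S w) w"
    using assms(1) by (simp add: positive_sqrt_def)
  ultimately have "sqrt q * inner w w \<le> 0" by simp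
  then have "inner w w \<le> 0" using assms(3) by (simp add: mult_le_0_iff)
  then have "inner w w = 0" using inner_ge_zero[of w] by linarith
  then have "w = 0" by simp
  then show ?thesis by (simp add: w_def)
qed

lemma inner_positive_sqrt_ebasis:
  assumes "positive_sqrt Qh Q" "Q (ebasis i) = q *\<^sub>R ebasis i" "q > 0"
  shows "inner (Qh u) (ebasis i) = sqrt q * inner u (ebasis i)"
  using positive_sqrt_eigenvector[OF assms] assms(1)
  by (simp add: positive_sqrt_def self_adjoint_def)

subsection \<open>Integral equations driven by continuous paths\<close>

text \<open>
  The mild equation with driving path \<open>N\<close>, given by its coordinates. The integral against \<open>dN\<close> has been
  integrated by parts, so that \<open>N\<close> may be any continuous path starting at 0.
\<close>

definition solves :: "(L2 \<Rightarrow> L2) \<Rightarrow> nat \<Rightarrow> (nat \<Rightarrow> real \<Rightarrow> real) \<Rightarrow> real \<Rightarrow> (real \<Rightarrow> L2) \<Rightarrow> bool" where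
  "solves F n N t x \<longleftrightarrow> continuous_on {0..t} x \<and> x ` {0..t} \<subseteq> H_n n \<and>
     (\<forall>s\<in>{0..t}. \<forall>i\<in>{1..n}.
        ((\<lambda>r. exp (- eigval i * (s - r)) * (inner (F (x r)) (ebasis i) - eigval i * N i r))
           has_integral (inner (x s) (ebasis i) - N i s)) {0..s})"

lemma solves_initial:
  assumes "solves F n N t x" "t \<ge> 0" "i \<in> {1..n}"
  shows "inner (x 0) (ebasis i) = N i 0"
proof -
  let ?f = "\<lambda>r. exp (- eigval i * (0 - r)) * (inner (F (x r)) (ebasis i) - eigval i * N i r)"
  have "(?f has_integral (inner (x 0) (ebasis i) - N i 0)) {0..0}"
  proof -
    have "0 \<in> {0..t}" using assms(2) by simp
    with assms(1,3) show ?thesis unfolding solves_def by blast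
  qed
  moreover have "(?f has_integral 0) {0..0}"
    using has_integral_refl(1)[of ?f 0] by (simp only: cbox_interval)
  ultimately have "inner (x 0) (ebasis i) - N i 0 = 0"
    by (rule has_integral_unique)
  then show ?thesis by simp
qed

text \<open>Variation of constants read backwards: pulling \<open>exp (- l * s)\<close> out of the
  integral leaves the primitive of a continuous function. This recovers the differential equation
  from the integral equation.\<close>

lemma exp_convolution_derivative:
  fixes y g :: "real \<Rightarrow> real"
  assumes "\<And>s. s \<in> {0..t} \<Longrightarrow> ((\<lambda>r. exp (- l * (s - r)) * g r) has_integral y s) {0..s}"
    and g: "continuous_on {0..t} g" and s: "s \<in> {0..t}"
  shows "(y has_real_derivative (- l * y s + g s)) (at s within {0..t})"
proof -
  define G where "G s = integral {0..s} (\<lambda>r. exp (l * r) * g r)" for s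
  have y: "y u = exp (- l * u) * G u" if "u \<in> {0..t}" for u
  proof -
    have "((\<lambda>r. exp (- l * u) * (exp (l * r) * g r)) has_integral y u) {0..u}"
      using assms(1)[OF that] by (simp add: exp_add[symmetric] algebra_simps)
    then have "integral {0..u} (\<lambda>r. exp (- l * u) * (exp (l * r) * g r)) = y u"
      by (rule integral_unique)
    then show ?thesis by (simp add: G_def)
  qed
  have "(G has_real_derivative exp (l * s) * g s) (at s within {0..t})"
    unfolding G_def using s g
    by (intro integral_has_real_derivative continuous_intros) auto
  then have "((\<lambda>u. exp (- l * u) * G u) has_real_derivative
      (exp (- l * s) * (exp (l * s) * g s) + exp (- l * s) * (- l) * G s)) (at s within {0..t})"
    by (auto intro!: derivative_eq_intros)
  moreover have "exp (- l * s) * (exp (l * s) * g s) + exp (- l * s) * (- l) * G s = - l * y s + g s"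
    using s by (simp add: y mult.assoc[symmetric] exp_add[symmetric])
  ultimately show ?thesis
    using y s by (subst has_field_derivative_cong_eventually[where g="\<lambda>u. exp (- l * u) * G u"])
      (auto simp: eventually_at_filter)
qed

lemma norm_P_n_le: "norm (P_n n u) \<le> norm u"
proof -
  have "(norm (P_n n u))\<^sup>2 = (\<Sum>i=1..n. inner (P_n n u) (ebasis i) * inner u (ebasis i))"
    unfolding norm_sq_eq_sum_coords[OF P_n_in_H_n]
    by (intro sum.cong refl) (simp add: inner_P_n power2_eq_square)
  also have "\<dots> = inner (P_n n u) u"
    by (rule inner_eq_sum_coords[OF P_n_in_H_n, symmetric])
  also have "\<dots> \<le> norm (P_n n u) * norm u" by (rule norm_cauchy_schwarz)
  finally have "norm (P_n n u) * norm (P_n n u) \<le> norm (P_n n u) * norm u"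
    by (simp add: power2_eq_square)
  then show ?thesis
    by (cases "norm (P_n n u) = 0") (auto simp: mult_le_cancel_left)
qed

lemma sum_coords_sq_le: "(\<Sum>i=1..n. (inner u (ebasis i))\<^sup>2) \<le> (norm u)\<^sup>2"
proof -
  have "(\<Sum>i=1..n. (inner u (ebasis i))\<^sup>2) = (norm (P_n n u))\<^sup>2"
    unfolding P_n_def by (rule norm_sq_basis_sum[symmetric])
  also have "\<dots> \<le> (norm u)\<^sup>2" by (intro power_mono norm_P_n_le) auto
  finally show ?thesis .
qed

section \<open>Existence by contraction\<close>

lemma exp_convolution_one:
  fixes l s :: real
  assumes "s \<ge> 0" "l > 0"
  shows "((\<lambda>r. exp (- l * (s - r))) has_integral ((1 - exp (- l * s)) / l)) {0..s}"
proof -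
  have "((\<lambda>r. exp (- l * (s - r))) has_integral (exp (- l * (s - s)) / l - exp (- l * (s - 0)) / l)) {0..s}"
    using assms by (intro fundamental_theorem_of_calculus)
      (auto intro!: derivative_eq_intros simp: has_real_derivative_iff_has_vector_derivative[symmetric])
  then show ?thesis by (simp add: diff_divide_distrib)
qed

text \<open>The diagonal kernel is dominated by its slowest mode,
  \<open>exp (- eigval 1 * (s - r))\<close>, whose total mass is at most
  \<open>1 / eigval 1\<close>.\<close>

lemma convolution_Lipschitz:
  assumes s: "s \<ge> 0" and n: "n \<ge> 1" and D: "D \<ge> 0"
    and c: "\<And>i. i \<in> {1..n} \<Longrightarrow> ((\<lambda>r. exp (- eigval i * (s - r)) * d i r) has_integral c i) {0..s}"
    and d: "\<And>r. r \<in> {0..s} \<Longrightarrow> (\<Sum>i=1..n. (d i r)\<^sup>2) \<le> D\<^sup>2"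
  shows "norm (\<Sum>i=1..n. c i *\<^sub>R ebasis i) \<le> D / eigval 1"
proof -
  let ?v = "\<lambda>r. \<Sum>i=1..n. (exp (- eigval i * (s - r)) * d i r) *\<^sub>R ebasis i"
  have l: "eigval 1 > 0" by (rule eigval_pos) simp
  have v: "(?v has_integral (\<Sum>i=1..n. c i *\<^sub>R ebasis i)) {0..s}"
    by (intro has_integral_sum has_integral_scaleR_left c) auto
  have e: "((\<lambda>r. D * exp (- eigval 1 * (s - r))) has_integral (D * ((1 - exp (- eigval 1 * s)) / eigval 1))) {0..s}"
    by (intro has_integral_mult_right exp_convolution_one s l)
  have "norm (?v r) \<le> D * exp (- eigval 1 * (s - r))" if r: "r \<in> {0..s}" for r
  proof (rule power2_le_imp_le)
    have "(norm (?v r))\<^sup>2 = (\<Sum>i=1..n. (exp (- eigval i * (s - r)) * d i r)\<^sup>2)"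
      by (rule norm_sq_basis_sum)
    also have "\<dots> \<le> (\<Sum>i=1..n. (exp (- eigval 1 * (s - r)))\<^sup>2 * (d i r)\<^sup>2)"
    proof (rule sum_mono)
      fix i assume i: "i \<in> {1..n}"
      have "eigval 1 * (s - r) \<le> eigval i * (s - r)"
        using r i by (intro mult_right_mono eigval_mono) auto
      then show "(exp (- eigval i * (s - r)) * d i r)\<^sup>2 \<le> (exp (- eigval 1 * (s - r)))\<^sup>2 * (d i r)\<^sup>2"
        unfolding power_mult_distrib by (intro mult_right_mono power_mono) auto
    qed
    also have "\<dots> = (exp (- eigval 1 * (s - r)))\<^sup>2 * (\<Sum>i=1..n. (d i r)\<^sup>2)"
      by (rule sum_distrib_left[symmetric])
    also have "\<dots> \<le> (exp (- eigval 1 * (s - r)))\<^sup>2 * D\<^sup>2"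
      by (intro mult_left_mono d r) auto
    finally show "(norm (?v r))\<^sup>2 \<le> (D * exp (- eigval 1 * (s - r)))\<^sup>2"
      by (simp add: power_mult_distrib mult.commute)
  qed (use D in auto)
  then have "norm (integral {0..s} ?v) \<le> integral {0..s} (\<lambda>r. D * exp (- eigval 1 * (s - r)))"
    using v e by (intro integral_norm_bound_integral) auto
  also have "\<dots> = D * ((1 - exp (- eigval 1 * s)) / eigval 1)"
    using e by (rule integral_unique)
  also have "\<dots> \<le> D * (1 / eigval 1)"
    using l D by (intro mult_left_mono divide_right_mono) auto
  finally show ?thesis using integral_unique[OF v] by simp
qed

lemma continuous_on_if_Lipschitz:
  fixes F :: "'a::real_normed_vector \<Rightarrow> 'b::real_normed_vector"
  assumes "\<And>u v. norm (F u - F v) \<le> L * norm (u - v)" "0 \<le> L"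
  shows "continuous_on A F"
  using assms by (intro lipschitz_on_continuous_on[where L=L] lipschitz_onI) (auto simp: dist_norm)

text \<open>Since \<open>L_F < eigval 1\<close>, the mild fixed-point map contracts in the supremum
  norm on the whole of \<open>[0,t]\<close>, with factor \<open>L_F / eigval 1\<close>; neither
  short time steps nor a weighted norm is required.\<close>

lemma ex_solves:
  assumes lip: "\<And>u v. norm (F u - F v) \<le> L_F * norm (u - v)"
    and L: "0 \<le> L_F" "L_F < eigval 1" and n: "n \<ge> 1" and t: "t \<ge> 0"
    and N: "\<And>i. i \<in> {1..n} \<Longrightarrow> continuous_on {0..t} (N i)"
  shows "\<exists>x. solves F n N t x"
proof -
  have cF: "continuous_on UNIV F" by (rule continuous_on_if_Lipschitz[OF lip L(1)])
  define c where "c g i s = integral {0..s} (\<lambda>r. exp (- eigval i * (s - r)) *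
      (inner (F (g r)) (ebasis i) - eigval i * N i r))" for g i s
  define h where "h g s = (\<Sum>i=1..n. (N i s + c g i s) *\<^sub>R ebasis i)" for g s
  have integrand: "continuous_on {0..t} (\<lambda>r. inner (F (g r)) (ebasis i) - eigval i * N i r)"
    if "continuous_on {0..t} g" "i \<in> {1..n}" for g i
    by (intro continuous_intros N that continuous_on_compose2[OF cF]) auto
  have c: "((\<lambda>r. exp (- eigval i * (s - r)) * (inner (F (g r)) (ebasis i) - eigval i * N i r))
      has_integral c g i s) {0..s}"
    if "continuous_on {0..t} g" "i \<in> {1..n}" "s \<in> {0..t}" for g i s
    unfolding c_def using that(3)
    by (intro integrable_integral integrable_continuous_interval continuous_intros
        continuous_on_subset[OF integrand[OF that(1,2)]]) auto
  have cc: "continuous_on {0..t} (c g i)" if "continuous_on {0..t} g" "i \<in> {1..n}" for g i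
    by (rule DERIV_continuous_on[OF exp_convolution_derivative[OF c[OF that] integrand[OF that]]])
  have ch: "continuous_on (cbox 0 t) (h g)" if "continuous_on {0..t} g" for g
    unfolding h_def using that by (auto intro!: continuous_intros N cc)
  \<comment> \<open>The fixed-point theorem acts on a complete type. Paths on \<open>[0,t]\<close>
    are therefore extended by \<open>clamp\<close> to bounded continuous functions on the line,
    constant outside the interval.\<close>
  have "\<forall>g :: real \<Rightarrow>\<^sub>C L2. \<exists>k :: real \<Rightarrow>\<^sub>C L2. \<forall>x. k x = h g (clamp 0 t x)"
  proof
    fix g :: "real \<Rightarrow>\<^sub>C L2"
    have "continuous_on {0..t} (apply_bcontfun g)"
      using bcontfun_def apply_bcontfun continuous_on_subset by (metis (no_types) mem_Collect_eq subset_UNIV)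
    from continuous_on_cbox_bcontfunE[OF ch[OF this]]
    show "\<exists>k :: real \<Rightarrow>\<^sub>C L2. \<forall>x. k x = h g (clamp 0 t x)" by metis
  qed
  then obtain T :: "(real \<Rightarrow>\<^sub>C L2) \<Rightarrow> (real \<Rightarrow>\<^sub>C L2)" where T: "\<And>g x. T g x = h g (clamp 0 t x)"
    by metis
  have cont: "continuous_on {0..t} (apply_bcontfun g)" for g :: "real \<Rightarrow>\<^sub>C L2"
    by (intro continuous_on_subset[OF continuous_on_apply_bcontfun]) auto
  have contr: "dist (T g) (T k) \<le> L_F / eigval 1 * dist g k" for g k
  proof (rule dist_bound)
    fix x :: real
    define s where "s = clamp 0 t x"
    have "s \<in> cbox 0 t" unfolding s_def by (rule clamp_in_interval) (use t in simp)
    then have s: "s \<in> {0..t}" by simp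
    have "T g x - T k x = (\<Sum>i=1..n. (c g i s - c k i s) *\<^sub>R ebasis i)"
      unfolding T h_def s_def[symmetric] by (simp add: sum_subtractf[symmetric] algebra_simps)
    also have "norm \<dots> \<le> (L_F * dist g k) / eigval 1"
    proof (rule convolution_Lipschitz[where s=s and d="\<lambda>i r. inner (F (g r) - F (k r)) (ebasis i)"])
      fix i assume i: "i \<in> {1..n}"
      show "((\<lambda>r. exp (- eigval i * (s - r)) * inner (F (g r) - F (k r)) (ebasis i)) has_integral
          (c g i s - c k i s)) {0..s}"
        using has_integral_diff[OF c[OF cont i s, of g] c[OF cont i s, of k]]
        by (simp add: inner_diff_left algebra_simps)
    next
      fix r
      have "norm (F (g r) - F (k r)) \<le> L_F * dist g k"
        using lip[of "g r" "k r"] dist_bounded[of g r k] L(1)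
        by (metis dist_norm mult_left_mono order_trans)
      then have "(norm (F (g r) - F (k r)))\<^sup>2 \<le> (L_F * dist g k)\<^sup>2"
        by (intro power_mono) auto
      then show "(\<Sum>i=1..n. (inner (F (g r) - F (k r)) (ebasis i))\<^sup>2) \<le> (L_F * dist g k)\<^sup>2"
        using sum_coords_sq_le[where u="F (g r) - F (k r)"] order_trans by blast
    qed (use s n L in auto)
    finally show "dist (T g x) (T k x) \<le> L_F / eigval 1 * dist g k"
      by (simp add: dist_norm)
  qed
  obtain x where x: "T x = x"
    using banach_fix_type[of "L_F / eigval 1" T] contr L by auto
  have xh: "x s = h x s" if "s \<in> {0..t}" for s
    using T[of x s] that unfolding x by simp
  show ?thesis
  proof (rule exI[of _ "apply_bcontfun x"], unfold solves_def, intro conjI ballI)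
    show "apply_bcontfun x ` {0..t} \<subseteq> H_n n"
      using xh basis_sum_in_H_n by (auto simp: h_def)
    fix s i assume si: "s \<in> {0..t}" "i \<in> {1..n}"
    have "inner (h x s) (ebasis i) = N i s + c x i s"
      unfolding h_def by (rule inner_basis_sum[OF si(2)])
    then have "inner (x s) (ebasis i) - N i s = c x i s"
      using xh[OF si(1)] by simp
    then show "((\<lambda>r. exp (- eigval i * (s - r)) * (inner (F (x r)) (ebasis i) - eigval i * N i r))
        has_integral (inner (x s) (ebasis i) - N i s)) {0..s}"
      using c[OF cont si(2,1), of x] by (simp only:)
  qed (rule cont)
qed

section \<open>Dissipative comparison of two driving paths\<close>

text \<open>The left side is the time derivative of the squared norm of \<open>u\<close>, where
  \<open>u + m\<close> is the difference of two solutions. The spectral gap contributes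
  \<open>-2 * eigval 1\<close> and the Lipschitz term at most \<open>2 * L_F\<close>; one half of
  the resulting rate \<open>2 * \<kappa>\<close> absorbs the cross terms with \<open>m\<close> by
  completing a square, which is where the constant \<open>(eigval n + L_F)^2 / \<kappa>\<close>
  comes from.\<close>

lemma energy_dissipation:
  assumes n: "n \<ge> 1" and L: "0 \<le> L_F" "L_F < eigval 1"
    and F: "(norm d)\<^sup>2 \<le> (L_F * norm (\<Sum>i=1..n. (u i + m i) *\<^sub>R ebasis i))\<^sup>2"
  shows "(\<Sum>i=1..n. 2 * u i * (- eigval i * (u i + m i) + inner d (ebasis i)))
    \<le> - (eigval 1 - L_F) * (\<Sum>i=1..n. (u i)\<^sup>2)
      + (eigval n + L_F)\<^sup>2 / (eigval 1 - L_F) * (\<Sum>i=1..n. (m i)\<^sup>2)"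
proof -
  define U where "U = (\<Sum>i=1..n. u i *\<^sub>R ebasis i)"
  define Mv where "Mv = (\<Sum>i=1..n. m i *\<^sub>R ebasis i)"
  define AM where "AM = (\<Sum>i=1..n. (eigval i * m i) *\<^sub>R ebasis i)"
  define \<kappa> where "\<kappa> = eigval 1 - L_F"
  have k: "\<kappa> > 0" using L by (simp add: \<kappa>_def)
  have Uc: "inner U (ebasis i) = u i" if "i \<in> {1..n}" for i
    unfolding U_def by (rule inner_basis_sum[OF that])
  have UH: "U \<in> H_n n" unfolding U_def by (rule basis_sum_in_H_n)
  have nU: "(norm U)\<^sup>2 = (\<Sum>i=1..n. (u i)\<^sup>2)" and nM: "(norm Mv)\<^sup>2 = (\<Sum>i=1..n. (m i)\<^sup>2)"
    unfolding U_def Mv_def by (rule norm_sq_basis_sum)+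
  have d: "norm d \<le> L_F * (norm U + norm Mv)"
  proof -
    have "(\<Sum>i=1..n. (u i + m i) *\<^sub>R ebasis i) = U + Mv"
      by (simp add: U_def Mv_def sum.distrib scaleR_add_left)
    from F[unfolded this] have "norm d \<le> L_F * norm (U + Mv)"
      by (rule power2_le_imp_le) (use L(1) in simp)
    also have "\<dots> \<le> L_F * (norm U + norm Mv)"
      by (intro mult_left_mono norm_triangle_ineq L)
    finally show ?thesis .
  qed
  have AM: "norm AM \<le> eigval n * norm Mv"
  proof (rule power2_le_imp_le)
    have "(norm AM)\<^sup>2 = (\<Sum>i=1..n. (eigval i * m i)\<^sup>2)"
      unfolding AM_def by (rule norm_sq_basis_sum)
    also have "\<dots> \<le> (\<Sum>i=1..n. (eigval n)\<^sup>2 * (m i)\<^sup>2)"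
      unfolding power_mult_distrib
      by (intro sum_mono mult_right_mono power_mono eigval_mono eigval_nonneg) auto
    finally show "(norm AM)\<^sup>2 \<le> (eigval n * norm Mv)\<^sup>2"
      by (simp add: power_mult_distrib nM sum_distrib_left)
  qed (use eigval_nonneg in auto)
  have s1: "eigval 1 * (norm U)\<^sup>2 \<le> (\<Sum>i=1..n. eigval i * (u i)\<^sup>2)"
    unfolding nU sum_distrib_left by (intro sum_mono mult_right_mono eigval_mono) auto
  have s2: "(\<Sum>i=1..n. u i * (eigval i * m i)) = inner U AM"
  proof -
    have "inner U AM = (\<Sum>i=1..n. inner U (ebasis i) * inner AM (ebasis i))"
      by (rule inner_eq_sum_coords[OF UH])
    then show ?thesis
      by (simp add: Uc AM_def inner_basis_sum)
  qed
  have s3: "(\<Sum>i=1..n. u i * inner d (ebasis i)) = inner U d"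
    using inner_eq_sum_coords[OF UH, of d] by (simp add: Uc)
  have "(\<Sum>i=1..n. 2 * u i * (- eigval i * (u i + m i) + inner d (ebasis i)))
     = - 2 * (\<Sum>i=1..n. eigval i * (u i)\<^sup>2) - 2 * (\<Sum>i=1..n. u i * (eigval i * m i))
       + 2 * (\<Sum>i=1..n. u i * inner d (ebasis i))"
    unfolding sum_distrib_left sum.distrib[symmetric] sum_subtractf[symmetric]
    by (intro sum.cong refl) (simp add: algebra_simps power2_eq_square)
  also have "\<dots> \<le> - 2 * (eigval 1 * (norm U)\<^sup>2) + 2 * (norm U * (eigval n * norm Mv))
       + 2 * (norm U * (L_F * (norm U + norm Mv)))"
  proof -
    have "- inner U AM \<le> norm U * norm AM"
      using Cauchy_Schwarz_ineq2[of U AM] by linarith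
    also have "\<dots> \<le> norm U * (eigval n * norm Mv)"
      by (intro mult_left_mono AM) auto
    finally have a: "- inner U AM \<le> norm U * (eigval n * norm Mv)" .
    have "inner U d \<le> norm U * norm d" by (rule norm_cauchy_schwarz)
    also have "\<dots> \<le> norm U * (L_F * (norm U + norm Mv))"
      by (intro mult_left_mono d) auto
    finally show ?thesis using s1 a unfolding s2 s3 by linarith
  qed
  also have "\<dots> = - 2 * \<kappa> * (norm U)\<^sup>2 + 2 * (eigval n + L_F) * norm U * norm Mv"
    by (simp add: \<kappa>_def algebra_simps power2_eq_square)
  also have "\<dots> \<le> - \<kappa> * (norm U)\<^sup>2 + (eigval n + L_F)\<^sup>2 / \<kappa> * (norm Mv)\<^sup>2"
  proof -
    have "0 \<le> (\<kappa> * norm U - (eigval n + L_F) * norm Mv)\<^sup>2 / \<kappa>" using k by simp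
    also have "\<dots> = \<kappa> * (norm U)\<^sup>2 - 2 * (eigval n + L_F) * norm U * norm Mv
        + (eigval n + L_F)\<^sup>2 / \<kappa> * (norm Mv)\<^sup>2"
      using k by (simp add: power2_diff power_mult_distrib field_simps power2_eq_square)
    finally show ?thesis by simp
  qed
  finally show ?thesis by (simp add: \<kappa>_def nU nM)
qed

text \<open>Driving paths enter only through values of their difference \<open>D\<close>, never
  through derivatives, and in the integral only relative to the final value \<open>D i t\<close>.
  The first term is what remains of the mismatch at time 0.\<close>

lemma solves_compare:
  assumes x: "solves F n N1 t x1" "solves F n N2 t x2"
    and lip: "\<And>u v. norm (F u - F v) \<le> L_F * norm (u - v)"
    and L: "0 \<le> L_F" "L_F < eigval 1" and n: "n \<ge> 1" and t: "t > 0"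
    and N1: "\<And>i. i \<in> {1..n} \<Longrightarrow> continuous_on {0..t} (N1 i)"
    and N2: "\<And>i. i \<in> {1..n} \<Longrightarrow> continuous_on {0..t} (N2 i)"
    and D: "\<And>i s. D i s = N1 i s - N2 i s"
  defines "\<kappa> \<equiv> eigval 1 - L_F"
  shows "(norm (x1 t - x2 t))\<^sup>2 \<le> exp (- \<kappa> * t) * (\<Sum>i=1..n. (D i t)\<^sup>2)
     + (eigval n + L_F)\<^sup>2 / \<kappa> * integral {0..t} (\<lambda>s. exp (- \<kappa> * (t - s)) * (\<Sum>i=1..n. (D i s - D i t)\<^sup>2))"
proof -
  define C where "C = (eigval n + L_F)\<^sup>2 / \<kappa>"
  have cF: "continuous_on UNIV F" by (rule continuous_on_if_Lipschitz[OF lip L(1)])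
  \<comment> \<open>Subtracting the driving error makes \<open>u\<close> differentiable. Normalising
    that error to vanish at time \<open>t\<close> makes \<open>u\<close> at time \<open>t\<close>
    the exact difference of the solutions; the price is the initial value
    \<open>u i 0 = D i t\<close>, which is discounted over the whole interval.\<close>
  define u where "u i s = inner (x1 s) (ebasis i) - inner (x2 s) (ebasis i) - (D i s - D i t)" for i s
  define u' where "u' i s = - eigval i * (u i s + (D i s - D i t)) + inner (F (x1 s) - F (x2 s)) (ebasis i)" for i s
  have cx: "continuous_on {0..t} x1" "continuous_on {0..t} x2"
    using x by (auto simp: solves_def)
  have xH: "x1 s \<in> H_n n" "x2 s \<in> H_n n" if "s \<in> {0..t}" for s
    using x that by (auto simp: solves_def)
  have cD: "continuous_on {0..t} (D i)" if "i \<in> {1..n}" for i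
    unfolding D by (intro continuous_intros N1 N2 that)
  have du: "(u i has_real_derivative u' i s) (at s within {0..t})" if i: "i \<in> {1..n}" and s: "s \<in> {0..t}" for i s
  proof -
    have "((\<lambda>s. inner (x1 s) (ebasis i) - N1 i s) has_real_derivative
       (- eigval i * (inner (x1 s) (ebasis i) - N1 i s) + (inner (F (x1 s)) (ebasis i) - eigval i * N1 i s)))
       (at s within {0..t})"
      using x(1) i s by (intro exp_convolution_derivative continuous_intros N1 continuous_on_compose2[OF cF] cx)
        (auto simp: solves_def)
    moreover have "((\<lambda>s. inner (x2 s) (ebasis i) - N2 i s) has_real_derivative
       (- eigval i * (inner (x2 s) (ebasis i) - N2 i s) + (inner (F (x2 s)) (ebasis i) - eigval i * N2 i s)))
       (at s within {0..t})"
      using x(2) i s by (intro exp_convolution_derivative continuous_intros N2 continuous_on_compose2[OF cF] cx)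
        (auto simp: solves_def)
    ultimately have "((\<lambda>s. (inner (x1 s) (ebasis i) - N1 i s) - (inner (x2 s) (ebasis i) - N2 i s) + D i t)
       has_real_derivative
       ((- eigval i * (inner (x1 s) (ebasis i) - N1 i s) + (inner (F (x1 s)) (ebasis i) - eigval i * N1 i s))
       - (- eigval i * (inner (x2 s) (ebasis i) - N2 i s) + (inner (F (x2 s)) (ebasis i) - eigval i * N2 i s)) + 0))
       (at s within {0..t})"
      by (intro DERIV_add DERIV_diff DERIV_const)
    moreover have "(\<lambda>s. (inner (x1 s) (ebasis i) - N1 i s) - (inner (x2 s) (ebasis i) - N2 i s) + D i t) = u i"
      by (auto simp: u_def D)
    moreover have "((- eigval i * (inner (x1 s) (ebasis i) - N1 i s) + (inner (F (x1 s)) (ebasis i) - eigval i * N1 i s))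
       - (- eigval i * (inner (x2 s) (ebasis i) - N2 i s) + (inner (F (x2 s)) (ebasis i) - eigval i * N2 i s)) + 0)
       = u' i s"
      by (simp add: u'_def u_def D inner_diff_left algebra_simps)
    ultimately show ?thesis by simp
  qed
  define E where "E s = (\<Sum>i=1..n. (u i s)\<^sup>2)" for s
  define m where "m s = (\<Sum>i=1..n. (D i s - D i t)\<^sup>2)" for s
  have cm: "continuous_on {0..t} m"
    unfolding m_def by (intro continuous_intros cD)
  define J where "J s = integral {0..s} (\<lambda>r. exp (\<kappa> * r) * m r)" for s
  \<comment> \<open>Gronwall's inequality in differential form: the dissipation estimate says that
    \<open>G\<close> is nonincreasing.\<close>
  define G where "G s = exp (\<kappa> * s) * E s - C * J s" for s
  have dE: "(E has_real_derivative (\<Sum>i=1..n. 2 * u i s * u' i s)) (at s within {0..t})" if "s \<in> {0..t}" for s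
    unfolding E_def by (rule DERIV_sum, rule derivative_eq_intros) (use du that in auto)
  have dJ: "(J has_real_derivative exp (\<kappa> * s) * m s) (at s within {0..t})" if "s \<in> {0..t}" for s
    unfolding J_def using that cm by (intro integral_has_real_derivative continuous_intros) auto
  define G' where "G' s = exp (\<kappa> * s) * (\<kappa> * E s + (\<Sum>i=1..n. 2 * u i s * u' i s) - C * m s)" for s
  have dG: "(G has_real_derivative G' s) (at s within {0..t})" if "s \<in> {0..t}" for s
  proof -
    have "(G has_real_derivative exp (\<kappa> * s) * (\<Sum>i=1..n. 2 * u i s * u' i s) + exp (\<kappa> * s) * \<kappa> * E s
        - C * (exp (\<kappa> * s) * m s)) (at s within {0..t})"
      unfolding G_def by (rule derivative_eq_intros dE dJ that refl | simp)+
    then show ?thesis by (simp add: G'_def algebra_simps)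
  qed
  have G'_le: "G' s \<le> 0" if s: "s \<in> {0..t}" for s
  proof -
    have "(\<Sum>i=1..n. 2 * u i s * u' i s) \<le> - \<kappa> * E s + C * m s"
      unfolding u'_def E_def m_def C_def \<kappa>_def
    proof (rule energy_dissipation[OF n L])
      have "(\<Sum>i=1..n. (u i s + (D i s - D i t)) *\<^sub>R ebasis i) = x1 s - x2 s"
        using xH[OF s] subspace_H_n
        by (intro H_n_eqI[where n=n] basis_sum_in_H_n)
          (auto simp: u_def inner_diff_left inner_basis_sum subspace_diff)
      then show "(norm (F (x1 s) - F (x2 s)))\<^sup>2
          \<le> (L_F * norm (\<Sum>i=1..n. (u i s + (D i s - D i t)) *\<^sub>R ebasis i))\<^sup>2"
        using lip by (simp only:) (intro power_mono, auto)
    qed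
    then show ?thesis
      by (auto simp: G'_def intro: mult_nonneg_nonpos)
  qed
  have "G t \<le> G 0"
  proof (rule DERIV_nonpos_imp_decreasing_open[of 0 t G])
    show "continuous_on {0..t} G" by (rule DERIV_continuous_on[OF dG])
    fix s assume "0 < s" "s < t"
    then show "\<exists>y. (G has_real_derivative y) (at s) \<and> y \<le> 0"
      using dG[of s] G'_le[of s] at_within_Icc_at[of 0 s t] by auto
  qed (use t in auto)
  moreover have "G 0 = (\<Sum>i=1..n. (D i t)\<^sup>2)"
  proof -
    have "u i 0 = D i t" if i: "i \<in> {1..n}" for i
      using solves_initial[OF x(1) _ i] solves_initial[OF x(2) _ i] t by (simp add: u_def D)
    then show ?thesis by (simp add: G_def E_def J_def)
  qed
  moreover have "E t = (norm (x1 t - x2 t))\<^sup>2"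
    using t xH[of t] subspace_H_n
    by (subst norm_sq_eq_sum_coords[where n=n]) (auto simp: E_def u_def inner_diff_left subspace_diff)
  ultimately have "exp (\<kappa> * t) * (norm (x1 t - x2 t))\<^sup>2 \<le> (\<Sum>i=1..n. (D i t)\<^sup>2) + C * J t"
    by (simp add: G_def)
  then have "exp (- \<kappa> * t) * (exp (\<kappa> * t) * (norm (x1 t - x2 t))\<^sup>2)
      \<le> exp (- \<kappa> * t) * ((\<Sum>i=1..n. (D i t)\<^sup>2) + C * J t)"
    by (intro mult_left_mono) auto
  then have "(norm (x1 t - x2 t))\<^sup>2 \<le> exp (- \<kappa> * t) * (\<Sum>i=1..n. (D i t)\<^sup>2) + C * (exp (- \<kappa> * t) * J t)"
    by (simp add: mult.assoc[symmetric] exp_add[symmetric] distrib_left mult.commute[of _ C])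
  moreover have "exp (- \<kappa> * t) * J t = integral {0..t} (\<lambda>s. exp (- \<kappa> * (t - s)) * m s)"
  proof -
    have "exp (- \<kappa> * (t - s)) * m s = exp (- \<kappa> * t) * (exp (\<kappa> * s) * m s)" for s
      unfolding mult.assoc[symmetric] exp_add[symmetric] by (simp add: algebra_simps)
    then have "(\<lambda>s. exp (- \<kappa> * (t - s)) * m s) = (\<lambda>s. exp (- \<kappa> * t) * (exp (\<kappa> * s) * m s))" by blast
    then show ?thesis unfolding J_def by (simp only: integral_mult_right)
  qed
  ultimately show ?thesis by (simp add: C_def m_def)
qed

subsection \<open>Piecewise constant controls\<close>

definition ramp :: "real \<Rightarrow> real" where
  "ramp x = max 0 (min 1 x)"

definition in_cell :: "nat \<Rightarrow> real \<Rightarrow> real" where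
  "in_cell k x = (if \<lfloor>x\<rfloor> = int k then 1 else 0)"

text \<open>\<open>c k\<close> is the increment over cell \<open>k\<close>. As a sum of shifted
  ramps, rather than by cases, the polygon is linear in its coefficients, so continuity and
  convolution identities reduce to a single ramp.\<close>

definition broken_line :: "real \<Rightarrow> real \<Rightarrow> nat \<Rightarrow> (nat \<Rightarrow> real) \<Rightarrow> real \<Rightarrow> real" where
  "broken_line a h m c s = (\<Sum>k<m. c k * ramp ((s - a) / h - real k))"

text \<open>In each coordinate this is the derivative of the broken line away from its nodes. The
  cells are half-open, so at most one \<open>k\<close> contributes at any time.\<close>

definition slope_control :: "nat \<Rightarrow> real \<Rightarrow> real \<Rightarrow> nat \<Rightarrow> (nat \<Rightarrow> nat \<Rightarrow> real) \<Rightarrow> real \<Rightarrow> L2" where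
  "slope_control n a h m c s = (\<Sum>i=1..n. (\<Sum>k<m. c i k * in_cell k ((s - a) / h) / h) *\<^sub>R ebasis i)"

lemma ramp_derivative:
  assumes "x \<noteq> 0" "x \<noteq> 1"
  shows "(ramp has_real_derivative in_cell 0 x) (at x)"
proof -
  consider "x < 0" | "0 < x" "x < 1" | "1 < x" using assms by linarith
  then show ?thesis
  proof cases
    case 1
    then have "in_cell 0 x = 0" by (simp add: in_cell_def floor_eq_iff)
    moreover have "(ramp has_real_derivative 0) (at x)"
      by (rule has_field_derivative_transform_within_open[of "\<lambda>_. 0" _ _ "{..<0}"])
        (use 1 in \<open>auto simp: ramp_def\<close>)
    ultimately show ?thesis by simp
  next
    case 2
    then have "in_cell 0 x = 1" by (simp add: in_cell_def floor_eq_iff)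
    moreover have "(ramp has_real_derivative 1) (at x)"
      by (rule has_field_derivative_transform_within_open[of "\<lambda>x. x" _ _ "{0<..<1}"])
        (use 2 in \<open>auto simp: ramp_def\<close>)
    ultimately show ?thesis by simp
  next
    case 3
    then have "in_cell 0 x = 0" by (simp add: in_cell_def floor_eq_iff)
    moreover have "(ramp has_real_derivative 0) (at x)"
      by (rule has_field_derivative_transform_within_open[of "\<lambda>_. 1" _ _ "{1<..}"])
        (use 3 in \<open>auto simp: ramp_def\<close>)
    ultimately show ?thesis by simp
  qed
qed

lemma in_cell_shift: "in_cell 0 (x - real k) = in_cell k x"
proof -
  have "\<lfloor>x - real k\<rfloor> = \<lfloor>x\<rfloor> - int k"
    by (metis floor_diff_of_int of_int_of_nat_eq)
  then show ?thesis by (simp add: in_cell_def)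
qed

text \<open>The integrand is the derivative of \<open>exp (- l * (s - r)) * ramp\<close> off the two
  kinks, and the fundamental theorem tolerates finitely many exceptional points. The boundary term
  at 0 vanishes because \<open>a \<ge> 0\<close>. This is the integration by parts that links a
  control to its integrated path in \<open>solves\<close>.\<close>

lemma ramp_convolution:
  assumes "a \<ge> 0" "h > 0" "s \<ge> 0"
  shows "((\<lambda>r. exp (- l * (s - r)) * (in_cell k ((r - a) / h) / h + l * ramp ((r - a) / h - real k)))
      has_integral ramp ((s - a) / h - real k)) {0..s}"
proof -
  let ?f = "\<lambda>r. exp (- l * (s - r)) * ramp ((r - a) / h - real k)"
  have "(0 - a) / h \<le> 0" using assms(1,2) by (intro divide_nonpos_pos) auto
  then have "(0 - a) / h - real k \<le> 0" by simp
  then have f0: "?f 0 = 0" by (simp add: ramp_def)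
  have "((\<lambda>r. exp (- l * (s - r)) * (in_cell k ((r - a) / h) / h + l * ramp ((r - a) / h - real k)))
      has_integral (?f s - ?f 0)) {0..s}"
  proof (rule fundamental_theorem_of_calculus_interior_strong[where S="{a + real k * h, a + real (Suc k) * h}"])
    fix x assume x: "x \<in> {0<..<s} - {a + real k * h, a + real (Suc k) * h}"
    have "(x - a) / h - real k \<noteq> 0" "(x - a) / h - real k \<noteq> 1"
      using x assms(2) by (auto simp: field_simps)
    note d = ramp_derivative[OF this, unfolded in_cell_shift]
    have e: "((\<lambda>r. (r - a) / h - real k) has_real_derivative 1 / h) (at x)"
      using assms(2) by (auto intro!: derivative_eq_intros)
    have "(?f has_real_derivative (exp (- l * (s - x)) * (- l * (0 - 1))) * ramp ((x - a) / h - real k)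
        + exp (- l * (s - x)) * (in_cell k ((x - a) / h) * (1 / h))) (at x)"
      by (rule derivative_eq_intros DERIV_chain2[OF d e] refl | simp)+
    then show "(?f has_vector_derivative
        exp (- l * (s - x)) * (in_cell k ((x - a) / h) / h + l * ramp ((x - a) / h - real k))) (at x)"
      unfolding has_real_derivative_iff_has_vector_derivative[symmetric] by (simp add: algebra_simps)
  next
    show "continuous_on {0..s} ?f"
      using assms(2) unfolding ramp_def by (intro continuous_intros) auto
  qed (use assms in auto)
  then show ?thesis unfolding f0 by simp
qed

lemma broken_line_convolution:
  assumes "a \<ge> 0" "h > 0" "s \<ge> 0"
  shows "((\<lambda>r. exp (- l * (s - r)) * ((\<Sum>k<m. c k * in_cell k ((r - a) / h) / h) + l * broken_line a h m c r))
      has_integral broken_line a h m c s) {0..s}"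
proof -
  have "((\<lambda>r. \<Sum>k<m. c k * (exp (- l * (s - r)) * (in_cell k ((r - a) / h) / h + l * ramp ((r - a) / h - real k))))
      has_integral broken_line a h m c s) {0..s}"
    unfolding broken_line_def
    by (intro has_integral_sum has_integral_mult_right ramp_convolution assms) simp
  moreover have "(\<Sum>k<m. c k * (exp (- l * (s - r)) * (in_cell k ((r - a) / h) / h + l * ramp ((r - a) / h - real k))))
     = exp (- l * (s - r)) * ((\<Sum>k<m. c k * in_cell k ((r - a) / h) / h) + l * broken_line a h m c r)" for r
    unfolding broken_line_def distrib_left sum_distrib_left sum.distrib[symmetric]
    by (intro sum.cong refl) simp
  ultimately show ?thesis by (simp only:)
qed

lemma continuous_on_broken_line: "h \<noteq> 0 \<Longrightarrow> continuous_on A (broken_line a h m c)"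
  unfolding broken_line_def ramp_def by (intro continuous_intros) auto

lemma broken_line_0:
  assumes "a \<ge> 0" "h > 0"
  shows "broken_line a h m c 0 = 0"
  unfolding broken_line_def
proof (intro sum.neutral ballI)
  fix k
  have "(0 - a) / h \<le> 0" using assms by (intro divide_nonpos_pos) auto
  then have "(0 - a) / h - real k \<le> 0" by simp
  then show "c k * ramp ((0 - a) / h - real k) = 0" by (simp add: ramp_def)
qed

text \<open>Factors the control through an integer-valued map: every function on the discrete
  integers into \<open>H_n n\<close> is measurable, so only the floor function has to be
  checked.\<close>

lemma slope_control_eq_comp:
  "slope_control n a h m c s =
    (\<lambda>j. \<Sum>i=1..n. (\<Sum>k<m. c i k * (if j = int k then 1 else 0) / h) *\<^sub>R ebasis i) \<lfloor>(s - a) / h\<rfloor>"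
  by (simp add: slope_control_def in_cell_def)

lemma slope_control_measurable:
  "slope_control n a h m c \<in> restrict_space lborel A \<rightarrow>\<^sub>M borel_n n"
  unfolding slope_control_eq_comp[abs_def]
proof (rule measurable_compose[where N="count_space UNIV" and f="\<lambda>s. \<lfloor>(s - a) / h\<rfloor>"])
  show "(\<lambda>s. \<lfloor>(s - a) / h\<rfloor>) \<in> restrict_space lborel A \<rightarrow>\<^sub>M count_space UNIV"
    by (rule measurable_restrict_space1) measurable
qed (auto simp: basis_sum_in_H_n space_restrict_space)

text \<open>The cells are disjoint, so the square has no cross terms.\<close>

lemma sq_sum_in_cell:
  "(\<Sum>k<m. c k * in_cell k x / h)\<^sup>2 = (\<Sum>k<m. (c k / h)\<^sup>2 * in_cell k x)"
proof (cases "\<exists>j<m. \<lfloor>x\<rfloor> = int j")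
  case True
  then obtain j where j: "j < m" "\<lfloor>x\<rfloor> = int j" by blast
  have "(\<Sum>k<m. c k * in_cell k x / h) = (\<Sum>k<m. if k = j then c k / h else 0)"
    by (intro sum.cong refl) (simp add: in_cell_def j)
  moreover have "(\<Sum>k<m. (c k / h)\<^sup>2 * in_cell k x) = (\<Sum>k<m. if k = j then (c k / h)\<^sup>2 else 0)"
    by (intro sum.cong refl) (simp add: in_cell_def j)
  ultimately show ?thesis using j(1) by simp
next
  case False
  then have "in_cell k x = 0" if "k < m" for k
    using that by (auto simp: in_cell_def)
  then show ?thesis by simp
qed

text \<open>Slope \<open>c / h\<close> on a cell of length \<open>h\<close> costs
  \<open>c^2 / h\<close>. Only an inequality, since the horizon \<open>T\<close> may cut off
  cells.\<close>

lemma control_energy_slope_control: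
  assumes "h > 0"
  shows "control_energy T (slope_control n a h m c) \<le> ennreal (\<Sum>i=1..n. \<Sum>k<m. (c i k)\<^sup>2 / h)"
proof -
  define w where "w k = (\<Sum>i=1..n. (c i k / h)\<^sup>2)" for k
  have w: "w k \<ge> 0" for k unfolding w_def by (intro sum_nonneg) auto
  have nn: "(norm (slope_control n a h m c s))\<^sup>2 = (\<Sum>k<m. w k * in_cell k ((s - a) / h))" for s
    unfolding slope_control_def norm_sq_basis_sum sq_sum_in_cell w_def sum_distrib_right
    by (rule sum.swap)
  have "control_energy T (slope_control n a h m c) \<le>
    (\<integral>\<^sup>+s. (\<Sum>k<m. ennreal (w k) * indicator {a + real k * h..<a + real (Suc k) * h} s) \<partial>lborel)"
    unfolding control_energy_def
  proof (rule nn_integral_mono)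
    fix s
    have "in_cell k ((s - a) / h) = indicator {a + real k * h..<a + real (Suc k) * h} s" for k
      using assms by (auto simp: in_cell_def indicator_def floor_eq_iff field_simps)
    then have "ennreal ((norm (slope_control n a h m c s))\<^sup>2)
      = (\<Sum>k<m. ennreal (w k) * indicator {a + real k * h..<a + real (Suc k) * h} s)"
      unfolding nn using w
      by (subst sum_ennreal[symmetric]) (simp_all add: ennreal_mult ennreal_indicator)
    then show "ennreal ((norm (slope_control n a h m c s))\<^sup>2) * indicator {0..T} s
      \<le> (\<Sum>k<m. ennreal (w k) * indicator {a + real k * h..<a + real (Suc k) * h} s)"
      by (auto simp: indicator_def)
  qed
  also have "\<dots> = (\<Sum>k<m. ennreal (w k) * ennreal h)"
    using assms by (subst nn_integral_sum) (auto simp: nn_integral_cmult algebra_simps intro!: sum.cong)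
  also have "\<dots> = ennreal (\<Sum>k<m. w k * h)"
    using assms w by (subst sum_ennreal[symmetric]) (auto simp: ennreal_mult)
  also have "(\<Sum>k<m. w k * h) = (\<Sum>k<m. \<Sum>i=1..n. (c i k)\<^sup>2 / h)"
    using assms unfolding w_def sum_distrib_right
    by (intro sum.cong refl) (simp add: power2_eq_square)
  also have "\<dots> = (\<Sum>i=1..n. \<Sum>k<m. (c i k)\<^sup>2 / h)" by (rule sum.swap)
  finally show ?thesis .
qed

text \<open>The convolution identities for \<open>z\<close> and for the broken line are added
  coordinatewise; the terms carrying \<open>eigval i\<close> times the broken line cancel and leave
  its slope, which is the control.\<close>

lemma solves_imp_mild_control_solution:
  assumes Qh: "\<And>i u. i \<in> {1..n} \<Longrightarrow> inner (Qh u) (ebasis i) = \<sigma> i * inner u (ebasis i)"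
    and z: "solves F n (\<lambda>i s. \<sigma> i * broken_line a h m (c i) s) t z"
    and a: "a \<ge> 0" and h: "h > 0"
  shows "mild_control_solution Qh F n t 0 (slope_control n a h m c) z"
  unfolding mild_control_solution_def
proof (intro conjI ballI)
  show "z \<in> paths n t" using z by (auto simp: solves_def paths_def)
  fix s assume s: "s \<in> {0..t}"
  let ?\<psi> = "slope_control n a h m c"
  let ?g = "\<lambda>i r. inner (F (z r)) (ebasis i) + \<sigma> i * (\<Sum>k<m. c i k * in_cell k ((r - a) / h) / h)"
  have integrand: "S_n n (s - r) (P_n n (F (z r)) + P_n n (Qh (?\<psi> r)))
      = (\<Sum>i=1..n. (exp (- eigval i * (s - r)) * ?g i r) *\<^sub>R ebasis i)" for r
  proof (subst S_n_H_n)
    show "P_n n (F (z r)) + P_n n (Qh (?\<psi> r)) \<in> H_n n"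
      by (intro subspace_add subspace_H_n P_n_in_H_n)
    show "(\<Sum>i = 1..n. (exp (- eigval i * (s - r)) * inner (P_n n (F (z r)) + P_n n (Qh (?\<psi> r))) (ebasis i)) *\<^sub>R ebasis i)
      = (\<Sum>i=1..n. (exp (- eigval i * (s - r)) * ?g i r) *\<^sub>R ebasis i)"
      by (intro sum.cong refl) (simp add: inner_add_left inner_P_n Qh slope_control_def inner_basis_sum)
  qed
  have "((\<lambda>r. \<Sum>i=1..n. (exp (- eigval i * (s - r)) * ?g i r) *\<^sub>R ebasis i) has_integral
      (\<Sum>i=1..n. inner (z s) (ebasis i) *\<^sub>R ebasis i)) {0..s}"
  proof (intro has_integral_sum has_integral_scaleR_left)
    fix i assume i: "i \<in> {1..n}"
    have 1: "((\<lambda>r. exp (- eigval i * (s - r)) * (inner (F (z r)) (ebasis i) - eigval i * (\<sigma> i * broken_line a h m (c i) r)))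
       has_integral (inner (z s) (ebasis i) - \<sigma> i * broken_line a h m (c i) s)) {0..s}"
      using z i s by (auto simp: solves_def)
    have 2: "((\<lambda>r. \<sigma> i * (exp (- eigval i * (s - r)) * ((\<Sum>k<m. c i k * in_cell k ((r - a) / h) / h) + eigval i * broken_line a h m (c i) r)))
      has_integral (\<sigma> i * broken_line a h m (c i) s)) {0..s}"
      by (intro has_integral_mult_right broken_line_convolution a h) (use s in auto)
    have "(\<lambda>r. exp (- eigval i * (s - r)) * (inner (F (z r)) (ebasis i) - eigval i * (\<sigma> i * broken_line a h m (c i) r))
       + \<sigma> i * (exp (- eigval i * (s - r)) * ((\<Sum>k<m. c i k * in_cell k ((r - a) / h) / h) + eigval i * broken_line a h m (c i) r)))
       = (\<lambda>r. exp (- eigval i * (s - r)) * ?g i r)"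
      by (intro ext) (simp only: algebra_simps)
    with has_integral_add[OF 1 2]
    show "((\<lambda>r. exp (- eigval i * (s - r)) * ?g i r) has_integral inner (z s) (ebasis i)) {0..s}"
      by simp
  qed simp
  moreover have "(\<Sum>i=1..n. inner (z s) (ebasis i) *\<^sub>R ebasis i) = z s"
    by (rule H_n_expand[symmetric]) (use z s in \<open>auto simp: solves_def\<close>)
  moreover have "S_n n s 0 = 0"
    using S_n_H_n[OF subspace_0[OF subspace_H_n], of n s] by simp
  ultimately show "((\<lambda>r. S_n n (s - r) (P_n n (F (z r)) + P_n n (Qh (?\<psi> r)))) has_integral
      (z s - S_n n s 0)) {0..s}"
    unfolding integrand by (simp only: diff_zero)
qed

text \<open>The quasi-potential is an infimum over all horizons, so \<open>t\<close> may be
  arbitrarily large without affecting the bound; only the increments inside the control window are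
  paid for. The factor 2 is the one half in the action.\<close>

lemma slope_control_level_set:
  assumes Qh: "\<And>i u. i \<in> {1..n} \<Longrightarrow> inner (Qh u) (ebasis i) = \<sigma> i * inner u (ebasis i)"
    and z: "solves F n (\<lambda>i s. \<sigma> i * broken_line a h m (c i) s) t z"
    and a: "a \<ge> 0" and h: "h > 0" and t: "t > 0"
    and e: "(\<Sum>i=1..n. \<Sum>k<m. (c i k)\<^sup>2 / h) \<le> 2 * \<alpha>"
  shows "z t \<in> level_set Qh F n \<alpha>"
proof -
  let ?\<psi> = "slope_control n a h m c"
  have zp: "z \<in> paths n t" using z by (auto simp: solves_def paths_def)
  have z0: "z 0 = 0"
  proof (rule H_n_eqI[where n=n])
    show "z 0 \<in> H_n n" using zp t by (auto simp: paths_def)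
    fix i assume i: "i \<in> {1..n}"
    show "inner (z 0) (ebasis i) = inner 0 (ebasis i)"
      using solves_initial[OF z _ i] t broken_line_0[OF a h] by simp
  qed (rule subspace_0[OF subspace_H_n])
  have ce: "control_energy t ?\<psi> \<le> ennreal (2 * \<alpha>)"
    using control_energy_slope_control[OF h] ennreal_leI[OF e] by (rule order_trans)
  have "?\<psi> \<in> {\<psi>\<in>controls n t. mild_control_solution Qh F n t 0 \<psi> z}"
    using solves_imp_mild_control_solution[OF Qh z a h] slope_control_measurable
      le_less_trans[OF ce] by (auto simp: controls_def)
  then have "action Qh F n t 0 z \<le> control_energy t ?\<psi> / 2"
    unfolding action_def by (intro divide_right_mono_ennreal INF_lower)
  also have "\<dots> \<le> ennreal (2 * \<alpha>) / 2" by (intro divide_right_mono_ennreal ce)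
  also have "\<dots> = ennreal \<alpha>"
  proof -
    \<comment> \<open>Nonnegative energy yields \<open>\<alpha> \<ge> 0\<close>, as
      \<open>ennreal\<close> represents only nonnegative reals faithfully.\<close>
    have "0 \<le> (\<Sum>i=1..n. \<Sum>k<m. (c i k)\<^sup>2 / h)"
      using h by (intro sum_nonneg) auto
    then have "0 \<le> 2 * \<alpha>" using e by linarith
    then show ?thesis using divide_ennreal[of "2 * \<alpha>" 2] by simp
  qed
  finally have ac: "action Qh F n t 0 z \<le> ennreal \<alpha>" .
  have "quasi_potential Qh F n (z t) \<le> (\<lambda>(T, z). action Qh F n T 0 z) (t, z)"
    unfolding quasi_potential_def by (rule INF_lower) (use zp z0 t in auto)
  then have "quasi_potential Qh F n (z t) \<le> ennreal \<alpha>" using ac by simp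
  moreover have "z t \<in> H_n n" using zp t by (auto simp: paths_def)
  ultimately show ?thesis by (simp add: level_set_def)
qed

subsection \<open>Stieltjes sums\<close>

text \<open>On each cell \<open>g\<close> is frozen at the right end point with error at most
  \<open>\<eta>\<close>; integrated against the nonnegative \<open>\<phi>'\<close> this costs
  \<open>\<eta>\<close> times the increment of \<open>\<phi>\<close>, and the increments telescope.
  The separate index \<open>j\<close> lets the induction proceed while the mesh \<open>t / m\<close>
  stays fixed.\<close>

lemma Stieltjes_sum_error:
  fixes g \<phi> \<phi>' :: "real \<Rightarrow> real"
  assumes t: "t \<ge> 0" and m: "m > 0" and j: "j \<le> m" and g: "continuous_on {0..t} g"
    and \<phi>: "\<And>s. s \<in> {0..t} \<Longrightarrow> (\<phi> has_real_derivative \<phi>' s) (at s within {0..t})"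
    and \<phi>': "continuous_on {0..t} \<phi>'" "\<And>s. s \<in> {0..t} \<Longrightarrow> \<phi>' s \<ge> 0"
    and \<eta>: "\<And>x y. x \<in> {0..t} \<Longrightarrow> y \<in> {0..t} \<Longrightarrow> \<bar>x - y\<bar> \<le> t / real m \<Longrightarrow> \<bar>g x - g y\<bar> \<le> \<eta>"
  defines "s \<equiv> \<lambda>k. t * real k / real m"
  shows "\<bar>(\<Sum>k<j. g (s (Suc k)) * (\<phi> (s (Suc k)) - \<phi> (s k))) - integral {0..s j} (\<lambda>r. g r * \<phi>' r)\<bar>
     \<le> \<eta> * (\<phi> (s j) - \<phi> (s 0))"
  using j
proof (induction j)
  case 0
  then show ?case by (simp add: s_def)
next
  case (Suc j)
  have sj: "0 \<le> s j" "s j \<le> s (Suc j)" "s (Suc j) \<le> t" "s (Suc j) - s j = t / real m"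
    using t m mult_left_mono[of "real (Suc j)" "real m" t] Suc.prems
    by (auto simp: s_def field_simps)
  have sub: "{s j..s (Suc j)} \<subseteq> {0..t}" using sj by auto
  let ?I = "\<lambda>A. integral A (\<lambda>r. g r * \<phi>' r)"
  have int: "(\<lambda>r. g r * \<phi>' r) integrable_on {0..s (Suc j)}"
    using sj by (intro integrable_continuous_interval continuous_intros continuous_on_subset[OF g]
        continuous_on_subset[OF \<phi>'(1)]) auto
  have split: "?I {0..s (Suc j)} = ?I {0..s j} + ?I {s j..s (Suc j)}"
    using Henstock_Kurzweil_Integration.integral_combine[OF sj(1,2) int] by simp
  have ftc: "(\<phi>' has_integral (\<phi> (s (Suc j)) - \<phi> (s j))) {s j..s (Suc j)}"
    using sj sub \<phi>
    by (intro fundamental_theorem_of_calculus)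
      (auto simp: has_real_derivative_iff_has_vector_derivative[symmetric] intro!: DERIV_subset[OF _ sub])
  have 1: "((\<lambda>r. g (s (Suc j)) * \<phi>' r) has_integral (g (s (Suc j)) * (\<phi> (s (Suc j)) - \<phi> (s j)))) {s j..s (Suc j)}"
    by (intro has_integral_mult_right ftc)
  have 2: "((\<lambda>r. g r * \<phi>' r) has_integral ?I {s j..s (Suc j)}) {s j..s (Suc j)}"
    by (intro integrable_integral integrable_subinterval_real[OF int]) (use sj in auto)
  have "norm (integral {s j..s (Suc j)} (\<lambda>r. g (s (Suc j)) * \<phi>' r - g r * \<phi>' r))
      \<le> integral {s j..s (Suc j)} (\<lambda>r. \<eta> * \<phi>' r)"
  proof (rule integral_norm_bound_integral)
    fix r assume r: "r \<in> {s j..s (Suc j)}"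
    have "\<bar>g (s (Suc j)) - g r\<bar> \<le> \<eta>"
      using r sj by (intro \<eta>) auto
    then have "\<bar>g (s (Suc j)) - g r\<bar> * \<phi>' r \<le> \<eta> * \<phi>' r"
      using \<phi>'(2) sub r by (intro mult_right_mono) auto
    moreover have "norm (g (s (Suc j)) * \<phi>' r - g r * \<phi>' r) = \<bar>g (s (Suc j)) - g r\<bar> * \<phi>' r"
      using \<phi>'(2)[of r] sub r by (auto simp: left_diff_distrib[symmetric] abs_mult)
    ultimately show "norm (g (s (Suc j)) * \<phi>' r - g r * \<phi>' r) \<le> \<eta> * \<phi>' r" by simp
  qed (use has_integral_diff[OF 1 2] has_integral_mult_right[OF ftc] in blast)+
  then have "\<bar>g (s (Suc j)) * (\<phi> (s (Suc j)) - \<phi> (s j)) - ?I {s j..s (Suc j)}\<bar> \<le> \<eta> * (\<phi> (s (Suc j)) - \<phi> (s j))"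
    using integral_unique[OF has_integral_diff[OF 1 2]] integral_unique[OF ftc]
    by simp
  moreover have "\<bar>(\<Sum>k<j. g (s (Suc k)) * (\<phi> (s (Suc k)) - \<phi> (s k))) - ?I {0..s j}\<bar> \<le> \<eta> * (\<phi> (s j) - \<phi> (s 0))"
    using Suc by simp
  ultimately show ?case
    unfolding split sum.lessThan_Suc by (simp add: algebra_simps)
qed

lemma Stieltjes_sum_tendsto:
  fixes g \<phi> \<phi>' :: "real \<Rightarrow> real"
  assumes t: "t \<ge> 0" and g: "continuous_on {0..t} g"
    and \<phi>: "\<And>s. s \<in> {0..t} \<Longrightarrow> (\<phi> has_real_derivative \<phi>' s) (at s within {0..t})"
    and \<phi>': "continuous_on {0..t} \<phi>'" "\<And>s. s \<in> {0..t} \<Longrightarrow> \<phi>' s \<ge> 0"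
  shows "(\<lambda>m. \<Sum>k<m. g (t * real (Suc k) / real m) * (\<phi> (t * real (Suc k) / real m) - \<phi> (t * real k / real m)))
     \<longlonglongrightarrow> integral {0..t} (\<lambda>r. g r * \<phi>' r)"
proof (rule LIMSEQ_I)
  fix e :: real assume e: "e > 0"
  have inc: "\<phi> 0 \<le> \<phi> t"
  proof -
    have "(\<phi>' has_integral (\<phi> t - \<phi> 0)) {0..t}"
      using t \<phi> by (intro fundamental_theorem_of_calculus)
        (auto simp: has_real_derivative_iff_has_vector_derivative[symmetric])
    from has_integral_nonneg[OF this \<phi>'(2)] show ?thesis by simp
  qed
  \<comment> \<open>The summand 1 keeps the denominator positive when \<open>\<phi>\<close> is
    constant.\<close>
  define \<eta> where "\<eta> = e / (2 * (\<phi> t - \<phi> 0 + 1))"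
  have \<eta>: "\<eta> > 0" using e inc by (simp add: \<eta>_def)
  have lt: "\<eta> * (\<phi> t - \<phi> 0) < e"
  proof -
    have "\<eta> * (\<phi> t - \<phi> 0) \<le> \<eta> * (\<phi> t - \<phi> 0 + 1)" using \<eta> by (intro mult_left_mono) auto
    also have "\<dots> = e / 2" using inc by (simp add: \<eta>_def field_simps)
    finally show ?thesis using e by simp
  qed
  have "uniformly_continuous_on {0..t} g"
    using compact_uniformly_continuous[OF g] by simp
  then obtain d where d: "d > 0" "\<And>x y. x \<in> {0..t} \<Longrightarrow> y \<in> {0..t} \<Longrightarrow> dist y x < d \<Longrightarrow> dist (g y) (g x) < \<eta>"
    using \<eta> unfolding uniformly_continuous_on_def by metis
  obtain m0 :: nat where m0: "t / d < real m0" using reals_Archimedean2 by blast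
  show "\<exists>no. \<forall>m\<ge>no. norm ((\<Sum>k<m. g (t * real (Suc k) / real m) * (\<phi> (t * real (Suc k) / real m) - \<phi> (t * real k / real m)))
     - integral {0..t} (\<lambda>r. g r * \<phi>' r)) < e"
  proof (intro exI[of _ "Suc m0"] allI impI)
    fix m assume "Suc m0 \<le> m"
    then have m: "m > 0" "t / d < real m" using m0 by linarith+
    then have td: "t / real m < d" using d(1) by (simp add: field_simps)
    have "\<bar>(\<Sum>k<m. g (t * real (Suc k) / real m) * (\<phi> (t * real (Suc k) / real m) - \<phi> (t * real k / real m)))
       - integral {0..t * real m / real m} (\<lambda>r. g r * \<phi>' r)\<bar> \<le> \<eta> * (\<phi> (t * real m / real m) - \<phi> (t * real 0 / real m))"
    proof (rule Stieltjes_sum_error[OF t m(1) order_refl g \<phi> \<phi>'])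
      fix x y assume "x \<in> {0..t}" "y \<in> {0..t}" "\<bar>x - y\<bar> \<le> t / real m"
      then show "\<bar>g x - g y\<bar> \<le> \<eta>"
        using d(2)[of y x] td by (auto simp: dist_real_def)
    qed auto
    then show "norm ((\<Sum>k<m. g (t * real (Suc k) / real m) * (\<phi> (t * real (Suc k) / real m) - \<phi> (t * real k / real m)))
     - integral {0..t} (\<lambda>r. g r * \<phi>' r)) < e"
      using m(1) lt by simp
  qed
qed

lemma sum_by_parts:
  fixes \<phi> b :: "nat \<Rightarrow> real"
  shows "(\<Sum>k<m. \<phi> k * (b (Suc k) - b k)) = \<phi> m * b m - \<phi> 0 * b 0 - (\<Sum>k<m. b (Suc k) * (\<phi> (Suc k) - \<phi> k))"
  by (induction m) (simp_all add: algebra_simps)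

text \<open>A continuous path need not have bounded variation, so the differences are moved onto the
  exponential by summation by parts. The left-point sums of the Wiener integral thereby become
  right-point Stieltjes sums against a smooth monotone function.\<close>

lemma exp_Wiener_sum_tendsto:
  fixes b :: "real \<Rightarrow> real"
  assumes t: "t \<ge> 0" and l: "l \<ge> 0" and b: "continuous_on {0..t} b" "b 0 = 0"
  shows "(\<lambda>m. \<Sum>k<m. exp (- l * (t - t * real k / real m)) * (b (t * real (Suc k) / real m) - b (t * real k / real m)))
     \<longlonglongrightarrow> b t - integral {0..t} (\<lambda>r. b r * (l * exp (- l * (t - r))))"
proof -
  let ?\<phi> = "\<lambda>s. exp (- l * (t - s))"
  have "(\<lambda>m. \<Sum>k<m. b (t * real (Suc k) / real m) * (?\<phi> (t * real (Suc k) / real m) - ?\<phi> (t * real k / real m)))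
     \<longlonglongrightarrow> integral {0..t} (\<lambda>r. b r * (l * ?\<phi> r))"
    using l by (intro Stieltjes_sum_tendsto[OF t b(1)]) (auto intro!: derivative_eq_intros continuous_intros)
  then have "(\<lambda>m. b t - (\<Sum>k<m. b (t * real (Suc k) / real m) * (?\<phi> (t * real (Suc k) / real m) - ?\<phi> (t * real k / real m))))
     \<longlonglongrightarrow> b t - integral {0..t} (\<lambda>r. b r * (l * ?\<phi> r))"
    by (intro tendsto_diff tendsto_const)
  moreover have "\<forall>\<^sub>F m in sequentially.
      b t - (\<Sum>k<m. b (t * real (Suc k) / real m) * (?\<phi> (t * real (Suc k) / real m) - ?\<phi> (t * real k / real m)))
    = (\<Sum>k<m. ?\<phi> (t * real k / real m) * (b (t * real (Suc k) / real m) - b (t * real k / real m)))"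
    using eventually_gt_at_top[of 0]
  proof eventually_elim
    case (elim m)
    have "t * real m / real m = t" using elim by simp
    then show ?case
      using sum_by_parts[of "\<lambda>k. ?\<phi> (t * real k / real m)" "\<lambda>k. b (t * real k / real m)" m] b(2) by simp
  qed
  ultimately show ?thesis by (rule Lim_transform_eventually)
qed

subsection \<open>Pathwise form of the stochastic equation\<close>

text \<open>By Fatou the pointwise limit of the squared differences has integral at most the limit
  0, so no almost surely convergent subsequence has to be extracted.\<close>

lemma AE_eq_if_mean_square_limit:
  fixes R :: "nat \<Rightarrow> 'w \<Rightarrow> real"
  assumes R [measurable]: "\<And>m. R m \<in> borel_measurable M" and Z [measurable]: "Z \<in> borel_measurable M"
    and lim: "AE \<omega> in M. (\<lambda>m. R m \<omega>) \<longlonglongrightarrow> l \<omega>"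
    and ms: "(\<lambda>m. \<integral>\<^sup>+\<omega>. ennreal ((R m \<omega> - Z \<omega>)\<^sup>2) \<partial>M) \<longlonglongrightarrow> 0"
  shows "AE \<omega> in M. Z \<omega> = l \<omega>"
proof -
  let ?h = "\<lambda>\<omega>. liminf (\<lambda>m. ennreal ((R m \<omega> - Z \<omega>)\<^sup>2))"
  have "(\<integral>\<^sup>+\<omega>. ?h \<omega> \<partial>M) \<le> liminf (\<lambda>m. \<integral>\<^sup>+\<omega>. ennreal ((R m \<omega> - Z \<omega>)\<^sup>2) \<partial>M)"
    by (rule nn_integral_liminf) measurable
  also have "\<dots> = 0" using lim_imp_Liminf[OF sequentially_bot ms] .
  finally have "(\<integral>\<^sup>+\<omega>. ?h \<omega> \<partial>M) = 0" by simp
  then have "AE \<omega> in M. ?h \<omega> = 0" by (subst (asm) nn_integral_0_iff_AE) measurable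
  with lim show ?thesis
  proof eventually_elim
    case (elim \<omega>)
    have "(\<lambda>m. ennreal ((R m \<omega> - Z \<omega>)\<^sup>2)) \<longlonglongrightarrow> ennreal ((l \<omega> - Z \<omega>)\<^sup>2)"
      by (intro tendsto_intros elim(1))
    from lim_imp_Liminf[OF sequentially_bot this] elim(2) have "ennreal ((l \<omega> - Z \<omega>)\<^sup>2) = 0" by simp
    then show ?case by simp
  qed
qed

lemma inner_W_n: "i \<in> {1..n} \<Longrightarrow> inner (W_n n \<beta> t \<omega>) (ebasis i) = \<beta> i t \<omega>"
  unfolding W_n_def by (rule inner_basis_sum)

text \<open>The same Riemann sums converge in mean square to the Wiener integral, by its definition,
  and pathwise to the expression obtained by parts. The coordinate error is dominated by the norm
  error because basis vectors have norm 1.\<close>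

lemma wiener_integral_coord:
  assumes bm: "indep_brownian_motions M \<beta>" and t: "t \<ge> 0" and i: "i \<in> {1..n}"
    and Qh: "\<And>i u. i \<in> {1..n} \<Longrightarrow> inner (Qh u) (ebasis i) = \<sigma> i * inner u (ebasis i)"
    and Z: "has_wiener_integral M (W_n n \<beta>) (\<lambda>s h. S_n n (t - s) (P_n n (Qh h))) t Z"
  shows "AE \<omega> in M. inner (Z \<omega>) (ebasis i) =
     \<sigma> i * (\<beta> i t \<omega> - integral {0..t} (\<lambda>r. \<beta> i r \<omega> * (eigval i * exp (- eigval i * (t - r)))))"
proof (rule AE_eq_if_mean_square_limit)
  let ?s = "\<lambda>m k. t * real k / real m"
  define R where "R m \<omega> = \<sigma> i * (\<Sum>k<m. exp (- eigval i * (t - ?s m k)) * (\<beta> i (?s m (Suc k)) \<omega> - \<beta> i (?s m k) \<omega>))"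
    for m \<omega>
  have B: "std_brownian_motion M (\<beta> i)" using bm i by (auto simp: indep_brownian_motions_def)
  have "\<beta> i (?s m k) \<in> borel_measurable M" for m k
    using B t by (simp add: std_brownian_motion_def)
  then show "R m \<in> borel_measurable M" for m unfolding R_def by measurable
  have Zm: "Z \<in> borel_measurable M" using Z by (simp add: has_wiener_integral_def)
  show "(\<lambda>\<omega>. inner (Z \<omega>) (ebasis i)) \<in> borel_measurable M"
    by (rule measurable_compose[OF Zm]) (intro borel_measurable_continuous_onI continuous_intros)
  have "AE \<omega> in M. \<beta> i 0 \<omega> = 0" "AE \<omega> in M. continuous_on {0..} (\<lambda>t. \<beta> i t \<omega>)"
    using B by (auto simp: std_brownian_motion_def)
  then show "AE \<omega> in M. (\<lambda>m. R m \<omega>) \<longlonglongrightarrow>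
      \<sigma> i * (\<beta> i t \<omega> - integral {0..t} (\<lambda>r. \<beta> i r \<omega> * (eigval i * exp (- eigval i * (t - r)))))"
  proof eventually_elim
    case (elim \<omega>)
    have "continuous_on {0..t} (\<lambda>t. \<beta> i t \<omega>)"
      using elim(2) by (rule continuous_on_subset) auto
    then show ?case
      unfolding R_def
      by (intro tendsto_mult tendsto_const exp_Wiener_sum_tendsto t eigval_nonneg elim(1))
  qed
  let ?D = "\<lambda>m \<omega>. (\<Sum>k<m. S_n n (t - ?s m k) (P_n n (Qh (W_n n \<beta> (?s m (Suc k)) \<omega> - W_n n \<beta> (?s m k) \<omega>))))
     - Z \<omega>"
  have D: "(\<lambda>m. \<integral>\<^sup>+\<omega>. ennreal ((norm (?D m \<omega>))\<^sup>2) \<partial>M) \<longlonglongrightarrow> 0"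
    using Z by (simp add: has_wiener_integral_def)
  have c: "(R m \<omega> - inner (Z \<omega>) (ebasis i))\<^sup>2 \<le> (norm (?D m \<omega>))\<^sup>2" for m \<omega>
  proof -
    have "inner (?D m \<omega>) (ebasis i) = R m \<omega> - inner (Z \<omega>) (ebasis i)"
      unfolding R_def inner_diff_left inner_sum_left sum_distrib_left
      by (simp add: inner_S_n[OF P_n_in_H_n i] inner_P_n[OF i] Qh[OF i] inner_diff_left inner_W_n[OF i] algebra_simps)
    moreover have "\<bar>inner (?D m \<omega>) (ebasis i)\<bar> \<le> norm (?D m \<omega>) * norm (ebasis i)"
      by (rule Cauchy_Schwarz_ineq2)
    moreover have "norm (ebasis i) = 1" using i by (simp add: norm_ebasis)
    ultimately have "\<bar>R m \<omega> - inner (Z \<omega>) (ebasis i)\<bar> \<le> norm (?D m \<omega>)" by simp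
    then show ?thesis by (subst abs_le_square_iff[symmetric]) simp
  qed
  show "(\<lambda>m. \<integral>\<^sup>+\<omega>. ennreal ((R m \<omega> - inner (Z \<omega>) (ebasis i))\<^sup>2) \<partial>M) \<longlonglongrightarrow> 0"
  proof (rule tendsto_sandwich[OF _ _ tendsto_const D])
    show "\<forall>\<^sub>F m in sequentially. (\<integral>\<^sup>+\<omega>. ennreal ((R m \<omega> - inner (Z \<omega>) (ebasis i))\<^sup>2) \<partial>M)
        \<le> (\<integral>\<^sup>+\<omega>. ennreal ((norm (?D m \<omega>))\<^sup>2) \<partial>M)"
      by (rule always_eventually, rule allI, rule nn_integral_mono, rule ennreal_leI, rule c)
  qed simp
qed

text \<open>The stochastic equation holds at each time outside a null set that depends on the time.
  Rational times share one null set, and both sides are continuous in \<open>s\<close>, so the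
  identity extends to the closed interval by density.\<close>

lemma solves_if_rationals:
  assumes t: "t > 0" and cx: "continuous_on {0..t} x" and xH: "x ` {0..t} \<subseteq> H_n n"
    and cF: "continuous_on UNIV F" and N: "\<And>i. i \<in> {1..n} \<Longrightarrow> continuous_on {0..t} (N i)"
    and rat: "\<And>i s. i \<in> {1..n} \<Longrightarrow> s \<in> \<rat> \<Longrightarrow> s \<in> {0..t} \<Longrightarrow>
      ((\<lambda>r. exp (- eigval i * (s - r)) * (inner (F (x r)) (ebasis i) - eigval i * N i r))
           has_integral (inner (x s) (ebasis i) - N i s)) {0..s}"
  shows "solves F n N t x"
  unfolding solves_def
proof (intro conjI ballI cx xH)
  fix s i assume s: "s \<in> {0..t}" and i: "i \<in> {1..n}"
  let ?g = "\<lambda>r. inner (F (x r)) (ebasis i) - eigval i * N i r"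
  define y where "y s = integral {0..s} (\<lambda>r. exp (- eigval i * (s - r)) * ?g r)" for s
  have g: "continuous_on {0..t} ?g"
    by (intro continuous_intros N i continuous_on_compose2[OF cF cx]) auto
  have y: "((\<lambda>r. exp (- eigval i * (s - r)) * ?g r) has_integral y s) {0..s}" if "s \<in> {0..t}" for s
    unfolding y_def using that
    by (intro integrable_integral integrable_continuous_interval continuous_intros continuous_on_subset[OF g]) auto
  have cl: "closure ({0<..<t} \<inter> \<rat>) = {0..t}"
    using closure_open_Int_superset[of "{0<..<t}" \<rat>] t Rats_closure_real by simp
  have "y s - (inner (x s) (ebasis i) - N i s) = 0"
  proof (rule continuous_constant_on_closure[where S="{0<..<t} \<inter> \<rat>"
        and f="\<lambda>s. y s - (inner (x s) (ebasis i) - N i s)"])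
    show "continuous_on (closure ({0<..<t} \<inter> \<rat>)) (\<lambda>s. y s - (inner (x s) (ebasis i) - N i s))"
      unfolding cl by (intro continuous_intros cx N i DERIV_continuous_on[OF exp_convolution_derivative[OF y g]])
    show "s \<in> closure ({0<..<t} \<inter> \<rat>)" unfolding cl by (rule s)
    fix u assume "u \<in> {0<..<t} \<inter> \<rat>"
    then show "y u - (inner (x u) (ebasis i) - N i u) = 0"
      using has_integral_unique[OF y rat[OF i]] by simp
  qed
  then have eq: "inner (x s) (ebasis i) - N i s = y s" by simp
  show "((\<lambda>r. exp (- eigval i * (s - r)) * ?g r) has_integral (inner (x s) (ebasis i) - N i s)) {0..s}"
    unfolding eq by (rule y[OF s])
qed

text \<open>Inserting the pathwise formula for the Wiener integral into the mild equation gives the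
  same integrated equation that controlled paths satisfy, so the two can be compared one path at a
  time.\<close>

lemma sde_solves:
  assumes bm: "indep_brownian_motions M \<beta>" and t: "t > 0"
    and Qh: "\<And>i u. i \<in> {1..n} \<Longrightarrow> inner (Qh u) (ebasis i) = \<sigma> i * inner u (ebasis i)"
    and cF: "continuous_on UNIV F"
    and X: "mild_sde_solution M \<beta> Qh F n \<epsilon> 0 X"
  shows "AE \<omega> in M. solves F n (\<lambda>i s. \<epsilon> * \<sigma> i * \<beta> i s \<omega>) t (\<lambda>s. X s \<omega>)"
proof -
  have B: "std_brownian_motion M (\<beta> i)" if "i \<in> {1..n}" for i
    using bm that by (auto simp: indep_brownian_motions_def)
  have "AE \<omega> in M. \<forall>i\<in>{1..n}. ((\<lambda>r. exp (- eigval i * (s - r)) * inner (F (X r \<omega>)) (ebasis i)) has_integral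
     (inner (X s \<omega>) (ebasis i) -
       \<epsilon> * (\<sigma> i * (\<beta> i s \<omega> - integral {0..s} (\<lambda>r. \<beta> i r \<omega> * (eigval i * exp (- eigval i * (s - r)))))))) {0..s}"
    if s: "s \<ge> 0" for s
  proof -
    obtain Z where Z: "has_wiener_integral M (W_n n \<beta>) (\<lambda>u h. S_n n (s - u) (P_n n (Qh h))) s Z"
      and hi: "AE \<omega> in M. ((\<lambda>u. S_n n (s - u) (P_n n (F (X u \<omega>))))
           has_integral (X s \<omega> - S_n n s 0 - \<epsilon> *\<^sub>R Z \<omega>)) {0..s}"
      using X s unfolding mild_sde_solution_def by blast
    have "AE \<omega> in M. \<forall>i\<in>{1..n}. inner (Z \<omega>) (ebasis i) =
     \<sigma> i * (\<beta> i s \<omega> - integral {0..s} (\<lambda>r. \<beta> i r \<omega> * (eigval i * exp (- eigval i * (s - r)))))"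
      by (rule AE_finite_allI) (use wiener_integral_coord[OF bm s _ Qh Z] in auto)
    with hi show ?thesis
    proof eventually_elim
      case (elim \<omega>)
      show ?case
      proof
        fix i assume i: "i \<in> {1..n}"
        have "S_n n s 0 = 0"
          using S_n_H_n[OF subspace_0[OF subspace_H_n], of n s] by simp
        moreover have "((\<lambda>u. inner (S_n n (s - u) (P_n n (F (X u \<omega>)))) (ebasis i))
            has_integral (inner (X s \<omega> - S_n n s 0 - \<epsilon> *\<^sub>R Z \<omega>) (ebasis i))) {0..s}"
          using has_integral_linear[OF elim(1) bounded_linear_inner_left[of "ebasis i"]] by (simp add: o_def)
        ultimately show "((\<lambda>r. exp (- eigval i * (s - r)) * inner (F (X r \<omega>)) (ebasis i)) has_integral
         (inner (X s \<omega>) (ebasis i) -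
         \<epsilon> * (\<sigma> i * (\<beta> i s \<omega> - integral {0..s} (\<lambda>r. \<beta> i r \<omega> * (eigval i * exp (- eigval i * (s - r)))))))) {0..s}"
          using elim(2) i
          by (simp add: inner_S_n[OF P_n_in_H_n i] inner_P_n[OF i] inner_diff_left)
      qed
    qed
  qed
  then have "AE \<omega> in M. \<forall>s\<in>\<rat> \<inter> {0..}. \<forall>i\<in>{1..n}. ((\<lambda>r. exp (- eigval i * (s - r)) * inner (F (X r \<omega>)) (ebasis i)) has_integral
     (inner (X s \<omega>) (ebasis i) -
       \<epsilon> * (\<sigma> i * (\<beta> i s \<omega> - integral {0..s} (\<lambda>r. \<beta> i r \<omega> * (eigval i * exp (- eigval i * (s - r)))))))) {0..s}"
    by (rule AE_ball_countable') (simp, intro countable_Int1 countable_rat)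
  moreover have "AE \<omega> in M. \<forall>i\<in>{1..n}. continuous_on {0..} (\<lambda>t. \<beta> i t \<omega>)"
    by (rule AE_finite_allI) (use B in \<open>auto simp: std_brownian_motion_def\<close>)
  moreover have "AE \<omega> in M. continuous_on {0..} (\<lambda>t. X t \<omega>)"
    using X by (simp add: mild_sde_solution_def)
  moreover have "AE \<omega> in M. \<omega> \<in> space M" by simp
  ultimately show ?thesis
  proof eventually_elim
    case (elim \<omega>)
    have cb: "continuous_on {0..s} (\<lambda>t. \<beta> i t \<omega>)" if "i \<in> {1..n}" for i s
      by (rule continuous_on_subset[OF elim(2)[rule_format, OF that]]) auto
    show ?case
    proof (rule solves_if_rationals[OF t _ _ cF])
      show "continuous_on {0..t} (\<lambda>s. X s \<omega>)"
        using elim(3) by (rule continuous_on_subset) auto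
      have "X s \<omega> \<in> H_n n" if "s \<ge> 0" for s
        using X that measurable_space[OF _ elim(4), of "X s" "borel_n n"]
        by (auto simp: mild_sde_solution_def space_restrict_space)
      then show "(\<lambda>s. X s \<omega>) ` {0..t} \<subseteq> H_n n" by auto
      fix i assume i: "i \<in> {1..n}"
      show "continuous_on {0..t} (\<lambda>s. \<epsilon> * \<sigma> i * \<beta> i s \<omega>)"
        by (intro continuous_intros cb i)
      fix s :: real assume s: "s \<in> \<rat>" "s \<in> {0..t}"
      let ?I = "integral {0..s} (\<lambda>r. \<beta> i r \<omega> * (eigval i * exp (- eigval i * (s - r))))"
      have 1: "((\<lambda>r. exp (- eigval i * (s - r)) * inner (F (X r \<omega>)) (ebasis i)) has_integral
         (inner (X s \<omega>) (ebasis i) - \<epsilon> * (\<sigma> i * (\<beta> i s \<omega> - ?I)))) {0..s}"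
        using elim(1) s i by auto
      have 2: "((\<lambda>r. \<epsilon> * \<sigma> i * (\<beta> i r \<omega> * (eigval i * exp (- eigval i * (s - r))))) has_integral
         (\<epsilon> * \<sigma> i * ?I)) {0..s}"
        by (intro has_integral_mult_right integrable_integral integrable_continuous_interval continuous_intros cb i)
      have "(\<lambda>r. exp (- eigval i * (s - r)) * inner (F (X r \<omega>)) (ebasis i)
          - \<epsilon> * \<sigma> i * (\<beta> i r \<omega> * (eigval i * exp (- eigval i * (s - r)))))
         = (\<lambda>r. exp (- eigval i * (s - r)) * (inner (F (X r \<omega>)) (ebasis i) - eigval i * (\<epsilon> * \<sigma> i * \<beta> i r \<omega>)))"
        by (intro ext) (simp only: algebra_simps)
      moreover have "inner (X s \<omega>) (ebasis i) - \<epsilon> * (\<sigma> i * (\<beta> i s \<omega> - ?I)) - \<epsilon> * \<sigma> i * ?I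
         = inner (X s \<omega>) (ebasis i) - \<epsilon> * \<sigma> i * \<beta> i s \<omega>"
        by (simp only: algebra_simps)
      ultimately show "((\<lambda>r. exp (- eigval i * (s - r)) * (inner (F (X r \<omega>)) (ebasis i) - eigval i * (\<epsilon> * \<sigma> i * \<beta> i r \<omega>)))
         has_integral (inner (X s \<omega>) (ebasis i) - \<epsilon> * \<sigma> i * \<beta> i s \<omega>)) {0..s}"
        using has_integral_diff[OF 1 2] by (simp only:)
    qed
  qed
qed

subsection \<open>Exponential square moments\<close>

text \<open>
  For \<open>V \<ge> 0\<close> this bounds an Orlicz norm of \<open>V\<close> by \<open>K\<close>; convexity of the exponential function makes
  such bounds stable under nonnegative combinations.
\<close>

definition exp_bounded :: "'w measure \<Rightarrow> ('w \<Rightarrow> real) \<Rightarrow> real \<Rightarrow> bool" where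
  "exp_bounded M V K \<longleftrightarrow> V \<in> borel_measurable M \<and> (\<forall>\<omega>. 0 \<le> V \<omega>) \<and> K > 0 \<and>
     (\<integral>\<^sup>+\<omega>. ennreal (exp (V \<omega> / K)) \<partial>M) \<le> 2"

lemma exp_bounded_mono:
  assumes V: "exp_bounded M V K" and W: "W \<in> borel_measurable M" "\<And>\<omega>. 0 \<le> W \<omega>" "\<And>\<omega>. W \<omega> \<le> V \<omega>"
    and K: "K \<le> K'"
  shows "exp_bounded M W K'"
proof -
  have K0: "K > 0" using V by (simp add: exp_bounded_def)
  have "W \<omega> / K' \<le> V \<omega> / K" for \<omega>
    using W(2,3) K K0 by (intro frac_le) (auto intro: order_trans)
  then have "(\<integral>\<^sup>+\<omega>. ennreal (exp (W \<omega> / K')) \<partial>M) \<le> (\<integral>\<^sup>+\<omega>. ennreal (exp (V \<omega> / K)) \<partial>M)"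
    by (intro nn_integral_mono ennreal_leI) simp
  also have "\<dots> \<le> 2" using V by (simp add: exp_bounded_def)
  finally show ?thesis using W(1,2) K0 K by (simp add: exp_bounded_def)
qed

context prob_space begin

lemma exp_bounded_zero: "K > 0 \<Longrightarrow> exp_bounded M (\<lambda>_. 0) K"
  by (simp add: exp_bounded_def emeasure_space_1)

text \<open>The numbers \<open>w i * k i / S\<close> are convex weights, and the sum divided by
  \<open>S\<close> is the corresponding average of the \<open>V i / k i\<close>: Jensen. Dependence
  among the \<open>V i\<close> does not matter, which is essential for values of one path at
  different times.\<close>

lemma exp_bounded_sum:
  assumes V: "\<And>i. i \<in> I \<Longrightarrow> exp_bounded M (V i) (k i)" and w: "\<And>i. i \<in> I \<Longrightarrow> w i \<ge> 0"
    and K: "(\<Sum>i\<in>I. w i * k i) \<le> K" "K > 0" and I: "finite I"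
  shows "exp_bounded M (\<lambda>\<omega>. \<Sum>i\<in>I. w i * V i \<omega>) K"
proof -
  have k: "k i > 0" and Vm [measurable]: "V i \<in> borel_measurable M" and V0: "0 \<le> V i \<omega>" if "i \<in> I" for i \<omega>
    using V[OF that] by (auto simp: exp_bounded_def)
  define S where "S = (\<Sum>i\<in>I. w i * k i)"
  have wk: "0 \<le> w i * k i" if "i \<in> I" for i
    using w[OF that] k[OF that] by simp
  have Sn: "0 \<le> S" unfolding S_def using wk by (rule sum_nonneg)
  show ?thesis
  proof (cases "S = 0")
    \<comment> \<open>All weights vanish here, because every \<open>k i\<close> is positive; the
      convex weights would be undefined.\<close>
    case True
    then have "\<forall>i\<in>I. w i * k i = 0"
      unfolding S_def using sum_nonneg_eq_0_iff[OF I wk] by simp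
    then have "\<forall>i\<in>I. w i = 0" using k by fastforce
    then show ?thesis using exp_bounded_zero[OF K(2)] by simp
  next
    case False
    with Sn have S: "S > 0" by simp
    have wkS: "0 \<le> w i * k i / S" if "i \<in> I" for i
      using wk[OF that] S by simp
    have conv: "exp ((\<Sum>i\<in>I. w i * V i \<omega>) / S) \<le> (\<Sum>i\<in>I. (w i * k i / S) * exp (V i \<omega> / k i))" for \<omega>
    proof -
      have "exp (\<Sum>i\<in>I. (w i * k i / S) *\<^sub>R (V i \<omega> / k i)) \<le> (\<Sum>i\<in>I. (w i * k i / S) * exp (V i \<omega> / k i))"
      proof (rule convex_on_sum[OF I _ exp_convex])
        show "I \<noteq> {}" using S by (auto simp: S_def)
        show "(\<Sum>i\<in>I. w i * k i / S) = 1"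
          using S by (simp add: sum_divide_distrib[symmetric] S_def[symmetric])
      qed (use wkS in auto)
      moreover have "(\<Sum>i\<in>I. (w i * k i / S) *\<^sub>R (V i \<omega> / k i)) = (\<Sum>i\<in>I. w i * V i \<omega>) / S"
        unfolding sum_divide_distrib using k by (intro sum.cong refl) (simp add: less_imp_neq[symmetric])
      ultimately show ?thesis by simp
    qed
    have "(\<integral>\<^sup>+\<omega>. ennreal (exp ((\<Sum>i\<in>I. w i * V i \<omega>) / S)) \<partial>M)
      \<le> (\<integral>\<^sup>+\<omega>. (\<Sum>i\<in>I. ennreal (w i * k i / S) * ennreal (exp (V i \<omega> / k i))) \<partial>M)"
    proof (rule nn_integral_mono)
      fix \<omega>
      have "(\<Sum>i\<in>I. ennreal (w i * k i / S) * ennreal (exp (V i \<omega> / k i)))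
          = (\<Sum>i\<in>I. ennreal ((w i * k i / S) * exp (V i \<omega> / k i)))"
        using wkS by (intro sum.cong refl ennreal_mult[symmetric]) auto
      also have "\<dots> = ennreal (\<Sum>i\<in>I. (w i * k i / S) * exp (V i \<omega> / k i))"
        using wkS by (intro sum_ennreal mult_nonneg_nonneg) auto
      finally show "ennreal (exp ((\<Sum>i\<in>I. w i * V i \<omega>) / S))
          \<le> (\<Sum>i\<in>I. ennreal (w i * k i / S) * ennreal (exp (V i \<omega> / k i)))"
        using conv[of \<omega>] by (simp add: ennreal_leI)
    qed
    also have "\<dots> = (\<Sum>i\<in>I. ennreal (w i * k i / S) * (\<integral>\<^sup>+\<omega>. ennreal (exp (V i \<omega> / k i)) \<partial>M))"
      by (subst nn_integral_sum) (auto simp: nn_integral_cmult)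
    also have "\<dots> \<le> (\<Sum>i\<in>I. ennreal (w i * k i / S) * 2)"
      using V by (intro sum_mono mult_left_mono) (auto simp: exp_bounded_def)
    also have "\<dots> = ennreal (\<Sum>i\<in>I. w i * k i / S) * 2"
      unfolding sum_distrib_right[symmetric] using wkS by (subst sum_ennreal) auto
    also have "(\<Sum>i\<in>I. w i * k i / S) = 1"
      using S by (simp add: sum_divide_distrib[symmetric] S_def[symmetric])
    finally have "exp_bounded M (\<lambda>\<omega>. \<Sum>i\<in>I. w i * V i \<omega>) S"
      using S w V0 by (auto simp: exp_bounded_def intro!: sum_nonneg)
    then show ?thesis
      by (rule exp_bounded_mono[OF _ _ _ order_refl]) (use K(1) w V0 in \<open>auto simp: S_def intro!: sum_nonneg\<close>)
  qed
qed

lemma exp_bounded_scale: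
  assumes "exp_bounded M V k" "w \<ge> 0" "w * k \<le> K" "K > 0"
  shows "exp_bounded M (\<lambda>\<omega>. w * V \<omega>) K"
  using exp_bounded_sum[of "{()}" "\<lambda>_. V" "\<lambda>_. k" "\<lambda>_. w" K] assms by simp

lemma exp_bounded_add:
  assumes "exp_bounded M V k" "exp_bounded M W l"
  shows "exp_bounded M (\<lambda>\<omega>. V \<omega> + W \<omega>) (k + l)"
  using exp_bounded_sum[of UNIV "\<lambda>b. if b then V else W" "\<lambda>b. if b then k else l" "\<lambda>_. 1" "k + l"] assms
  by (simp add: UNIV_bool exp_bounded_def add.commute)

text \<open>Markov's inequality for the exponential, with Fatou carrying the bound 2 over to the
  limit. Phrasing it for a measurable event on which \<open>J\<close> is large avoids discussing
  measurability of \<open>J\<close>, which will be a time integral.\<close>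

lemma exp_bounded_tail:
  assumes V: "\<And>m. exp_bounded M (V m) K" and lim: "AE \<omega> in M. (\<lambda>m. V m \<omega>) \<longlonglongrightarrow> J \<omega>"
    and A: "A \<in> sets M" "AE \<omega> in M. \<omega> \<in> A \<longrightarrow> c \<le> J \<omega>"
  shows "measure M A \<le> 2 * exp (- (c / K))"
proof -
  have K: "K > 0" and Vm [measurable]: "V m \<in> borel_measurable M" for m
    using V by (auto simp: exp_bounded_def)
  have "ennreal (exp (c / K)) * emeasure M A = (\<integral>\<^sup>+\<omega>. ennreal (exp (c / K)) * indicator A \<omega> \<partial>M)"
    using A(1) by (simp add: nn_integral_cmult_indicator)
  also have "\<dots> \<le> (\<integral>\<^sup>+\<omega>. liminf (\<lambda>m. ennreal (exp (V m \<omega> / K))) \<partial>M)"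
  proof (rule nn_integral_mono_AE)
    show "AE \<omega> in M. ennreal (exp (c / K)) * indicator A \<omega> \<le> liminf (\<lambda>m. ennreal (exp (V m \<omega> / K)))"
      using lim A(2)
    proof eventually_elim
      case (elim \<omega>)
      have "(\<lambda>m. ennreal (exp (V m \<omega> / K))) \<longlonglongrightarrow> ennreal (exp (J \<omega> / K))"
        using K by (intro tendsto_intros elim(1)) auto
      then have "liminf (\<lambda>m. ennreal (exp (V m \<omega> / K))) = ennreal (exp (J \<omega> / K))"
        by (rule lim_imp_Liminf[OF sequentially_bot])
      then show ?case
        using elim(2) K by (auto simp: indicator_def divide_right_mono intro!: ennreal_leI)
    qed
  qed
  also have "\<dots> \<le> liminf (\<lambda>m. \<integral>\<^sup>+\<omega>. ennreal (exp (V m \<omega> / K)) \<partial>M)"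
    by (rule nn_integral_liminf) measurable
  also have "\<dots> \<le> 2"
    by (rule Liminf_le[OF sequentially_bot]) (use V in \<open>auto simp: exp_bounded_def intro!: always_eventually\<close>)
  finally have "ennreal (exp (c / K) * measure M A) \<le> ennreal 2"
    by (simp add: emeasure_eq_measure ennreal_mult)
  then have "exp (c / K) * measure M A \<le> 2" by (subst (asm) ennreal_le_iff) auto
  then have "exp (- (c / K)) * (exp (c / K) * measure M A) \<le> exp (- (c / K)) * 2"
    by (intro mult_left_mono) auto
  then show ?thesis unfolding mult.assoc[symmetric] exp_add[symmetric] by simp
qed

text \<open>Tilting the density of variance \<open>v\<close> by
  \<open>exp (\<theta> * x^2 / v)\<close> gives a multiple of the density of variance
  \<open>v / (1 - 2 * \<theta>)\<close>.\<close>

lemma normal_exp_square: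
  assumes D: "distributed M lborel X (normal_density 0 (sqrt v))" and v: "v > 0" and \<theta>: "\<theta> < 1 / 2"
  shows "(\<integral>\<^sup>+\<omega>. ennreal (exp (\<theta> * (X \<omega>)\<^sup>2 / v)) \<partial>M) = ennreal (1 / sqrt (1 - 2 * \<theta>))"
proof -
  define u where "u = v / (1 - 2 * \<theta>)"
  have u: "u > 0" using v \<theta> by (simp add: u_def)
  have eq: "normal_density 0 (sqrt v) x * exp (\<theta> * x\<^sup>2 / v) = 1 / sqrt (1 - 2 * \<theta>) * normal_density 0 (sqrt u) x" for x
  proof -
    have e: "exp (- (x\<^sup>2) / (2 * v)) * exp (\<theta> * x\<^sup>2 / v) = exp (- (x\<^sup>2) / (2 * u))"
    proof -
      have "- (x\<^sup>2) / (2 * v) + \<theta> * x\<^sup>2 / v = - (x\<^sup>2) / (2 * u)"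
        using v by (simp add: u_def diff_divide_distrib left_diff_distrib right_diff_distrib)
      then show ?thesis by (simp only: exp_add[symmetric])
    qed
    have "2 * pi * u = (2 * pi * v) / (1 - 2 * \<theta>)" by (simp add: u_def)
    then have "sqrt (2 * pi * u) = sqrt (2 * pi * v) / sqrt (1 - 2 * \<theta>)"
      by (simp only: real_sqrt_divide)
    then have s: "1 / sqrt (1 - 2 * \<theta>) * (1 / sqrt (2 * pi * u)) = 1 / sqrt (2 * pi * v)"
      using \<theta> by simp
    have "normal_density 0 (sqrt v) x * exp (\<theta> * x\<^sup>2 / v)
        = 1 / sqrt (2 * pi * v) * (exp (- (x\<^sup>2) / (2 * v)) * exp (\<theta> * x\<^sup>2 / v))"
      using v by (simp add: normal_density_def)
    also have "\<dots> = 1 / sqrt (1 - 2 * \<theta>) * (1 / sqrt (2 * pi * u) * exp (- (x\<^sup>2) / (2 * u)))"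
      unfolding e s[symmetric] by (simp only: mult.assoc)
    also have "1 / sqrt (2 * pi * u) * exp (- (x\<^sup>2) / (2 * u)) = normal_density 0 (sqrt u) x"
      using u by (simp add: normal_density_def)
    finally show ?thesis .
  qed
  have "(\<integral>\<^sup>+\<omega>. ennreal (exp (\<theta> * (X \<omega>)\<^sup>2 / v)) \<partial>M)
      = (\<integral>\<^sup>+x. ennreal (normal_density 0 (sqrt v) x) * ennreal (exp (\<theta> * x\<^sup>2 / v)) \<partial>lborel)"
    by (rule distributed_nn_integral[OF D, symmetric]) measurable
  also have "\<dots> = (\<integral>\<^sup>+x. ennreal (1 / sqrt (1 - 2 * \<theta>)) * ennreal (normal_density 0 (sqrt u) x) \<partial>lborel)"
    using \<theta> by (intro nn_integral_cong) (simp add: ennreal_mult[symmetric] eq del: times_divide_eq_left)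
  also have "\<dots> = ennreal (1 / sqrt (1 - 2 * \<theta>)) * (\<integral>\<^sup>+x. ennreal (normal_density 0 (sqrt u) x) \<partial>lborel)"
    by (intro nn_integral_cmult) measurable
  also have "(\<integral>\<^sup>+x. ennreal (normal_density 0 (sqrt u) x) \<partial>lborel) = 1"
    using u by (subst nn_integral_eq_integral) auto
  finally show ?thesis by simp
qed

text \<open>The factor 4 corresponds to \<open>\<theta> = 1/4\<close>, where the moment is
  \<open>sqrt 2\<close>, below the threshold 2. Equal times are treated apart, since the Gaussian
  density is available only for \<open>s < t\<close>.\<close>

lemma brownian_increment_exp_bounded:
  assumes B: "std_brownian_motion M b" and st: "0 \<le> s" "s \<le> t" and k: "k > 0" "k \<ge> 4 * (t - s)"
  shows "exp_bounded M (\<lambda>\<omega>. (b t \<omega> - b s \<omega>)\<^sup>2) k"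
proof (cases "s = t")
  case True
  then show ?thesis using exp_bounded_zero[OF k(1)] by simp
next
  case False
  then have lt: "s < t" using st by simp
  have [measurable]: "b s \<in> borel_measurable M" "b t \<in> borel_measurable M"
    using B st by (auto simp: std_brownian_motion_def)
  have "(\<integral>\<^sup>+\<omega>. ennreal (exp (1/4 * (b t \<omega> - b s \<omega>)\<^sup>2 / (t - s))) \<partial>M) = ennreal (1 / sqrt (1 - 2 * (1/4)))"
    using B st(1) lt by (intro normal_exp_square) (auto simp: std_brownian_motion_def)
  also have "\<dots> \<le> ennreal 2"
  proof (rule ennreal_leI)
    have "sqrt ((1/2)\<^sup>2) \<le> sqrt (1 - 2 * (1/4))" by (intro real_sqrt_le_mono) (simp add: power2_eq_square)
    then have "1/2 \<le> sqrt (1 - 2 * (1/4))" by simp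
    then show "1 / sqrt (1 - 2 * (1/4)) \<le> 2"
      using le_divide_eq by (simp add: field_simps)
  qed
  finally have "exp_bounded M (\<lambda>\<omega>. (b t \<omega> - b s \<omega>)\<^sup>2) (4 * (t - s))"
    using lt by (simp add: exp_bounded_def)
  then show ?thesis by (rule exp_bounded_mono[OF _ _ _ order_refl k(2)]) simp_all
qed

subsection \<open>The energy of the increments\<close>

lemma brownian_energy_moment:
  assumes B: "std_brownian_motion M b" and a: "a \<ge> 0" and h: "h > 0" and \<theta>: "\<theta> < 1 / 2"
  shows "(\<integral>\<^sup>+\<omega>. ennreal (exp (\<theta> * (\<Sum>k<m. (b (a + real (Suc k) * h) \<omega> - b (a + real k * h) \<omega>)\<^sup>2 / h))) \<partial>M)
     = ennreal ((1 / sqrt (1 - 2 * \<theta>)) ^ m)"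
proof -
  let ?\<tau> = "\<lambda>k. a + real k * h"
  let ?D = "\<lambda>k \<omega>. b (?\<tau> (Suc k)) \<omega> - b (?\<tau> k) \<omega>"
  have tau: "?\<tau> k < ?\<tau> (Suc k)" "0 \<le> ?\<tau> k" "?\<tau> (Suc k) - ?\<tau> k = h" for k
    using a h by (auto simp: algebra_simps)
  have B4: "\<forall>m (\<tau> :: nat \<Rightarrow> real). 0 \<le> \<tau> 0 \<and> (\<forall>k<m. \<tau> k < \<tau> (Suc k)) \<longrightarrow>
        indep_vars (\<lambda>_. borel) (\<lambda>k \<omega>. b (\<tau> (Suc k)) \<omega> - b (\<tau> k) \<omega>) {..<m}"
    using B unfolding std_brownian_motion_def by blast
  have ind: "indep_vars (\<lambda>_. borel) ?D {..<m}"
    using B4[rule_format, of ?\<tau> m] tau a by simp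
  have ind': "indep_vars (\<lambda>_. borel) (\<lambda>k \<omega>. ennreal (exp (\<theta> * (?D k \<omega>)\<^sup>2 / h))) {..<m}"
    by (rule indep_vars_compose2[OF ind]) measurable
  have "(\<integral>\<^sup>+\<omega>. ennreal (exp (\<theta> * (\<Sum>k<m. (?D k \<omega>)\<^sup>2 / h))) \<partial>M)
      = (\<integral>\<^sup>+\<omega>. (\<Prod>k<m. ennreal (exp (\<theta> * (?D k \<omega>)\<^sup>2 / h))) \<partial>M)"
    by (intro nn_integral_cong) (simp add: prod_ennreal exp_sum[symmetric] sum_distrib_left)
  also have "\<dots> = (\<Prod>k<m. \<integral>\<^sup>+\<omega>. ennreal (exp (\<theta> * (?D k \<omega>)\<^sup>2 / h)) \<partial>M)"
    by (intro indep_vars_nn_integral ind') auto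
  also have "\<dots> = (\<Prod>k<m. ennreal (1 / sqrt (1 - 2 * \<theta>)))"
  proof (intro prod.cong refl normal_exp_square h \<theta>)
    fix k
    have "distributed M lborel (?D k) (normal_density 0 (sqrt (?\<tau> (Suc k) - ?\<tau> k)))"
      using B tau unfolding std_brownian_motion_def by blast
    then show "distributed M lborel (?D k) (normal_density 0 (sqrt h))" by (simp only: tau(3))
  qed
  also have "\<dots> = ennreal ((1 / sqrt (1 - 2 * \<theta>)) ^ m)"
    using \<theta> by (simp add: ennreal_power)
  finally show ?thesis .
qed

text \<open>Independence of the motions is given for whole paths in the product sigma-algebra; the
  energy reads only finitely many time coordinates and is therefore a measurable functional of the
  path. With \<open>n * m\<close> independent standard squares this is the moment generating
  function of a chi-square law.\<close>

lemma brownian_energies_moment: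
  assumes bm: "indep_brownian_motions M \<beta>" and a: "a \<ge> 0" and h: "h > 0" and \<theta>: "\<theta> < 1 / 2"
  shows "(\<integral>\<^sup>+\<omega>. ennreal (exp (\<theta> * (\<Sum>i=1..n. \<Sum>k<m.
      (\<beta> i (a + real (Suc k) * h) \<omega> - \<beta> i (a + real k * h) \<omega>)\<^sup>2 / h))) \<partial>M)
     = ennreal ((1 / sqrt (1 - 2 * \<theta>)) ^ (n * m))"
proof -
  let ?\<tau> = "\<lambda>k. a + real k * h"
  let ?E = "\<lambda>p. ennreal (exp (\<theta> * (\<Sum>k<m. (p (?\<tau> (Suc k)) - p (?\<tau> k))\<^sup>2 / h)))"
  have tau: "?\<tau> k \<in> {0..}" for k using a h by simp
  have "indep_vars (\<lambda>_. Pi\<^sub>M {0..} (\<lambda>_. borel)) (\<lambda>i \<omega>. \<lambda>t\<in>{0..}. \<beta> i t \<omega>) {1..n}"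
    using bm unfolding indep_brownian_motions_def by (auto intro: indep_vars_subset)
  then have "indep_vars (\<lambda>_. borel) (\<lambda>i \<omega>. ?E (\<lambda>t\<in>{0..}. \<beta> i t \<omega>)) {1..n}"
  proof (rule indep_vars_compose2)
    have c: "(\<lambda>p. p (?\<tau> k)) \<in> borel_measurable (Pi\<^sub>M {0..} (\<lambda>_. borel :: real measure))" for k
      by (rule measurable_component_singleton[OF tau])
    note [measurable] = c
    show "?E \<in> borel_measurable (Pi\<^sub>M {0..} (\<lambda>_. borel))" for i
      by measurable
  qed
  moreover have "?E (\<lambda>t\<in>{0..}. \<beta> i t \<omega>) = ?E (\<lambda>t. \<beta> i t \<omega>)" for i \<omega>
  proof -
    have "(\<lambda>t\<in>{0..}. \<beta> i t \<omega>) (?\<tau> k) = \<beta> i (?\<tau> k) \<omega>" for k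
      using tau by (rule restrict_apply')
    then show ?thesis by (simp only:)
  qed
  ultimately have ind: "indep_vars (\<lambda>_. borel) (\<lambda>i \<omega>. ?E (\<lambda>t. \<beta> i t \<omega>)) {1..n}" by (simp only:)
  have "(\<integral>\<^sup>+\<omega>. ennreal (exp (\<theta> * (\<Sum>i=1..n. \<Sum>k<m. (\<beta> i (?\<tau> (Suc k)) \<omega> - \<beta> i (?\<tau> k) \<omega>)\<^sup>2 / h))) \<partial>M)
      = (\<integral>\<^sup>+\<omega>. (\<Prod>i=1..n. ?E (\<lambda>t. \<beta> i t \<omega>)) \<partial>M)"
    by (intro nn_integral_cong) (simp add: prod_ennreal exp_sum[symmetric] sum_distrib_left)
  also have "\<dots> = (\<Prod>i=1..n. \<integral>\<^sup>+\<omega>. ?E (\<lambda>t. \<beta> i t \<omega>) \<partial>M)"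
    by (intro indep_vars_nn_integral ind) auto
  also have "\<dots> = (\<Prod>i=1..n. ennreal ((1 / sqrt (1 - 2 * \<theta>)) ^ m))"
    using bm by (intro prod.cong refl brownian_energy_moment a h \<theta>) (auto simp: indep_brownian_motions_def)
  also have "\<dots> = ennreal ((1 / sqrt (1 - 2 * \<theta>)) ^ (n * m))"
    using \<theta> by (simp add: ennreal_power power_mult[symmetric] mult.commute)
  finally show ?thesis .
qed

text \<open>Chernoff's bound. The prefactor depends on the number of increments but not on the
  position \<open>a\<close> of the window.\<close>

lemma brownian_energies_tail:
  assumes bm: "indep_brownian_motions M \<beta>" and a: "a \<ge> 0" and h: "h > 0" and \<theta>: "0 \<le> \<theta>" "\<theta> < 1 / 2"
  shows "measure M {\<omega>\<in>space M. c \<le> (\<Sum>i=1..n. \<Sum>k<m.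
      (\<beta> i (a + real (Suc k) * h) \<omega> - \<beta> i (a + real k * h) \<omega>)\<^sup>2 / h)}
     \<le> exp (- \<theta> * c) * (1 / sqrt (1 - 2 * \<theta>)) ^ (n * m)"
proof -
  let ?\<tau> = "\<lambda>k. a + real k * h"
  let ?V = "\<lambda>\<omega>. \<Sum>i=1..n. \<Sum>k<m. (\<beta> i (?\<tau> (Suc k)) \<omega> - \<beta> i (?\<tau> k) \<omega>)\<^sup>2 / h"
  have [measurable]: "?V \<in> borel_measurable M"
  proof (intro borel_measurable_sum borel_measurable_divide borel_measurable_power borel_measurable_diff
      borel_measurable_const)
    fix i k assume "i \<in> {1..n}"
    then have "std_brownian_motion M (\<beta> i)" using bm by (simp add: indep_brownian_motions_def)
    then have "\<beta> i t \<in> borel_measurable M" if "t \<ge> 0" for t using that by (simp add: std_brownian_motion_def)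
    then show "\<beta> i (?\<tau> (Suc k)) \<in> borel_measurable M" "\<beta> i (?\<tau> k) \<in> borel_measurable M"
      using a h by auto
  qed
  have "emeasure M {\<omega>\<in>space M. c \<le> ?V \<omega>} \<le> (\<integral>\<^sup>+\<omega>. ennreal (exp (- \<theta> * c)) * ennreal (exp (\<theta> * ?V \<omega>)) \<partial>M)"
  proof (subst nn_integral_indicator[symmetric])
    show "{\<omega>\<in>space M. c \<le> ?V \<omega>} \<in> sets M" by measurable
    show "(\<integral>\<^sup>+\<omega>. indicator {\<omega>\<in>space M. c \<le> ?V \<omega>} \<omega> \<partial>M)
       \<le> (\<integral>\<^sup>+\<omega>. ennreal (exp (- \<theta> * c)) * ennreal (exp (\<theta> * ?V \<omega>)) \<partial>M)"
    proof (rule nn_integral_mono)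
      fix \<omega>
      have "1 \<le> exp (- \<theta> * c) * exp (\<theta> * ?V \<omega>)" if "c \<le> ?V \<omega>"
      proof -
        have "\<theta> * c \<le> \<theta> * ?V \<omega>" using that \<theta>(1) by (rule mult_left_mono)
        then show ?thesis unfolding exp_add[symmetric] by simp
      qed
      then have "ennreal 1 \<le> ennreal (exp (- \<theta> * c) * exp (\<theta> * ?V \<omega>))" if "c \<le> ?V \<omega>"
        using that by (intro ennreal_leI) blast
      then show "indicator {\<omega>\<in>space M. c \<le> ?V \<omega>} \<omega> \<le> ennreal (exp (- \<theta> * c)) * ennreal (exp (\<theta> * ?V \<omega>))"
        by (cases "c \<le> ?V \<omega>") (auto simp: indicator_def ennreal_mult)
    qed
  qed
  also have "\<dots> = ennreal (exp (- \<theta> * c)) * (\<integral>\<^sup>+\<omega>. ennreal (exp (\<theta> * ?V \<omega>)) \<partial>M)"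
    by (intro nn_integral_cmult) measurable
  also have "\<dots> = ennreal (exp (- \<theta> * c) * (1 / sqrt (1 - 2 * \<theta>)) ^ (n * m))"
    unfolding brownian_energies_moment[OF bm a h \<theta>(2)] using \<theta> by (simp add: ennreal_mult)
  finally show ?thesis
    using \<theta> by (simp add: emeasure_eq_measure)
qed

end

subsection \<open>Comparison with controlled paths\<close>

text \<open>
  Up to time \<open>a\<close> the path \<open>brownian_line a h m b\<close> is 0; on \<open>[a, a + m h]\<close> it is the polygon through the values
  \<open>b(a + k h) - b(a)\<close>.
\<close>

definition increments :: "real \<Rightarrow> real \<Rightarrow> (real \<Rightarrow> real) \<Rightarrow> nat \<Rightarrow> real" where
  "increments a h b k = b (a + real (Suc k) * h) - b (a + real k * h)"

definition brownian_line :: "real \<Rightarrow> real \<Rightarrow> nat \<Rightarrow> (real \<Rightarrow> real) \<Rightarrow> real \<Rightarrow> real" where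
  "brownian_line a h m b = broken_line a h m (increments a h b)"

lemma brownian_line_before:
  assumes "h > 0" "s \<le> a"
  shows "brownian_line a h m b s = 0"
  unfolding brownian_line_def broken_line_def
proof (intro sum.neutral ballI)
  fix k
  have "(s - a) / h \<le> 0" using assms by (intro divide_nonpos_pos) auto
  then have "(s - a) / h - real k \<le> 0" by simp
  then show "increments a h b k * ramp ((s - a) / h - real k) = 0" by (simp add: ramp_def)
qed

text \<open>At a point of cell \<open>j\<close> the ramps of earlier cells are saturated at 1, so
  their increments telescope, and those of later cells are 0. Both end points are included.\<close>

lemma brownian_line_cell:
  assumes h: "h > 0" and j: "j < m" and x: "0 \<le> x" "x \<le> 1"
  shows "brownian_line a h m b (a + (real j + x) * h)
    = b (a + real j * h) - b a + x * (b (a + real (Suc j) * h) - b (a + real j * h))"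
proof -
  have arg: "(a + (real j + x) * h - a) / h - real k = real j + x - real k" for k
    using h by simp
  have "brownian_line a h m b (a + (real j + x) * h) = (\<Sum>k<m. increments a h b k * ramp (real j + x - real k))"
    unfolding brownian_line_def broken_line_def arg ..
  also have "\<dots> = (\<Sum>k<Suc j. increments a h b k * ramp (real j + x - real k))"
  proof (rule sum.mono_neutral_right)
    show "\<forall>k\<in>{..<m} - {..<Suc j}. increments a h b k * ramp (real j + x - real k) = 0"
    proof
      fix k assume "k \<in> {..<m} - {..<Suc j}"
      then have "real k \<ge> real j + 1" by auto
      then have "real j + x - real k \<le> 0" using x by linarith
      then show "increments a h b k * ramp (real j + x - real k) = 0" by (simp add: ramp_def)
    qed
  qed (use j in auto)
  also have "\<dots> = (\<Sum>k<j. increments a h b k) + increments a h b j * x"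
  proof -
    have "(\<Sum>k<j. increments a h b k * ramp (real j + x - real k)) = (\<Sum>k<j. increments a h b k)"
    proof (intro sum.cong refl)
      fix k assume "k \<in> {..<j}"
      then have "real k + 1 \<le> real j" by auto
      then have "1 \<le> real j + x - real k" using x by linarith
      then show "increments a h b k * ramp (real j + x - real k) = increments a h b k" by (simp add: ramp_def)
    qed
    then show ?thesis using x by (simp add: ramp_def)
  qed
  also have "(\<Sum>k<j. increments a h b k) = b (a + real j * h) - b a"
    using sum_lessThan_telescope[of "\<lambda>k. b (a + real k * h)" j] by (simp add: increments_def)
  finally show ?thesis by (simp add: increments_def mult.commute)
qed

lemma brownian_line_end:
  assumes h: "h > 0" and m: "m > 0"
  shows "brownian_line a h m b (a + real m * h) = b (a + real m * h) - b a"
proof -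
  obtain j where j: "m = Suc j" using m gr0_implies_Suc by blast
  have "brownian_line a h m b (a + (real j + 1) * h)
    = b (a + real j * h) - b a + 1 * (b (a + real (Suc j) * h) - b (a + real j * h))"
    using j by (intro brownian_line_cell h) auto
  then show ?thesis by (simp add: j algebra_simps)
qed

text \<open>The interpolation error minus its value at the final time. Since the polygon ends at
  \<open>b (a + m h) - b a\<close>, this is the increment \<open>b s - b a\<close> before
  \<open>a\<close> and the bridge over the current cell after it.\<close>

definition bridge :: "real \<Rightarrow> real \<Rightarrow> nat \<Rightarrow> (real \<Rightarrow> real) \<Rightarrow> real \<Rightarrow> real" where
  "bridge a h m b s = (b s - brownian_line a h m b s)
     - (b (a + real m * h) - brownian_line a h m b (a + real m * h))"

lemma bridge_eq: "h > 0 \<Longrightarrow> m > 0 \<Longrightarrow> bridge a h m b s = b s - brownian_line a h m b s - b a"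
  by (simp add: bridge_def brownian_line_end)

text \<open>\<open>1 + y \<le> exp y\<close> at \<open>y = \<kappa> * x / 2\<close>: half of the
  discount rate suffices to beat a linearly growing variance.\<close>

lemma le_exp_half:
  fixes x \<kappa> :: real
  assumes "\<kappa> > 0"
  shows "x * exp (- \<kappa> * x / 2) \<le> 2 / \<kappa>"
proof -
  have "\<kappa> * x / 2 \<le> exp (\<kappa> * x / 2)"
    using exp_ge_add_one_self[of "\<kappa> * x / 2"] by linarith
  then have "\<kappa> * x / 2 * exp (- \<kappa> * x / 2) \<le> exp (\<kappa> * x / 2) * exp (- \<kappa> * x / 2)"
    by (intro mult_right_mono) auto
  also have "\<dots> = 1" unfolding exp_add[symmetric] by simp
  finally have "x * exp (- \<kappa> * x / 2) * \<kappa> \<le> 2" by (simp add: algebra_simps)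
  then show ?thesis using assms by (subst pos_le_divide_eq)
qed

context prob_space begin

text \<open>Before \<open>a\<close> the variance \<open>a - s\<close> is at most
  \<open>(2 / \<kappa>) * exp (\<kappa> * (a - s) / 2)\<close>, and \<open>a - s\<close> equals
  \<open>t - s\<close> minus the window length, which produces the small first summand of
  \<open>\<rho>\<close>. After \<open>a\<close> the relevant variances are at most the mesh
  \<open>h\<close>, the second summand. The growth allowed in \<open>t - s\<close> uses only half of
  the discount rate.\<close>

lemma bridge_exp_bounded:
  assumes B: "std_brownian_motion M b" and a: "a \<ge> 0" and h: "h > 0" and m: "m > 0" and \<kappa>: "\<kappa> > 0"
    and t: "t = a + real m * h" and s: "s \<in> {0..t}"
    and \<rho>: "\<rho> = exp (- \<kappa> * (real m * h) / 2) * (2 / \<kappa>) + h"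
  shows "exp_bounded M (\<lambda>\<omega>. (bridge a h m (\<lambda>r. b r \<omega>) s)\<^sup>2) (4 * \<rho> * exp (\<kappa> * (t - s) / 2))"
proof -
  have bm: "b r \<in> borel_measurable M" if "r \<ge> 0" for r
    using B that by (simp add: std_brownian_motion_def)
  have \<rho>h: "h \<le> \<rho>" using \<kappa> by (simp add: \<rho>)
  show ?thesis
  proof (cases "s \<le> a")
    case True
    have "a - s \<le> \<rho> * exp (\<kappa> * (t - s) / 2)"
    proof -
      have "(a - s) * exp (- \<kappa> * (a - s) / 2) \<le> 2 / \<kappa>" by (rule le_exp_half[OF \<kappa>])
      then have "(a - s) * exp (- \<kappa> * (a - s) / 2) * exp (- \<kappa> * (real m * h) / 2)
          \<le> 2 / \<kappa> * exp (- \<kappa> * (real m * h) / 2)"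
        by (intro mult_right_mono) auto
      also have "\<dots> \<le> \<rho>" using h by (simp add: \<rho> mult.commute)
      finally have "(a - s) * exp (- \<kappa> * (a - s) / 2) * exp (- \<kappa> * (real m * h) / 2) \<le> \<rho>" .
      moreover have "exp (- \<kappa> * (a - s) / 2) * exp (- \<kappa> * (real m * h) / 2) = exp (- (\<kappa> * (t - s) / 2))"
        unfolding exp_add[symmetric] t by (simp add: field_simps)
      ultimately have "(a - s) * exp (- (\<kappa> * (t - s) / 2)) \<le> \<rho>" by (simp only: mult.assoc)
      then have "(a - s) * exp (- (\<kappa> * (t - s) / 2)) * exp (\<kappa> * (t - s) / 2) \<le> \<rho> * exp (\<kappa> * (t - s) / 2)"
        by (intro mult_right_mono) auto
      then show ?thesis unfolding mult.assoc exp_add[symmetric] by simp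
    qed
    then have "exp_bounded M (\<lambda>\<omega>. (b a \<omega> - b s \<omega>)\<^sup>2) (4 * \<rho> * exp (\<kappa> * (t - s) / 2))"
      using True s h \<rho>h by (intro brownian_increment_exp_bounded[OF B]) auto
    moreover have "(bridge a h m (\<lambda>r. b r \<omega>) s)\<^sup>2 = (b a \<omega> - b s \<omega>)\<^sup>2" for \<omega>
      unfolding bridge_eq[OF h m] brownian_line_before[OF h True] by (simp add: power2_commute)
    ultimately show ?thesis by simp
  next
    case False
    define y where "y = (s - a) / h"
    \<comment> \<open>At the last node the floor would name a cell beyond the polygon; that point is
      assigned to the last cell with \<open>x = 1\<close>.\<close>
    define j where "j = (if y = real m then m - 1 else nat \<lfloor>y\<rfloor>)"
    define x where "x = y - real j"
    have y: "0 \<le> y" "y \<le> real m" using False s h by (auto simp: y_def t field_simps)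
    have jx: "j < m" "0 \<le> x" "x \<le> 1"
    proof -
      show "j < m" using y m by (auto simp: j_def) linarith
      show "0 \<le> x" using y m by (auto simp: x_def j_def)
      show "x \<le> 1" using y m by (auto simp: x_def j_def of_nat_diff) linarith
    qed
    have s_eq: "s = a + (real j + x) * h" using h by (simp add: x_def y_def)
    define p where "p = a + real j * h"
    define q where "q = a + real (Suc j) * h"
    have pq: "0 \<le> p" "p \<le> s" "s \<le> q" "q - p = h"
    proof -
      show "0 \<le> p" using a h by (simp add: p_def)
      show "p \<le> s" using jx h by (simp add: p_def s_eq algebra_simps)
      show "q - p = h" by (simp add: q_def p_def algebra_simps)
      have "x * h \<le> 1 * h" using jx h by (intro mult_right_mono) auto
      then show "s \<le> q" by (simp add: q_def s_eq algebra_simps)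
    qed
    have "exp_bounded M (\<lambda>\<omega>. (1 - x) * (b s \<omega> - b p \<omega>)\<^sup>2 + x * (b q \<omega> - b s \<omega>)\<^sup>2) ((1 - x) * (4 * h) + x * (4 * h))"
    proof (cases "x = 0 \<or> x = 1")
      \<comment> \<open>At a node one weight is 0, and \<open>exp_bounded\<close> does not admit the
        bound 0.\<close>
      case True
      then show ?thesis
        using brownian_increment_exp_bounded[OF B, of p s "4 * h"]
          brownian_increment_exp_bounded[OF B, of s q "4 * h"] pq h by auto
    next
      case False
      then show ?thesis
        using pq h jx
        by (intro exp_bounded_add exp_bounded_scale[where k="4 * h"] brownian_increment_exp_bounded[OF B]) auto
    qed
    then have eb: "exp_bounded M (\<lambda>\<omega>. (1 - x) * (b s \<omega> - b p \<omega>)\<^sup>2 + x * (b q \<omega> - b s \<omega>)\<^sup>2) (4 * h)"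
      by (simp add: algebra_simps)
    \<comment> \<open>The bridge is a weighted difference of the increments to the two ends of its
      cell; these need not be independent for the convexity bound.\<close>
    have br: "bridge a h m (\<lambda>r. b r \<omega>) s = (1 - x) * (b s \<omega> - b p \<omega>) - x * (b q \<omega> - b s \<omega>)" for \<omega>
    proof -
      have "brownian_line a h m (\<lambda>r. b r \<omega>) s = b p \<omega> - b a \<omega> + x * (b q \<omega> - b p \<omega>)"
        unfolding s_eq p_def q_def by (rule brownian_line_cell[OF h jx])
      then show ?thesis unfolding bridge_eq[OF h m] by (simp add: algebra_simps)
    qed
    \<comment> \<open>The defect of the inequality is
      \<open>x * (1 - x) * (u + v)^2\<close>.\<close>
    have conv: "((1 - x) * u - x * v)\<^sup>2 \<le> (1 - x) * u\<^sup>2 + x * v\<^sup>2" for u v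
    proof -
      have "0 \<le> (x * (1 - x)) * (u + v)\<^sup>2" using jx by simp
      then show ?thesis by (simp add: power2_eq_square algebra_simps)
    qed
    have "4 * h * 1 \<le> 4 * \<rho> * exp (\<kappa> * (t - s) / 2)"
      using \<rho>h h s \<kappa> by (intro mult_mono) auto
    then show ?thesis
      using bm pq s by (intro exp_bounded_mono[OF eb]) (auto simp: br intro!: conv)
  qed
qed

text \<open>The discount is split into two equal factors: one cancels the growth in
  \<open>bridge_exp_bounded\<close>, the other is an integrable weight of mass at most
  \<open>2 / \<kappa>\<close>. The approximating sums are then nonnegative combinations, of total
  weight at most \<open>1 + C * (2 / \<kappa>)\<close>, of variables with one common exponential
  bound.\<close>

lemma weighted_bridge_tail:
  assumes bm: "indep_brownian_motions M \<beta>" and a: "a \<ge> 0" and h: "h > 0" and m: "m > 0" and \<kappa>: "\<kappa> > 0"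
    and t: "t = a + real m * h"
    and \<rho>: "\<rho> = exp (- \<kappa> * (real m * h) / 2) * (2 / \<kappa>) + h"
    and C: "C \<ge> 0" and n: "n \<ge> 1" and \<sigma>: "\<And>i. i \<in> {1..n} \<Longrightarrow> \<sigma> i > 0"
    and J: "\<And>\<omega>. J \<omega> = exp (- \<kappa> * t) * (\<Sum>i=1..n. (\<sigma> i)\<^sup>2 * (bridge a h m (\<lambda>r. \<beta> i r \<omega>) 0)\<^sup>2)
       + C * integral {0..t} (\<lambda>s. exp (- \<kappa> * (t - s)) * (\<Sum>i=1..n. (\<sigma> i)\<^sup>2 * (bridge a h m (\<lambda>r. \<beta> i r \<omega>) s)\<^sup>2))"
    and A: "A \<in> sets M" "AE \<omega> in M. \<omega> \<in> A \<longrightarrow> c \<le> J \<omega>"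
  shows "measure M A \<le> 2 * exp (- (c / (4 * (\<Sum>i=1..n. (\<sigma> i)\<^sup>2) * (1 + C * (2 / \<kappa>)) * \<rho>)))"
proof -
  let ?S = "\<Sum>i=1..n. (\<sigma> i)\<^sup>2"
  have B: "std_brownian_motion M (\<beta> i)" if "i \<in> {1..n}" for i
    using bm that by (auto simp: indep_brownian_motions_def)
  have S: "?S > 0" using n by (intro sum_pos zero_less_power \<sigma>) auto
  have \<rho>0: "\<rho> > 0" using h \<kappa> by (simp add: \<rho> add_nonneg_pos)
  have t0: "t > 0" using a h m by (simp add: t add_nonneg_pos)
  define q where "q s \<omega> = (\<Sum>i=1..n. (\<sigma> i)\<^sup>2 * (bridge a h m (\<lambda>r. \<beta> i r \<omega>) s)\<^sup>2)" for s \<omega>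
  define g where "g s \<omega> = exp (- \<kappa> * (t - s) / 2) * q s \<omega>" for s \<omega>
  \<comment> \<open>\<open>E\<close> is the primitive of the second discount factor; its increments
    are the weights of the Stieltjes sums.\<close>
  define E where "E s = 2 / \<kappa> * exp (- \<kappa> * (t - s) / 2)" for s
  let ?s = "\<lambda>p k. t * real k / real p"
  define V where "V p \<omega> = exp (- \<kappa> * t) * q 0 \<omega> + C * (\<Sum>k<p. (E (?s p (Suc k)) - E (?s p k)) * g (?s p (Suc k)) \<omega>)"
    for p \<omega>
  have E_mono: "E r \<le> E s" if "r \<le> s" for r s
    unfolding E_def using that \<kappa> by (intro mult_left_mono) (auto simp: divide_right_mono)
  have qb: "exp_bounded M (q s) (4 * ?S * \<rho> * exp (\<kappa> * (t - s) / 2))" if "s \<in> {0..t}" for s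
    unfolding q_def[abs_def]
  proof (rule exp_bounded_sum[where k="\<lambda>_. 4 * \<rho> * exp (\<kappa> * (t - s) / 2)"])
    show "(\<Sum>i=1..n. (\<sigma> i)\<^sup>2 * (4 * \<rho> * exp (\<kappa> * (t - s) / 2))) \<le> 4 * ?S * \<rho> * exp (\<kappa> * (t - s) / 2)"
      unfolding sum_distrib_right[symmetric] by simp
  qed (use bridge_exp_bounded[OF B a h m \<kappa> t that \<rho>] S \<rho>0 in auto)
  have gb: "exp_bounded M (g s) (4 * ?S * \<rho>)" if "s \<in> {0..t}" for s
    unfolding g_def[abs_def]
  proof (rule exp_bounded_scale[OF qb[OF that]])
    have "exp (- \<kappa> * (t - s) / 2) * exp (\<kappa> * (t - s) / 2) = 1"
      unfolding exp_add[symmetric] by simp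
    then show "exp (- \<kappa> * (t - s) / 2) * (4 * ?S * \<rho> * exp (\<kappa> * (t - s) / 2)) \<le> 4 * ?S * \<rho>"
      by (simp add: mult.left_commute)
  qed (use S \<rho>0 in auto)
  have Vb: "exp_bounded M (V p) (4 * ?S * (1 + C * (2 / \<kappa>)) * \<rho>)" for p
  proof -
    have 1: "exp_bounded M (\<lambda>\<omega>. exp (- \<kappa> * t) * q 0 \<omega>) (4 * ?S * \<rho>)"
    proof (rule exp_bounded_scale[OF qb])
      have "exp (- \<kappa> * t) * exp (\<kappa> * (t - 0) / 2) \<le> 1"
        unfolding exp_add[symmetric] using \<kappa> t0 by (simp add: field_simps)
      then have "4 * ?S * \<rho> * (exp (- \<kappa> * t) * exp (\<kappa> * (t - 0) / 2)) \<le> 4 * ?S * \<rho> * 1"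
        using S \<rho>0 by (intro mult_left_mono) auto
      then show "exp (- \<kappa> * t) * (4 * ?S * \<rho> * exp (\<kappa> * (t - 0) / 2)) \<le> 4 * ?S * \<rho>"
        by (simp add: mult.left_commute)
    qed (use S \<rho>0 t0 in auto)
    have 2: "exp_bounded M (\<lambda>\<omega>. \<Sum>k<p. (E (?s p (Suc k)) - E (?s p k)) * g (?s p (Suc k)) \<omega>) (2 / \<kappa> * (4 * ?S * \<rho>))"
    proof (rule exp_bounded_sum[where k="\<lambda>_. 4 * ?S * \<rho>"])
      fix k assume k: "k \<in> {..<p}"
      have "real (Suc k) \<le> real p" using k by auto
      then have "t * real (Suc k) \<le> t * real p" using t0 by (intro mult_left_mono) auto
      then have "?s p (Suc k) \<in> {0..t}" using t0 k by (auto simp: pos_divide_le_eq)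
      then show "exp_bounded M (g (?s p (Suc k))) (4 * ?S * \<rho>)" by (rule gb)
      show "0 \<le> E (?s p (Suc k)) - E (?s p k)"
        using E_mono[of "?s p k" "?s p (Suc k)"] t0 by (simp add: divide_right_mono)
    next
      have "(\<Sum>k<p. E (?s p (Suc k)) - E (?s p k)) = E (?s p p) - E (?s p 0)"
        by (rule sum_lessThan_telescope)
      also have "\<dots> \<le> 2 / \<kappa>"
      proof -
        have "E (?s p p) \<le> E t" using t0 by (intro E_mono) (auto simp: divide_le_eq)
        moreover have "E t = 2 / \<kappa>" by (simp add: E_def)
        moreover have "0 \<le> E (?s p 0)" using \<kappa> by (simp add: E_def)
        ultimately show ?thesis by linarith
      qed
      finally have "(\<Sum>k<p. E (?s p (Suc k)) - E (?s p k)) * (4 * ?S * \<rho>) \<le> 2 / \<kappa> * (4 * ?S * \<rho>)"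
        using S \<rho>0 by (intro mult_right_mono) auto
      then show "(\<Sum>k<p. (E (?s p (Suc k)) - E (?s p k)) * (4 * ?S * \<rho>)) \<le> 2 / \<kappa> * (4 * ?S * \<rho>)"
        by (simp add: sum_distrib_right)
    qed (use S \<rho>0 \<kappa> in auto)
    show ?thesis
    proof (cases "C = 0")
      case True
      then show ?thesis using 1 by (simp add: V_def[abs_def])
    next
      case False
      then have "exp_bounded M (V p) (4 * ?S * \<rho> + C * (2 / \<kappa> * (4 * ?S * \<rho>)))"
        unfolding V_def[abs_def] using C S \<rho>0 \<kappa>
        by (intro exp_bounded_add 1 exp_bounded_scale[OF 2]) auto
      then show ?thesis by (simp add: algebra_simps)
    qed
  qed
  have "AE \<omega> in M. \<forall>i\<in>{1..n}. continuous_on {0..} (\<lambda>t. \<beta> i t \<omega>)"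
    by (rule AE_finite_allI) (use B in \<open>auto simp: std_brownian_motion_def\<close>)
  then have lim: "AE \<omega> in M. (\<lambda>p. V p \<omega>) \<longlonglongrightarrow> J \<omega>"
  proof eventually_elim
    case (elim \<omega>)
    have cb: "continuous_on {0..t} (\<lambda>t. \<beta> i t \<omega>)" if "i \<in> {1..n}" for i
      by (rule continuous_on_subset[OF elim[rule_format, OF that]]) auto
    have cg: "continuous_on {0..t} (\<lambda>s. g s \<omega>)"
      unfolding g_def q_def bridge_def brownian_line_def
      using h by (intro continuous_intros cb continuous_on_broken_line) auto
    have "(\<lambda>p. \<Sum>k<p. g (?s p (Suc k)) \<omega> * (E (?s p (Suc k)) - E (?s p k)))
        \<longlonglongrightarrow> integral {0..t} (\<lambda>r. g r \<omega> * exp (- \<kappa> * (t - r) / 2))"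
      using t0 \<kappa> unfolding E_def
      by (intro Stieltjes_sum_tendsto cg) (auto intro!: derivative_eq_intros continuous_intros)
    then have "(\<lambda>p. V p \<omega>) \<longlonglongrightarrow> exp (- \<kappa> * t) * q 0 \<omega> + C * integral {0..t} (\<lambda>r. g r \<omega> * exp (- \<kappa> * (t - r) / 2))"
      unfolding V_def by (intro tendsto_intros) (simp only: mult.commute)
    moreover have "(\<lambda>r. g r \<omega> * exp (- \<kappa> * (t - r) / 2)) = (\<lambda>r. exp (- \<kappa> * (t - r)) * q r \<omega>)"
    proof
      fix r
      have "exp (- \<kappa> * (t - r)) = exp (- \<kappa> * (t - r) / 2) * exp (- \<kappa> * (t - r) / 2)"
        unfolding exp_add[symmetric] by simp
      then show "g r \<omega> * exp (- \<kappa> * (t - r) / 2) = exp (- \<kappa> * (t - r)) * q r \<omega>"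
        unfolding g_def by (simp only: mult_ac)
    qed
    ultimately show ?case unfolding J q_def by simp
  qed
  show ?thesis
    by (rule exp_bounded_tail[OF Vb lim A])
qed

end

subsection \<open>Deviation of the process from the level sets\<close>

text \<open>Outside the event \<open>A1\<close> of too much energy, the polygon of the noise itself
  is a control that steers into the level set, so a large distance forces the comparison error to be
  large. The two events are dependent, but a union bound is enough.\<close>

lemma (in prob_space) level_set_deviation:
  assumes bm: "indep_brownian_motions M \<beta>"
    and Qh: "\<And>i u. i \<in> {1..n} \<Longrightarrow> inner (Qh u) (ebasis i) = \<sigma> i * inner u (ebasis i)"
    and \<sigma>: "\<And>i. i \<in> {1..n} \<Longrightarrow> \<sigma> i > 0"
    and lip: "\<And>u v. norm (F u - F v) \<le> L_F * norm (u - v)"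
    and L: "0 \<le> L_F" "L_F < eigval 1" and n: "n \<ge> 1"
    and X: "mild_sde_solution M \<beta> Qh F n \<epsilon> 0 X" and \<epsilon>: "\<epsilon> > 0"
    and a: "a \<ge> 0" and h: "h > 0" and m: "m > 0" and t: "t = a + real m * h"
    and \<kappa>: "\<kappa> = eigval 1 - L_F"
    and \<rho>: "\<rho> = exp (- \<kappa> * (real m * h) / 2) * (2 / \<kappa>) + h"
    and \<theta>: "0 \<le> \<theta>" "\<theta> < 1 / 2"
    and \<delta>: "\<delta> > 0"
  shows "measure M {\<omega>\<in>space M. \<delta> \<le> infdist (X t \<omega>) (level_set Qh F n \<alpha>)}
    \<le> exp (- \<theta> * (2 * \<alpha> / \<epsilon>\<^sup>2)) * (1 / sqrt (1 - 2 * \<theta>)) ^ (n * m)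
      + 2 * exp (- (\<delta>\<^sup>2 / \<epsilon>\<^sup>2 /
          (4 * (\<Sum>i=1..n. (\<sigma> i)\<^sup>2) * (1 + (eigval n + L_F)\<^sup>2 / \<kappa> * (2 / \<kappa>)) * \<rho>)))"
proof -
  define C where "C = (eigval n + L_F)\<^sup>2 / \<kappa>"
  have \<kappa>0: "\<kappa> > 0" using L \<kappa> by simp
  have C0: "C \<ge> 0" using \<kappa>0 by (simp add: C_def)
  have t0: "t > 0" using a h m by (simp add: t add_nonneg_pos)
  have B: "std_brownian_motion M (\<beta> i)" if "i \<in> {1..n}" for i
    using bm that by (auto simp: indep_brownian_motions_def)
  have bmeas: "\<beta> i r \<in> borel_measurable M" if "i \<in> {1..n}" "r \<ge> 0" for i r
    using B[OF that(1)] that(2) by (simp add: std_brownian_motion_def)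
  let ?b = "\<lambda>i \<omega> r. \<beta> i r \<omega>"
  let ?V = "\<lambda>\<omega>. \<Sum>i=1..n. \<Sum>k<m. (\<beta> i (a + real (Suc k) * h) \<omega> - \<beta> i (a + real k * h) \<omega>)\<^sup>2 / h"
  have Vm: "?V \<in> borel_measurable M"
    using a h by (intro borel_measurable_sum borel_measurable_divide borel_measurable_power borel_measurable_diff
      borel_measurable_const bmeas) auto
  define J where "J \<omega> = exp (- \<kappa> * t) * (\<Sum>i=1..n. (\<sigma> i)\<^sup>2 * (bridge a h m (?b i \<omega>) 0)\<^sup>2)
       + C * integral {0..t} (\<lambda>s. exp (- \<kappa> * (t - s)) * (\<Sum>i=1..n. (\<sigma> i)\<^sup>2 * (bridge a h m (?b i \<omega>) s)\<^sup>2))" for \<omega>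
  define D where "D = {\<omega>\<in>space M. \<delta> \<le> infdist (X t \<omega>) (level_set Qh F n \<alpha>)}"
  define A1 where "A1 = {\<omega>\<in>space M. 2 * \<alpha> / \<epsilon>\<^sup>2 \<le> ?V \<omega>}"
  have cF: "continuous_on UNIV F" by (rule continuous_on_if_Lipschitz[OF lip L(1)])
  have Xm: "X t \<in> borel_measurable M"
  proof -
    have "X t \<in> M \<rightarrow>\<^sub>M borel_n n" using X t0 by (simp add: mild_sde_solution_def)
    then show ?thesis by (simp add: measurable_restrict_space2_iff)
  qed
  have Dm: "D \<in> sets M"
  proof -
    have "(\<lambda>\<omega>. infdist (X t \<omega>) (level_set Qh F n \<alpha>)) \<in> borel_measurable M"
      by (rule measurable_compose[OF Xm]) (intro borel_measurable_continuous_onI continuous_intros)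
    then show ?thesis unfolding D_def by measurable
  qed
  have A1m: "A1 \<in> sets M" unfolding A1_def using Vm by measurable
  have Jge: "AE \<omega> in M. \<omega> \<in> D - A1 \<longrightarrow> \<delta>\<^sup>2 / \<epsilon>\<^sup>2 \<le> J \<omega>"
  proof -
    have "AE \<omega> in M. \<forall>i\<in>{1..n}. \<beta> i 0 \<omega> = 0 \<and> continuous_on {0..} (\<lambda>t. \<beta> i t \<omega>)"
      by (rule AE_finite_allI) (use B in \<open>auto simp: std_brownian_motion_def\<close>)
    moreover have "AE \<omega> in M. solves F n (\<lambda>i s. \<epsilon> * \<sigma> i * \<beta> i s \<omega>) t (\<lambda>s. X s \<omega>)"
      by (rule sde_solves[OF bm t0 Qh cF X])
    ultimately show ?thesis
    proof eventually_elim
      case (elim \<omega>)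
      show ?case
      proof
        assume \<omega>: "\<omega> \<in> D - A1"
        have cb: "continuous_on {0..t} (?b i \<omega>)" if "i \<in> {1..n}" for i
          by (rule continuous_on_subset[OF elim(1)[rule_format, OF that, THEN conjunct2]]) auto
        let ?c = "\<lambda>i k. \<epsilon> * increments a h (?b i \<omega>) k"
        have line: "broken_line a h m (?c i) s = \<epsilon> * brownian_line a h m (?b i \<omega>) s" for i s
          by (simp add: broken_line_def brownian_line_def sum_distrib_left mult.assoc)
        \<comment> \<open>The controlled path is obtained for one fixed outcome; measurability in
          \<open>\<omega>\<close> is never asked of it, since only the inequality it yields for
          \<open>J\<close> is kept.\<close>
        have "\<exists>z. solves F n (\<lambda>i s. \<sigma> i * broken_line a h m (?c i) s) t z"
          using t0 h by (intro ex_solves[OF lip L n] continuous_intros continuous_on_broken_line) auto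
        then obtain z where z: "solves F n (\<lambda>i s. \<sigma> i * broken_line a h m (?c i) s) t z" ..
        have "(\<Sum>i=1..n. \<Sum>k<m. (?c i k)\<^sup>2 / h) = \<epsilon>\<^sup>2 * ?V \<omega>"
          by (simp add: increments_def power_mult_distrib sum_distrib_left)
        also have "\<dots> \<le> \<epsilon>\<^sup>2 * (2 * \<alpha> / \<epsilon>\<^sup>2)"
          using \<omega> by (intro mult_left_mono) (auto simp: A1_def D_def)
        also have "\<dots> = 2 * \<alpha>" using \<epsilon> by simp
        finally have e: "(\<Sum>i=1..n. \<Sum>k<m. (?c i k)\<^sup>2 / h) \<le> 2 * \<alpha>" .
        have zt: "z t \<in> level_set Qh F n \<alpha>"
          by (rule slope_control_level_set[OF Qh z a h t0 e])
        have "\<delta> \<le> infdist (X t \<omega>) (level_set Qh F n \<alpha>)" using \<omega> by (simp add: D_def)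
        also have "\<dots> \<le> dist (X t \<omega>) (z t)" by (rule infdist_le[OF zt])
        finally have "\<delta>\<^sup>2 \<le> (norm (X t \<omega> - z t))\<^sup>2"
          using \<delta> by (intro power_mono) (auto simp: dist_norm)
        also have "\<dots> \<le> \<epsilon>\<^sup>2 * J \<omega>"
        proof -
          let ?D = "\<lambda>i s. \<epsilon> * \<sigma> i * \<beta> i s \<omega> - \<sigma> i * broken_line a h m (?c i) s"
          have D: "?D i s - ?D i t = \<epsilon> * (\<sigma> i * bridge a h m (?b i \<omega>) s)" for i s
            unfolding line bridge_def t[symmetric] by (simp add: algebra_simps)
          have D2: "(?D i s - ?D i t)\<^sup>2 = \<epsilon>\<^sup>2 * ((\<sigma> i)\<^sup>2 * (bridge a h m (?b i \<omega>) s)\<^sup>2)" for i s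
            unfolding D by (simp only: power_mult_distrib)
          \<comment> \<open>Both driving paths start at 0, so the final driving error is, up to
            sign, the bridge at time 0.\<close>
          have D0: "(?D i t)\<^sup>2 = \<epsilon>\<^sup>2 * ((\<sigma> i)\<^sup>2 * (bridge a h m (?b i \<omega>) 0)\<^sup>2)" if "i \<in> {1..n}" for i
          proof -
            have "?D i 0 = 0" using elim(1) that broken_line_0[OF a h] by simp
            then have "(?D i t)\<^sup>2 = (?D i 0 - ?D i t)\<^sup>2" by (simp only: diff_0 power2_minus)
            then show ?thesis unfolding D2 .
          qed
          have "(norm (X t \<omega> - z t))\<^sup>2 \<le> exp (- \<kappa> * t) * (\<Sum>i=1..n. (?D i t)\<^sup>2)
             + C * integral {0..t} (\<lambda>s. exp (- \<kappa> * (t - s)) * (\<Sum>i=1..n. (?D i s - ?D i t)\<^sup>2))"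
            unfolding C_def \<kappa> using h
            by (intro solves_compare[OF elim(2) z lip L n t0] continuous_intros cb continuous_on_broken_line) auto
          also have "(\<Sum>i=1..n. (?D i t)\<^sup>2) = \<epsilon>\<^sup>2 * (\<Sum>i=1..n. (\<sigma> i)\<^sup>2 * (bridge a h m (?b i \<omega>) 0)\<^sup>2)"
            unfolding sum_distrib_left by (intro sum.cong refl D0)
          also have "(\<lambda>s. exp (- \<kappa> * (t - s)) * (\<Sum>i=1..n. (?D i s - ?D i t)\<^sup>2))
             = (\<lambda>s. \<epsilon>\<^sup>2 * (exp (- \<kappa> * (t - s)) * (\<Sum>i=1..n. (\<sigma> i)\<^sup>2 * (bridge a h m (?b i \<omega>) s)\<^sup>2)))"
            unfolding D2 sum_distrib_left[symmetric] by (simp only: mult.left_commute)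
          finally show ?thesis
            unfolding J_def by (simp add: algebra_simps)
        qed
        finally show "\<delta>\<^sup>2 / \<epsilon>\<^sup>2 \<le> J \<omega>" using \<epsilon> by (simp add: pos_divide_le_eq mult.commute)
      qed
    qed
  qed
  have "measure M D \<le> measure M (A1 \<union> (D - A1))"
    using Dm A1m by (intro finite_measure_mono) auto
  also have "\<dots> \<le> measure M A1 + measure M (D - A1)"
    using Dm A1m by (intro measure_Un_le) auto
  also have "measure M A1 \<le> exp (- \<theta> * (2 * \<alpha> / \<epsilon>\<^sup>2)) * (1 / sqrt (1 - 2 * \<theta>)) ^ (n * m)"
    unfolding A1_def by (rule brownian_energies_tail[OF bm a h \<theta>])
  also have "measure M (D - A1) \<le> 2 * exp (- (\<delta>\<^sup>2 / \<epsilon>\<^sup>2 /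
          (4 * (\<Sum>i=1..n. (\<sigma> i)\<^sup>2) * (1 + C * (2 / \<kappa>)) * \<rho>)))"
    using Dm A1m by (intro weighted_bridge_tail[OF bm a h m \<kappa>0 t \<rho> C0 n \<sigma> J_def _ Jge]) auto
  finally show ?thesis by (simp add: D_def C_def)
qed

section \<open>Choice of window, mesh and noise threshold\<close>

text \<open>The mesh takes half of \<open>\<eta>\<close>; with \<open>h\<close> then fixed, the
  window \<open>m * h\<close> is made long enough for the exponential to take the other
  half.\<close>

lemma small_mesh_exists:
  fixes \<kappa> \<eta> :: real
  assumes "\<kappa> > 0" "\<eta> > 0"
  shows "\<exists>h m. h > 0 \<and> m > (0::nat) \<and> exp (- \<kappa> * (real m * h) / 2) * (2 / \<kappa>) + h \<le> \<eta>"
proof -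
  define h where "h = \<eta> / 2"
  have h: "h > 0" using assms by (simp add: h_def)
  have "(\<lambda>m. exp (- \<kappa> * (real m * h) / 2) * (2 / \<kappa>)) \<longlonglongrightarrow> 0"
  proof -
    have "(\<lambda>m. exp (- (\<kappa> * h / 2)) ^ m * (2 / \<kappa>)) \<longlonglongrightarrow> 0 * (2 / \<kappa>)"
      using assms h by (intro tendsto_mult tendsto_const LIMSEQ_power_zero) auto
    moreover have "exp (- (\<kappa> * h / 2)) ^ m = exp (- \<kappa> * (real m * h) / 2)" for m
      unfolding exp_of_nat_mult[symmetric] by (simp add: algebra_simps)
    ultimately show ?thesis by simp
  qed
  then have "\<forall>\<^sub>F m in sequentially. exp (- \<kappa> * (real m * h) / 2) * (2 / \<kappa>) < \<eta> / 2"
    by (rule order_tendstoD) (use assms in simp)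
  then obtain m0 where m0: "\<And>m. m \<ge> m0 \<Longrightarrow> exp (- \<kappa> * (real m * h) / 2) * (2 / \<kappa>) < \<eta> / 2"
    by (auto simp: eventually_sequentially)
  have "exp (- \<kappa> * (real (Suc m0) * h) / 2) * (2 / \<kappa>) + h \<le> \<eta>"
    using m0[of "Suc m0"] by (simp add: h_def)
  then show ?thesis using h by blast
qed

text \<open>For \<open>\<epsilon>^2 \<le> \<gamma> / (K + 1)\<close> the inequality
  \<open>1 + x \<le> exp x\<close> gives
  \<open>K \<le> exp (\<gamma> / \<epsilon>^2)\<close>.\<close>

lemma eventually_exp_absorbs:
  fixes K c \<gamma> :: real
  assumes "\<gamma> > 0" "K \<ge> 0"
  shows "\<exists>\<epsilon>0>0. \<forall>\<epsilon>. 0 < \<epsilon> \<and> \<epsilon> \<le> \<epsilon>0 \<longrightarrow> K * exp (- (c + \<gamma>) / \<epsilon>\<^sup>2) \<le> exp (- c / \<epsilon>\<^sup>2)"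
proof -
  define \<epsilon>0 where "\<epsilon>0 = sqrt (\<gamma> / (K + 1))"
  have e0: "\<epsilon>0 > 0" using assms by (simp add: \<epsilon>0_def)
  have "K * exp (- (c + \<gamma>) / \<epsilon>\<^sup>2) \<le> exp (- c / \<epsilon>\<^sup>2)" if e: "0 < \<epsilon>" "\<epsilon> \<le> \<epsilon>0" for \<epsilon>
  proof -
    have "\<epsilon>\<^sup>2 \<le> \<epsilon>0\<^sup>2" using e by (intro power_mono) auto
    also have "\<dots> = \<gamma> / (K + 1)" using assms by (simp add: \<epsilon>0_def)
    finally have "\<epsilon>\<^sup>2 * (K + 1) \<le> \<gamma>" using assms by (simp add: field_simps)
    then have "K + 1 \<le> \<gamma> / \<epsilon>\<^sup>2" using e by (simp add: field_simps)
    then have "K \<le> exp (\<gamma> / \<epsilon>\<^sup>2)" using exp_ge_add_one_self[of "\<gamma> / \<epsilon>\<^sup>2"] by linarith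
    then have "K * exp (- (c + \<gamma>) / \<epsilon>\<^sup>2) \<le> exp (\<gamma> / \<epsilon>\<^sup>2) * exp (- (c + \<gamma>) / \<epsilon>\<^sup>2)"
      by (intro mult_right_mono) auto
    also have "\<dots> = exp (- c / \<epsilon>\<^sup>2)"
      unfolding exp_add[symmetric] by (simp add: add_divide_distrib[symmetric])
    finally show ?thesis .
  qed
  then show ?thesis using e0 by blast
qed

text \<open>
  The window length \<open>T\<close> and the mesh are chosen before \<open>\<epsilon>\<close>, which makes the bound uniform in \<open>t\<close>.
\<close>

lemma (in prob_space) uniform_level_set_deviation:
  assumes bm: "indep_brownian_motions M \<beta>"
    and Qh: "\<And>i u. i \<in> {1..n} \<Longrightarrow> inner (Qh u) (ebasis i) = \<sigma> i * inner u (ebasis i)"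
    and \<sigma>: "\<And>i. i \<in> {1..n} \<Longrightarrow> \<sigma> i > 0"
    and lip: "\<And>u v. norm (F u - F v) \<le> L_F * norm (u - v)"
    and L: "0 \<le> L_F" "L_F < eigval 1" and n: "n \<ge> 1"
    and X: "\<And>\<epsilon>. \<epsilon> > 0 \<Longrightarrow> mild_sde_solution M \<beta> Qh F n \<epsilon> 0 (X \<epsilon>)"
    and \<alpha>: "\<gamma> > 0" "\<gamma> < \<alpha>" and \<delta>: "\<delta> > 0"
  shows "\<exists>\<epsilon>0>0. \<exists>T. \<forall>\<epsilon> t. 0 < \<epsilon> \<and> \<epsilon> \<le> \<epsilon>0 \<and> T \<le> t \<longrightarrow>
     measure M {\<omega>\<in>space M. \<delta> \<le> infdist (X \<epsilon> t \<omega>) (level_set Qh F n \<alpha>)} \<le> exp (- (\<alpha> - \<gamma>) / \<epsilon>\<^sup>2)"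
proof -
  define \<kappa> where "\<kappa> = eigval 1 - L_F"
  have \<kappa>: "\<kappa> > 0" using L by (simp add: \<kappa>_def)
  define G where "G = 4 * (\<Sum>i=1..n. (\<sigma> i)\<^sup>2) * (1 + (eigval n + L_F)\<^sup>2 / \<kappa> * (2 / \<kappa>))"
  have G: "G > 0"
    unfolding G_def using n \<kappa> by (intro mult_pos_pos sum_pos zero_less_power \<sigma> add_pos_nonneg) auto
  \<comment> \<open>Chosen so that \<open>2 * \<theta> * \<alpha> = \<alpha> - \<gamma> / 2\<close>,
    while \<open>\<theta>\<close> stays strictly below 1/2, where the chi-square moment is
    finite.\<close>
  define \<theta> where "\<theta> = (\<alpha> - \<gamma> / 2) / (2 * \<alpha>)"
  have \<theta>: "0 \<le> \<theta>" "\<theta> < 1 / 2" using \<alpha> by (auto simp: \<theta>_def field_simps)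
  \<comment> \<open>This smallness gives \<open>\<delta>^2 / (G * \<rho>) \<ge> \<alpha>\<close>, so
    the bridge term decays at least like \<open>exp (- \<alpha> / \<epsilon>^2)\<close>. There is no
    circularity, as \<open>G\<close> does not involve \<open>h\<close> or \<open>m\<close>.\<close>
  obtain h m where hm: "h > 0" "m > (0::nat)"
    "exp (- \<kappa> * (real m * h) / 2) * (2 / \<kappa>) + h \<le> \<delta>\<^sup>2 / (G * \<alpha>)"
    using small_mesh_exists[OF \<kappa>, of "\<delta>\<^sup>2 / (G * \<alpha>)"] G \<alpha> \<delta> by auto
  define \<rho> where "\<rho> = exp (- \<kappa> * (real m * h) / 2) * (2 / \<kappa>) + h"
  have \<rho>: "\<rho> > 0" using hm(1) \<kappa> by (simp add: \<rho>_def add_nonneg_pos)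
  have G\<rho>: "G * \<rho> * \<alpha> \<le> \<delta>\<^sup>2"
  proof -
    have "(G * \<alpha>) * \<rho> \<le> (G * \<alpha>) * (\<delta>\<^sup>2 / (G * \<alpha>))"
      using hm(3) G \<alpha> by (intro mult_left_mono) (auto simp: \<rho>_def)
    then show ?thesis using G \<alpha> by (simp add: algebra_simps)
  qed
  define K where "K = (1 / sqrt (1 - 2 * \<theta>)) ^ (n * m)"
  have K: "K \<ge> 0" using \<theta> by (simp add: K_def)
  obtain \<epsilon>0 where \<epsilon>0: "\<epsilon>0 > 0" and absorb: "\<And>\<epsilon>. 0 < \<epsilon> \<Longrightarrow> \<epsilon> \<le> \<epsilon>0 \<Longrightarrow>
     (K + 2) * exp (- ((\<alpha> - \<gamma>) + \<gamma> / 2) / \<epsilon>\<^sup>2) \<le> exp (- (\<alpha> - \<gamma>) / \<epsilon>\<^sup>2)"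
    using eventually_exp_absorbs[of "\<gamma> / 2" "K + 2" "\<alpha> - \<gamma>"] \<alpha> K by auto
  show ?thesis
  proof (rule exI[of _ \<epsilon>0], intro conjI \<epsilon>0 exI[of _ "real m * h"] allI impI)
    fix \<epsilon> t :: real assume et: "0 < \<epsilon> \<and> \<epsilon> \<le> \<epsilon>0 \<and> real m * h \<le> t"
    then have \<epsilon>: "\<epsilon> > 0" and a: "t - real m * h \<ge> 0" and t: "t = (t - real m * h) + real m * h" by auto
    have "measure M {\<omega>\<in>space M. \<delta> \<le> infdist (X \<epsilon> t \<omega>) (level_set Qh F n \<alpha>)}
       \<le> exp (- \<theta> * (2 * \<alpha> / \<epsilon>\<^sup>2)) * K + 2 * exp (- (\<delta>\<^sup>2 / \<epsilon>\<^sup>2 / (G * \<rho>)))"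
      unfolding K_def G_def
      by (rule level_set_deviation[OF bm Qh \<sigma> lip L n X[OF \<epsilon>] \<epsilon> a hm(1,2) t \<kappa>_def \<rho>_def \<theta> \<delta>])
    also have "exp (- \<theta> * (2 * \<alpha> / \<epsilon>\<^sup>2)) = exp (- ((\<alpha> - \<gamma>) + \<gamma> / 2) / \<epsilon>\<^sup>2)"
    proof -
      have "\<theta> * (2 * \<alpha>) = \<alpha> - \<gamma> / 2" using \<alpha> by (simp add: \<theta>_def)
      then have "- \<theta> * (2 * \<alpha> / \<epsilon>\<^sup>2) = - (\<alpha> - \<gamma> / 2) / \<epsilon>\<^sup>2"
        by (metis minus_divide_left minus_mult_left times_divide_eq_right)
      then show ?thesis by simp
    qed
    also have "exp (- (\<delta>\<^sup>2 / \<epsilon>\<^sup>2 / (G * \<rho>))) \<le> exp (- ((\<alpha> - \<gamma>) + \<gamma> / 2) / \<epsilon>\<^sup>2)"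
    proof -
      have "\<alpha> - \<gamma> + \<gamma> / 2 \<le> \<alpha>" using \<alpha> by simp
      also have "\<dots> \<le> \<delta>\<^sup>2 / (G * \<rho>)" using G\<rho> G \<rho> by (simp add: pos_le_divide_eq mult.commute)
      finally have "(\<alpha> - \<gamma> + \<gamma> / 2) / \<epsilon>\<^sup>2 \<le> \<delta>\<^sup>2 / (G * \<rho>) / \<epsilon>\<^sup>2"
        by (intro divide_right_mono) auto
      moreover have "\<delta>\<^sup>2 / (G * \<rho>) / \<epsilon>\<^sup>2 = \<delta>\<^sup>2 / \<epsilon>\<^sup>2 / (G * \<rho>)" by (simp add: mult.commute)
      ultimately have "- (\<delta>\<^sup>2 / \<epsilon>\<^sup>2 / (G * \<rho>)) \<le> - ((\<alpha> - \<gamma> + \<gamma> / 2) / \<epsilon>\<^sup>2)" by linarith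
      then show ?thesis by (simp only: exp_le_cancel_iff minus_divide_left)
    qed
    finally have "measure M {\<omega>\<in>space M. \<delta> \<le> infdist (X \<epsilon> t \<omega>) (level_set Qh F n \<alpha>)}
       \<le> (K + 2) * exp (- ((\<alpha> - \<gamma>) + \<gamma> / 2) / \<epsilon>\<^sup>2)"
      by (simp add: algebra_simps)
    also have "\<dots> \<le> exp (- (\<alpha> - \<gamma>) / \<epsilon>\<^sup>2)" using et by (intro absorb) auto
    finally show "measure M {\<omega>\<in>space M. \<delta> \<le> infdist (X \<epsilon> t \<omega>) (level_set Qh F n \<alpha>)} \<le> exp (- (\<alpha> - \<gamma>) / \<epsilon>\<^sup>2)" .
  qed
qed

subsection \<open>Passage to the weak limit\<close>

lemma sets_time_average: "sets (time_average M n X t) = sets (borel_n n)"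
proof -
  have "sigma_sets (H_n n) (sets (borel_n n)) = sets (borel_n n)"
    using sets.sigma_sets_eq[of "borel_n n"] by (simp add: space_restrict_space)
  moreover have "sets (borel_n n) \<subseteq> Pow (H_n n)"
    using sets.space_closed[of "borel_n n"] by (simp add: space_restrict_space)
  ultimately show ?thesis by (simp add: time_average_def)
qed

text \<open>\<open>measure_of\<close> yields the zero measure when its set function is not countably
  additive, so the upper bound holds in either case, without proving measurability of the integrand
  in \<open>s\<close>.\<close>

lemma emeasure_time_average_le:
  "emeasure (time_average M n X t) B
    \<le> ennreal (1 / t) * (\<integral>\<^sup>+s\<in>{0..t}. emeasure M {\<omega>\<in>space M. X s \<omega> \<in> B} \<partial>lborel)"
  unfolding time_average_def by (subst emeasure_measure_of_conv) auto

text \<open>Times before \<open>T\<close> are bounded by probability 1 and contribute at most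
  \<open>T / t\<close> to the average; later times contribute at most \<open>c\<close>.\<close>

lemma (in prob_space) integral_time_average_le:
  fixes f :: "L2 \<Rightarrow> real"
  assumes t: "t > 0" and T: "T \<ge> 0" and c: "c \<ge> 0"
    and B: "B \<in> sets (borel_n n)" and f: "continuous_on UNIV f"
    and fB: "\<And>y. y \<in> H_n n \<Longrightarrow> 0 \<le> f y \<and> f y \<le> indicator B y"
    and late: "\<And>s. T \<le> s \<Longrightarrow> measure M {\<omega>\<in>space M. X s \<omega> \<in> B} \<le> c"
  shows "integral\<^sup>L (time_average M n X t) f \<le> T / t + c"
proof -
  let ?\<nu> = "time_average M n X t"
  have sp: "space ?\<nu> = H_n n"
    using sets_eq_imp_space_eq[OF sets_time_average] by (simp add: space_restrict_space)
  have "f \<in> borel_measurable (borel_n n)"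
    by (intro measurable_restrict_space1 borel_measurable_continuous_onI f)
  then have fm: "f \<in> borel_measurable ?\<nu>"
    using measurable_cong_sets[OF sets_time_average refl] by blast
  have "(\<integral>\<^sup>+s\<in>{0..t}. emeasure M {\<omega>\<in>space M. X s \<omega> \<in> B} \<partial>lborel)
     \<le> (\<integral>\<^sup>+s. indicator {0..T} s + ennreal c * indicator {0..t} s \<partial>lborel)"
  proof (rule nn_integral_mono)
    fix s :: real
    show "emeasure M {\<omega>\<in>space M. X s \<omega> \<in> B} * indicator {0..t} s
       \<le> indicator {0..T} s + ennreal c * indicator {0..t} s"
    proof (cases "T \<le> s")
      case True
      then have "emeasure M {\<omega>\<in>space M. X s \<omega> \<in> B} \<le> ennreal c"
        using late by (simp add: emeasure_eq_measure ennreal_leI)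
      then have "emeasure M {\<omega>\<in>space M. X s \<omega> \<in> B} * indicator {0..t} s \<le> ennreal c * indicator {0..t} s"
        by (rule mult_right_mono) simp
      then show ?thesis by (rule order_trans) simp
    next
      case False
      have "emeasure M {\<omega>\<in>space M. X s \<omega> \<in> B} * indicator {0..t} s \<le> 1 * indicator {0..T} s"
        using False emeasure_le_1 by (auto simp: indicator_def)
      then show ?thesis by (simp add: add_increasing2)
    qed
  qed
  also have "\<dots> = ennreal T + ennreal c * ennreal t"
    using T t by (subst nn_integral_add) (auto simp: nn_integral_cmult)
  also have "\<dots> = ennreal (T + c * t)"
    using T t c by (simp add: ennreal_mult)
  finally have "ennreal (1 / t) * (\<integral>\<^sup>+s\<in>{0..t}. emeasure M {\<omega>\<in>space M. X s \<omega> \<in> B} \<partial>lborel)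
    \<le> ennreal (1 / t) * ennreal (T + c * t)"
    by (rule mult_left_mono) simp
  also have "\<dots> = ennreal (1 / t * (T + c * t))"
    using T t c by (intro ennreal_mult[symmetric]) auto
  also have "1 / t * (T + c * t) = T / t + c"
    using t by (simp add: field_simps)
  finally have Bb: "emeasure ?\<nu> B \<le> ennreal (T / t + c)"
    using emeasure_time_average_le order_trans by blast
  have "(\<integral>\<^sup>+y. ennreal (f y) \<partial>?\<nu>) \<le> (\<integral>\<^sup>+y. indicator B y \<partial>?\<nu>)"
  proof (rule nn_integral_mono)
    fix y assume "y \<in> space ?\<nu>"
    then have "ennreal (f y) \<le> ennreal (indicator B y)" using fB sp by (intro ennreal_leI) auto
    then show "ennreal (f y) \<le> indicator B y" by (simp add: ennreal_indicator)
  qed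
  also have "\<dots> = emeasure ?\<nu> B"
    using B by (intro nn_integral_indicator) (simp add: sets_time_average)
  also note Bb
  finally have "enn2real (\<integral>\<^sup>+y. ennreal (f y) \<partial>?\<nu>) \<le> T / t + c"
    using T t c by (intro enn2real_leI) auto
  moreover have "integral\<^sup>L ?\<nu> f = enn2real (\<integral>\<^sup>+y. ennreal (f y) \<partial>?\<nu>)"
    using fB sp by (intro integral_eq_nn_integral fm AE_I2) auto
  ultimately show ?thesis by simp
qed

text \<open>Weak convergence tests continuous functions only, so the indicator of the far set is
  dominated by a cutoff of the distance. The cutoff is supported where the distance is at least
  \<open>\<delta> / 2\<close>, which is why the uniform estimate is asked for at that
  radius.\<close>

lemma (in prob_space) weak_limit_measure_le:
  assumes \<mu>: "weak_limit_of_time_averages M n X \<mu>" and \<delta>: "\<delta> > 0" and c: "c \<ge> 0"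
    and late: "\<And>s. T \<le> s \<Longrightarrow> measure M {\<omega>\<in>space M. X s \<omega> \<in> H_n n \<and> \<delta> / 2 \<le> infdist (X s \<omega>) K} \<le> c"
  shows "measure \<mu> {y \<in> H_n n. \<delta> \<le> infdist y K} \<le> c"
proof -
  from \<mu> obtain \<tau> where pr: "prob_space \<mu>" and s\<mu>: "sets \<mu> = sets (borel_n n)"
    and \<tau>: "\<And>i :: nat. 0 < \<tau> i" "filterlim \<tau> at_top sequentially"
    and w: "weakly_converges_n n (\<lambda>i. time_average M n X (\<tau> i)) \<mu>"
    unfolding weak_limit_of_time_averages_def by blast
  interpret \<mu>: prob_space \<mu> by (rule pr)
  \<comment> \<open>Piecewise linear in the distance: 0 up to \<open>\<delta> / 2\<close>, 1 from
    \<open>\<delta>\<close> on.\<close>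
  define f :: "L2 \<Rightarrow> real" where "f y = max 0 (min 1 (2 * infdist y K / \<delta> - 1))" for y
  have cf: "continuous_on UNIV f"
    unfolding f_def using \<delta> by (intro continuous_intros) auto
  have f01: "0 \<le> f y" "f y \<le> 1" for y by (auto simp: f_def)
  have f_hi: "f y = 1" if "\<delta> \<le> infdist y K" for y
    using that \<delta> by (simp add: f_def field_simps)
  have f_lo: "f y = 0" if "\<not> \<delta> / 2 \<le> infdist y K" for y
    using that \<delta> by (simp add: f_def field_simps)
  have meas: "{y \<in> H_n n. d \<le> infdist y K} \<in> sets (borel_n n)" for d
  proof -
    have "closed {y. d \<le> infdist y K}"
      by (intro closed_Collect_le continuous_intros)
    then have "H_n n \<inter> {y. d \<le> infdist y K} \<in> sets (borel_n n)"
      by (auto simp: sets_restrict_space)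
    then show ?thesis by (simp add: Int_def)
  qed
  have lim: "(\<lambda>i. integral\<^sup>L (time_average M n X (\<tau> i)) f) \<longlonglongrightarrow> integral\<^sup>L \<mu> f"
  proof -
    have "bounded (f ` H_n n)"
      using f01 by (intro boundedI[of _ 1]) auto
    then show ?thesis
      using w cf continuous_on_subset unfolding weakly_converges_n_def by blast
  qed
  have "(\<lambda>i. max T 0 / \<tau> i + c) \<longlonglongrightarrow> 0 + c"
    by (intro tendsto_add tendsto_const tendsto_divide_0[OF tendsto_const]
        filterlim_at_top_imp_at_infinity \<tau>(2))
  moreover have "integral\<^sup>L (time_average M n X (\<tau> i)) f \<le> max T 0 / \<tau> i + c" for i
  proof (rule integral_time_average_le[OF \<tau>(1) _ c meas[of "\<delta> / 2"] cf])
    fix s assume "max T 0 \<le> s"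
    then show "measure M {\<omega>\<in>space M. X s \<omega> \<in> {y \<in> H_n n. \<delta> / 2 \<le> infdist y K}} \<le> c"
      using late by simp
  qed (use f01 f_lo in \<open>auto simp: indicator_def\<close>)
  ultimately have le: "integral\<^sup>L \<mu> f \<le> c"
    using LIMSEQ_le[OF lim] by fastforce
  have "f \<in> borel_measurable (borel_n n)"
    by (intro measurable_restrict_space1 borel_measurable_continuous_onI cf)
  then have fm: "f \<in> borel_measurable \<mu>"
    using measurable_cong_sets[OF s\<mu> refl] by blast
  have "measure \<mu> {y \<in> H_n n. \<delta> \<le> infdist y K} = (\<integral>y. indicator {y \<in> H_n n. \<delta> \<le> infdist y K} y \<partial>\<mu>)"
  proof -
    have "{y \<in> H_n n. \<delta> \<le> infdist y K} \<in> sets \<mu>" using meas s\<mu> by simp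
    then show ?thesis by simp
  qed
  also have "\<dots> \<le> integral\<^sup>L \<mu> f"
  proof (rule integral_mono)
    show "integrable \<mu> (indicator {y \<in> H_n n. \<delta> \<le> infdist y K} :: L2 \<Rightarrow> real)"
      using meas s\<mu> by (simp add: \<mu>.emeasure_finite less_top[symmetric])
    show "integrable \<mu> f"
      using f01 by (intro \<mu>.integrable_const_bound[of _ 1] fm) auto
    show "indicator {y \<in> H_n n. \<delta> \<le> infdist y K} y \<le> f y" for y
      using f01 f_hi by (auto simp: indicator_def)
  qed
  finally show ?thesis using le by simp
qed

text \<open>\<open>infdist\<close> to an empty set is 0, but this convention does not intervene: as
  \<open>F 0 = 0\<close>, the zero control keeps the path at 0, so 0 lies in the level set.\<close>

theorem theorem3p11:
  fixes Q Qh F :: "L2 \<Rightarrow> L2"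
    and F' :: "L2 \<Rightarrow> L2 \<Rightarrow> L2"
    and q :: "nat \<Rightarrow> real"
    and L_F L \<alpha> \<delta> \<gamma> :: real
    and n :: nat
    and M :: "'w measure"
    and \<beta> :: "nat \<Rightarrow> real \<Rightarrow> 'w \<Rightarrow> real"
    and X :: "real \<Rightarrow> real \<Rightarrow> 'w \<Rightarrow> L2"
    and \<mu> :: "real \<Rightarrow> L2 measure"
  assumes "bounded_linear Q" and "self_adjoint Q"
    and "\<And>u. u \<noteq> 0 \<Longrightarrow> inner (Q u) u > 0"
    and "\<And>i. i \<ge> 1 \<Longrightarrow> q i > 0 \<and> Q (ebasis i) = q i *\<^sub>R ebasis i"
    and "positive_sqrt Qh Q"
    and "dom_laplace \<subseteq> range Qh"
    and "range Qh \<subseteq> dom_frac (1/2)" and "hilbert_schmidt (\<lambda>u. frac_laplace (1/2) (Qh u))"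
    and "bounded_linear (\<lambda>u. inv Qh (neg_laplace_inv u))"
    and "\<And>u. (F has_derivative F' u) (at u)"
    and "L_F > 0" and "L > 0"
    and "\<And>u v. norm (F u - F v) \<le> L_F * norm (u - v)"
    and "\<And>u. u \<in> Hdot 1 \<Longrightarrow> F u \<in> Hdot 1 \<and> Hdot_norm 1 (F u) \<le> L * (1 + Hdot_norm 1 u)"
    and "\<And>u v. u \<in> Hdot 2 \<Longrightarrow> v \<in> Hdot 2 \<Longrightarrow>
           F' u v \<in> Hdot 2 \<and> Hdot_norm 2 (F' u v) \<le> L * (1 + (Hdot_norm 2 u)\<^sup>2) * Hdot_norm 2 v"
    and "F 0 = 0" and "L_F < eigval 1"
    and "n \<ge> 1"
    and "prob_space M" and "indep_brownian_motions M \<beta>"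
    and "\<And>\<epsilon>. \<epsilon> > 0 \<Longrightarrow> mild_sde_solution M \<beta> Qh F n \<epsilon> 0 (X \<epsilon>)"
    and "\<And>\<epsilon>. \<epsilon> > 0 \<Longrightarrow> weak_limit_of_time_averages M n (X \<epsilon>) (\<mu> \<epsilon>)"
    and "\<alpha> \<ge> 0" and "\<delta> > 0" and "\<gamma> > 0"
  shows "\<exists>\<epsilon>0>0. \<forall>\<epsilon>. 0 < \<epsilon> \<and> \<epsilon> \<le> \<epsilon>0 \<longrightarrow>
           measure (\<mu> \<epsilon>) {y \<in> H_n n. infdist y (level_set Qh F n \<alpha>) \<ge> \<delta>}
             \<le> exp (- (\<alpha> - \<gamma>) / \<epsilon>\<^sup>2)"
proof (cases "\<alpha> \<le> \<gamma>")
  \<comment> \<open>The right-hand side is at least 1 here. In the remaining case \<alpha> is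
    positive, so the choice of the moment parameter, which divides by it, makes sense.\<close>
  case True
  note \<mu> = assms(22)
  show ?thesis
  proof (intro exI[of _ 1] conjI allI impI)
    fix \<epsilon> :: real assume \<epsilon>: "0 < \<epsilon> \<and> \<epsilon> \<le> 1"
    have "prob_space (\<mu> \<epsilon>)" using \<mu> \<epsilon> by (simp add: weak_limit_of_time_averages_def)
    then have "measure (\<mu> \<epsilon>) {y \<in> H_n n. \<delta> \<le> infdist y (level_set Qh F n \<alpha>)} \<le> 1"
      by (rule prob_space.prob_le_1)
    also have "1 \<le> exp (- (\<alpha> - \<gamma>) / \<epsilon>\<^sup>2)" using True by simp
    finally show "measure (\<mu> \<epsilon>) {y \<in> H_n n. \<delta> \<le> infdist y (level_set Qh F n \<alpha>)} \<le> exp (- (\<alpha> - \<gamma>) / \<epsilon>\<^sup>2)" .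
  qed simp
next
  case False
  note Q = assms(4) and Qh = assms(5) and L = assms(11) and lip = assms(13) and L1 = assms(17)
    and n = assms(18) and bm = assms(20) and X = assms(21) and \<mu> = assms(22) and pos = assms(23-25)
  interpret prob_space M by (rule assms(19))
  have coord: "inner (Qh u) (ebasis i) = sqrt (q i) * inner u (ebasis i)" if "i \<in> {1..n}" for i u
    by (rule inner_positive_sqrt_ebasis[OF Qh]) (use Q[of i] that in auto)
  have sq: "sqrt (q i) > 0" if "i \<in> {1..n}" for i using Q[of i] that by simp
  have "\<exists>\<epsilon>0>0. \<exists>T. \<forall>\<epsilon> t. 0 < \<epsilon> \<and> \<epsilon> \<le> \<epsilon>0 \<and> T \<le> t \<longrightarrow>
     measure M {\<omega>\<in>space M. \<delta> / 2 \<le> infdist (X \<epsilon> t \<omega>) (level_set Qh F n \<alpha>)} \<le> exp (- (\<alpha> - \<gamma>) / \<epsilon>\<^sup>2)"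
    by (rule uniform_level_set_deviation[OF bm coord sq lip _ L1 n X]) (use L pos False in auto)
  then obtain \<epsilon>0 T where \<epsilon>0: "\<epsilon>0 > 0" and dev: "\<And>\<epsilon> t. 0 < \<epsilon> \<Longrightarrow> \<epsilon> \<le> \<epsilon>0 \<Longrightarrow> T \<le> t \<Longrightarrow>
     measure M {\<omega>\<in>space M. \<delta> / 2 \<le> infdist (X \<epsilon> t \<omega>) (level_set Qh F n \<alpha>)} \<le> exp (- (\<alpha> - \<gamma>) / \<epsilon>\<^sup>2)"
    by blast
  show ?thesis
  proof (intro exI[of _ \<epsilon>0] conjI \<epsilon>0 allI impI)
    fix \<epsilon> assume \<epsilon>: "0 < \<epsilon> \<and> \<epsilon> \<le> \<epsilon>0"
    show "measure (\<mu> \<epsilon>) {y \<in> H_n n. \<delta> \<le> infdist y (level_set Qh F n \<alpha>)} \<le> exp (- (\<alpha> - \<gamma>) / \<epsilon>\<^sup>2)"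
    proof (rule weak_limit_measure_le[OF \<mu> pos(2), where T="max T 0"])
      fix s assume s: "max T 0 \<le> s"
      have "X \<epsilon> s \<in> M \<rightarrow>\<^sub>M borel_n n" using X \<epsilon> s by (simp add: mild_sde_solution_def)
      then have "X \<epsilon> s \<omega> \<in> H_n n" if "\<omega> \<in> space M" for \<omega>
        using measurable_space[OF _ that, of "X \<epsilon> s" "borel_n n"] by (simp add: space_restrict_space)
      then have "{\<omega>\<in>space M. X \<epsilon> s \<omega> \<in> H_n n \<and> \<delta> / 2 \<le> infdist (X \<epsilon> s \<omega>) (level_set Qh F n \<alpha>)}
         = {\<omega>\<in>space M. \<delta> / 2 \<le> infdist (X \<epsilon> s \<omega>) (level_set Qh F n \<alpha>)}" by auto
      then show "measure M {\<omega>\<in>space M. X \<epsilon> s \<omega> \<in> H_n n \<and> \<delta> / 2 \<le> infdist (X \<epsilon> s \<omega>) (level_set Qh F n \<alpha>)}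
         \<le> exp (- (\<alpha> - \<gamma>) / \<epsilon>\<^sup>2)"
        using dev[of \<epsilon> s] \<epsilon> s by simp
    qed (use \<epsilon> in auto)
  qed
qed

end
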